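(* Let $K$ be a field and let $\mathcal{C}$ be a $3$-uniform clutter on $[n]$ such that $F=\{1,2,3\}\in\mathcal{C}$ and, for all $r$ with $3<r\le n$, $\{\{1,2,r\},\{1,3,r\},\{2,3,r\}\}\nsubseteq\mathcal{C}$. Let $\mathcal{C}_1=\mathcal{C}\setminus\{F\}$ and let $\mathcal{C}'=\mathcal{C}_1\cup\{\{0,1,2\},\{0,1,3\},\{0,2,3\}\}$, a $3$-uniform clutter on the vertex set $\{0,1,\dots,n\}$. Let $I=I(\bar{\mathcal{C}})$ and $J=I(\bar{\mathcal{C}'})$ be the circuit ideals in the polynomial ring $S=K[x_0,x_1,\dots,x_n]$, where $\bar{\mathcal{C}}$ is the complement of $\mathcal{C}$ in the set of $3$-subsets of $[n]$ and $\bar{\mathcal{C}'}$ is the complement of $\mathcal{C}'$ in the set of $3$-subsets of $\{0,1,\dots,n\}$. Assume $I\neq0$ (equivalently, $n\ge4$). Then $\operatorname{reg}(I)=\operatorname{reg}(J)$.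
   Context: $[n]=\{1,\dots,n\}$. A $3$-uniform clutter on a vertex set $V$ is a set of $3$-element subsets of $V$ (called circuits). For a $3$-uniform clutter $\mathcal{D}$ with vertices in $\{0,1,\dots,n\}$, $I(\mathcal{D})=(\prod_{i\in F}x_i : F\in\mathcal{D})\subset S$, and $I(\varnothing)=0$. For a nonzero homogeneous ideal $I\subset S$, $\operatorname{reg}(I)=\sup\{j-i : \beta^S_{i,j}(I)\neq0\}$ is the Castelnuovo-Mumford regularity, where $\beta^S_{i,j}(I)$ are the graded Betti numbers of $I$ as an $S$-module. *)

theory Defs
  imports
    Complex_Main
    "HOL-Library.Poly_Mapping"
    "HOL-Library.Extended_Real"
    "HOL-Algebra.Ideal"
begin

definition three_subsets :: "nat set \<Rightarrow> nat set set"
  where "three_subsets V = {F. F \<subseteq> V \<and> card F = 3}"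

definition three_uniform_clutter :: "nat set \<Rightarrow> nat set set \<Rightarrow> bool"
  where "three_uniform_clutter V C \<longleftrightarrow> C \<subseteq> three_subsets V"

definition clutter_complement :: "nat set \<Rightarrow> nat set set \<Rightarrow> nat set set"
  where "clutter_complement V C = three_subsets V - C"

text \<open>
  Monomials are finitely supported exponent vectors, polynomials are finitely supported
  coefficient families. The type has one variable for every natural number; the ring
  \<open>K[x\<^sub>0, \<dots>, x\<^sub>n]\<close> is carved out as the carrier of a ring record.
\<close>

type_synonym 'a mpoly = "(nat \<Rightarrow>\<^sub>0 nat) \<Rightarrow>\<^sub>0 'a"

definition var :: "nat \<Rightarrow> 'a::field mpoly"
  where "var i = Poly_Mapping.single (Poly_Mapping.single i 1) 1"

definition poly_ring :: "nat \<Rightarrow> 'a::field mpoly ring"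
  where "poly_ring n =
    \<lparr>carrier = {p. \<forall>m \<in> Poly_Mapping.keys p. Poly_Mapping.keys m \<subseteq> {0..n}},
     mult = (*), one = 1, zero = 0, add = (+)\<rparr>"

lemma poly_ring_simps [simp]:
  "mult (poly_ring n) = (*)" "one (poly_ring n) = 1"
  "zero (poly_ring n) = 0" "add (poly_ring n) = (+)"
  by (simp_all add: poly_ring_def)

lemma mem_poly_ring_iff:
  "p \<in> carrier (poly_ring n) \<longleftrightarrow>
     (\<forall>m \<in> Poly_Mapping.keys p. Poly_Mapping.keys m \<subseteq> {0..n})"
  by (simp add: poly_ring_def)

lemma cring_poly_ring: "cring (poly_ring n :: 'a::field mpoly ring)"
proof -
  let ?S = "carrier (poly_ring n :: 'a mpoly ring)"
  have add: "p + q \<in> ?S" if "p \<in> ?S" "q \<in> ?S" for p q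
    using that Poly_Mapping.keys_add[of p q] by (auto simp: mem_poly_ring_iff)
  have mult: "p * q \<in> ?S" if p: "p \<in> ?S" and q: "q \<in> ?S" for p q
    unfolding mem_poly_ring_iff
  proof
    fix m assume "m \<in> Poly_Mapping.keys (p * q)"
    then obtain a b where ab: "m = a + b" "a \<in> Poly_Mapping.keys p" "b \<in> Poly_Mapping.keys q"
      using Poly_Mapping.keys_mult[of p q] by auto
    then show "Poly_Mapping.keys m \<subseteq> {0..n}"
      using p q Poly_Mapping.keys_add[of a b] unfolding mem_poly_ring_iff by blast
  qed
  have neg: "- p \<in> ?S" if "p \<in> ?S" for p
    using that by (simp add: mem_poly_ring_iff)
  have zero_one: "0 \<in> ?S" "1 \<in> ?S"
    by (auto simp: mem_poly_ring_iff)
  have "abelian_group (poly_ring n :: 'a mpoly ring)"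
  proof (rule abelian_groupI)
    fix p assume "p \<in> ?S"
    then show "\<exists>q\<in>?S. q \<oplus>\<^bsub>poly_ring n\<^esub> p = \<zero>\<^bsub>poly_ring n\<^esub>"
      by (intro bexI[of _ "- p"]) (simp_all add: neg)
  qed (auto simp: add zero_one algebra_simps)
  moreover have "comm_monoid (poly_ring n :: 'a mpoly ring)"
    by (rule comm_monoidI) (auto simp: mult zero_one algebra_simps)
  ultimately show ?thesis
    by (rule cringI) (auto simp: algebra_simps)
qed

definition circuit_ideal :: "nat \<Rightarrow> nat set set \<Rightarrow> 'a::field mpoly set"
  where "circuit_ideal n D = Idl\<^bsub>poly_ring n\<^esub> ((\<lambda>F. \<Prod>i\<in>F. var i) ` D)"

definition mono_deg :: "(nat \<Rightarrow>\<^sub>0 nat) \<Rightarrow> nat"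
  where "mono_deg m = (\<Sum>i\<in>Poly_Mapping.keys m. Poly_Mapping.lookup m i)"

text \<open>
  A (candidate) graded free resolution
  \<open>\<dots> \<rightarrow> F\<^sub>2 \<rightarrow> F\<^sub>1 \<rightarrow> F\<^sub>0 \<rightarrow> I \<rightarrow> 0\<close> of a homogeneous ideal \<open>I\<close>, given in coordinates:
  \<open>F\<^sub>i = \<Oplus>\<^sub>k S(-d\<^sub>i\<^sub>k)\<close> with \<open>k < res_rank R i\<close> and \<open>d\<^sub>i\<^sub>k = res_deg R i k\<close>, the augmentation
  \<open>F\<^sub>0 \<rightarrow> I\<close> is given by the images \<open>res_aug R l\<close> of the basis elements, and
  \<open>res_diff R i\<close> is the matrix (row index first) of \<open>F\<^bsub>i+1\<^esub> \<rightarrow> F\<^sub>i\<close>.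
  Natural numbers suffice as degrees: in a minimal resolution no basis element is mapped to \<open>0\<close>,
  and \<open>S\<close> is non-negatively graded.
\<close>

record (overloaded) 'a graded_resolution =
  res_rank :: "nat \<Rightarrow> nat"
  res_deg :: "nat \<Rightarrow> nat \<Rightarrow> nat"
  res_aug :: "nat \<Rightarrow> 'a mpoly"
  res_diff :: "nat \<Rightarrow> nat \<Rightarrow> nat \<Rightarrow> 'a mpoly"

definition free_module :: "nat \<Rightarrow> nat \<Rightarrow> (nat \<Rightarrow> 'a::field mpoly) set"
  where "free_module n r =
    {v. (\<forall>k<r. v k \<in> carrier (poly_ring n)) \<and> (\<forall>k\<ge>r. v k = 0)}"

definition aug_map :: "'a::field graded_resolution \<Rightarrow> (nat \<Rightarrow> 'a mpoly) \<Rightarrow> 'a mpoly"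
  where "aug_map R v = (\<Sum>l<res_rank R 0. res_aug R l * v l)"

definition diff_map ::
    "'a::field graded_resolution \<Rightarrow> nat \<Rightarrow> (nat \<Rightarrow> 'a mpoly) \<Rightarrow> nat \<Rightarrow> 'a mpoly"
  where "diff_map R i v =
    (\<lambda>k. if k < res_rank R i then \<Sum>l<res_rank R (Suc i). res_diff R i k l * v l else 0)"

text \<open>
  The first two conditions say that the maps are defined over \<open>S\<close> and homogeneous of degree \<open>0\<close>.
  The last one, that the matrix entries have no constant term, is minimality:
  the image of \<open>F\<^bsub>i+1\<^esub>\<close> lies in \<open>(x\<^sub>0, \<dots>, x\<^sub>n) F\<^sub>i\<close>.
\<close>

definition minimal_graded_free_resolution ::
    "nat \<Rightarrow> 'a::field mpoly set \<Rightarrow> 'a graded_resolution \<Rightarrow> bool"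
  where "minimal_graded_free_resolution n I R \<longleftrightarrow>
    (\<forall>l<res_rank R 0. res_aug R l \<in> carrier (poly_ring n) \<and>
       (\<forall>m\<in>Poly_Mapping.keys (res_aug R l). mono_deg m = res_deg R 0 l)) \<and>
    (\<forall>i. \<forall>k<res_rank R i. \<forall>l<res_rank R (Suc i).
       res_diff R i k l \<in> carrier (poly_ring n) \<and>
       (\<forall>m\<in>Poly_Mapping.keys (res_diff R i k l).
          mono_deg m + res_deg R i k = res_deg R (Suc i) l)) \<and>
    aug_map R ` free_module n (res_rank R 0) = I \<and>
    {v \<in> free_module n (res_rank R 0). aug_map R v = 0} =
      diff_map R 0 ` free_module n (res_rank R (Suc 0)) \<and>
    (\<forall>i. {v \<in> free_module n (res_rank R (Suc i)). diff_map R i v = (\<lambda>_. 0)} =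
      diff_map R (Suc i) ` free_module n (res_rank R (Suc (Suc i)))) \<and>
    (\<forall>i. \<forall>k<res_rank R i. \<forall>l<res_rank R (Suc i).
       Poly_Mapping.lookup (res_diff R i k l) 0 = 0)"

text \<open>
  The number of basis elements of degree \<open>j\<close> in \<open>F\<^sub>i\<close>. Minimal graded free resolutions of a
  homogeneous ideal exist and are unique up to isomorphism, so the choice is immaterial.
\<close>

definition graded_betti :: "nat \<Rightarrow> 'a::field mpoly set \<Rightarrow> nat \<Rightarrow> nat \<Rightarrow> nat"
  where "graded_betti n I i j =
    (let R = (SOME R. minimal_graded_free_resolution n I R)
     in card {k. k < res_rank R i \<and> res_deg R i k = j})"

definition cm_regularity :: "nat \<Rightarrow> 'a::field mpoly set \<Rightarrow> ereal"
  where "cm_regularity n I =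
    Sup {ereal (real j - real i) | i j. graded_betti n I i j \<noteq> 0}"

end

theory Submission
  imports Defs "HOL-Library.Function_Algebras"
begin

text \<open>
  A minimal graded free resolution splits into short exact sequences \<open>0 \<rightarrow> Z \<rightarrow> F \<rightarrow> M \<rightarrow> 0\<close> with \<open>F\<close>
  free and \<open>Z\<close> inside \<open>(x\<^sub>0, \<dots>, x\<^sub>n) F\<close>. The Koszul complex of \<open>F\<close> is exact in positive degrees, so
  the Koszul homology of \<open>M\<close> in degree \<open>p + 1\<close> vanishes exactly where that of \<open>Z\<close> in degree \<open>p\<close>
  does. Hence \<open>\<beta>\<^sub>i\<^sub>j(I) \<noteq> 0\<close> if and only if the Koszul homology of \<open>I\<close> in degree \<open>i\<close> and internal
  degree \<open>j\<close> is nonzero. The same shift yields the existence of minimal resolutions: for a squarefree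
  monomial ideal the Koszul homology lives in squarefree multidegrees, which bounds the degrees of
  the generators of all syzygy modules, so no Noetherian argument is needed.

  In a squarefree multidegree \<open>W\<close> the Koszul complex of a circuit ideal is, up to signs and
  complements, the cochain complex of the simplex on \<open>W\<close> relative to the clique complex. The
  regularity is therefore the largest \<open>q\<close> for which this complex has cohomology at sets of size \<open>q\<close>
  for some \<open>W\<close>. Replacing the facet \<open>{1, 2, 3}\<close> by its stellar subdivision changes no face with at
  least four vertices, and the only faces of size at least three at the new vertex are the three new
  triangles, so for \<open>q \<ge> 4\<close> classes can be moved between \<open>W\<close> and \<open>W \<union> {0}\<close>; the value \<open>q = 3\<close> always occurs.
\<close>

subsection \<open>The Koszul differential\<close>

text \<open>\<open>graded_betti\<close> reads its numbers from a resolution picked by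
  \<open>SOME\<close>. The Koszul description of the occurring degrees holds for every minimal
  resolution, so it applies to that choice once existence is proved. The regularity depends only on
  which Betti numbers are nonzero; hence everything is phrased as exactness statements, and no
  dimensions are compared.

  The condition on the vertices \<open>r > 3\<close> says that each \<open>{1, 2, 3, r}\<close>
  contains a missing circuit. Among the subsets of \<open>{1..n}\<close> the two complexes therefore
  differ at \<open>{1, 2, 3}\<close> alone, which is a face only before the subdivision. It has
  three elements, so for \<open>q > 3\<close> it affects the cochains of size \<open>q - 1\<close>
  when \<open>q = 4\<close>, and only then. All corrections in the final part deal with this case:
  the value of a primitive on \<open>{1, 2, 3}\<close> is controlled through the tetrahedron
  \<open>{0, 1, 2, 3}\<close>, whose other three triangles are faces after the subdivision.\<close>

definition koszul_sign :: "nat \<Rightarrow> nat set \<Rightarrow> 'r::comm_ring_1"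
  where "koszul_sign i A = (- 1) ^ card {a \<in> A. a < i}"

text \<open>Chains are coefficient functions on index sets, so the value at \<open>A\<close>
  collects the contributions of all \<open>insert i A\<close>. With \<open>y = var\<close> this is
  the Koszul complex over the polynomial ring; with \<open>y = 1\<close> it is one multigraded
  strand, where variables only relabel coefficients.\<close>

definition koszul_diff :: "nat set \<Rightarrow> (nat \<Rightarrow> 'r::comm_ring_1) \<Rightarrow> (nat set \<Rightarrow> 'r) \<Rightarrow> nat set \<Rightarrow> 'r"
  where "koszul_diff V y c A = (\<Sum>i\<in>V - A. koszul_sign i A * y i * c (insert i A))"

lemma koszul_sign_insert:
  assumes "finite A" "j \<notin> A"
  shows "koszul_sign i (insert j A) = (if j < i then - koszul_sign i A else koszul_sign i A)"
proof -
  have "{a \<in> insert j A. a < i} = (if j < i then insert j {a \<in> A. a < i} else {a \<in> A. a < i})"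
    by auto
  then show ?thesis
    using assms by (simp add: koszul_sign_def)
qed

lemma koszul_sign_insert_self [simp]: "koszul_sign i (insert i A) = koszul_sign i A"
  unfolding koszul_sign_def by (rule arg_cong[where f = "\<lambda>X. (- 1) ^ card X"]) auto

lemma koszul_sign_remove_self [simp]: "koszul_sign i (A - {i}) = koszul_sign i A"
  unfolding koszul_sign_def by (rule arg_cong[where f = "\<lambda>X. (- 1) ^ card X"]) auto

lemma koszul_sign_square [simp]: "koszul_sign i A * koszul_sign i A = 1"
  by (simp add: koszul_sign_def flip: power_add mult_2)

lemma koszul_sign_square' [simp]: "koszul_sign i A * (koszul_sign i A * x) = x"
  by (simp flip: mult.assoc)

text \<open>Exactly one of \<open>i < j\<close> and \<open>j < i\<close> holds, so exactly one of
  the two inserted elements flips a sign: the generators e_i and e_j anticommute.\<close>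

lemma koszul_sign_swap:
  assumes "finite A" "i \<notin> A" "j \<notin> A" "i \<noteq> j"
  shows "koszul_sign i A * koszul_sign j (insert i A)
       = - (koszul_sign j A * koszul_sign i (insert j A) :: 'r::comm_ring_1)"
  using assms by (simp add: koszul_sign_insert)

lemma koszul_sign_swap':
  assumes "finite A" "i \<notin> A" "j \<notin> A" "i \<noteq> j"
  shows "koszul_sign j (insert i A) * koszul_sign i (insert j A)
       = - (koszul_sign i A * koszul_sign j A :: 'r::comm_ring_1)"
  using assms by (simp add: koszul_sign_insert mult.commute)

text \<open>The index pairs are split by their order so that terms cancel in pairs; concluding from
  \<open>s = - s\<close> would fail in characteristic 2.\<close>

lemma sum_antisymmetric_eq_0:
  fixes h :: "'i::linorder \<Rightarrow> 'i \<Rightarrow> 'r::ab_group_add"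
  assumes "finite B" "\<And>i j. i \<in> B \<Longrightarrow> j \<in> B \<Longrightarrow> i \<noteq> j \<Longrightarrow> h i j = - h j i"
  shows "(\<Sum>i\<in>B. \<Sum>j\<in>B - {i}. h i j) = 0"
proof -
  have sp: "(\<Sum>j\<in>B - {i}. h i j) = (\<Sum>j\<in>{j\<in>B. i < j}. h i j) + (\<Sum>j\<in>{j\<in>B. j < i}. h i j)"
    if "i \<in> B" for i
    using assms(1) by (subst sum.union_disjoint[symmetric]) (auto intro!: sum.cong)
  have "(\<Sum>i\<in>B. \<Sum>j\<in>{j\<in>B. j < i}. h i j) = (\<Sum>j\<in>B. \<Sum>i\<in>{i\<in>B. j < i}. h i j)"
    by (rule sum.swap_restrict) (use assms in auto)
  also have "\<dots> = (\<Sum>j\<in>B. \<Sum>i\<in>{i\<in>B. j < i}. - h j i)"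
    by (intro sum.cong refl) (use assms(2) in auto)
  finally show ?thesis
    by (simp add: sp sum.distrib sum_negf)
qed

lemma koszul_diff_diff:
  assumes "finite V" "finite A"
  shows "koszul_diff V y (koszul_diff V y c) A = 0"
proof -
  define h where "h i j = koszul_sign i A * koszul_sign j (insert i A) * y i * y j * c (insert i (insert j A))" for i j
  have "koszul_diff V y (koszul_diff V y c) A = (\<Sum>i\<in>V - A. \<Sum>j\<in>V - A - {i}. h i j)"
    unfolding koszul_diff_def sum_distrib_left
  proof (intro sum.cong refl)
    fix i j
    show "V - insert i A = V - A - {i}" by auto
    show "koszul_sign i A * y i * (koszul_sign j (insert i A) * y j * c (insert j (insert i A))) = h i j"
      by (simp add: h_def insert_commute mult_ac)
  qed
  also have "\<dots> = 0"
  proof (rule sum_antisymmetric_eq_0)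
    fix i j assume "i \<in> V - A" "j \<in> V - A" "i \<noteq> j"
    then show "h i j = - h j i"
      using koszul_sign_swap[OF assms(2), of i j, where 'r='a]
      by (simp add: h_def insert_commute mult_ac)
  qed (use assms in auto)
  finally show ?thesis .
qed

lemma koszul_diff_eq_0:
  "(\<And>i. i \<in> V - A \<Longrightarrow> c (insert i A) = 0) \<Longrightarrow> koszul_diff V y c A = 0"
  by (simp add: koszul_diff_def)

text \<open>Multiplication by the generator e_i is a contracting homotopy when
  \<open>y i = 1\<close>: d(e_i f) + e_i d(f) = f, and the second term vanishes for a cycle.\<close>

lemma koszul_diff_cone:
  assumes V: "finite V" "i \<in> V" and A: "A \<subseteq> V"
    and cyc: "\<And>A. A \<subseteq> V \<Longrightarrow> koszul_diff V (\<lambda>_. 1) f A = 0"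
  shows "koszul_diff V (\<lambda>_. 1) (\<lambda>B. if i \<in> B then koszul_sign i B * f (B - {i}) else 0) A = f A"
    (is "koszul_diff V _ ?g A = _")
proof (cases "i \<in> A")
  case False
  have "koszul_diff V (\<lambda>_. 1) ?g A = (\<Sum>j\<in>{i}. koszul_sign j A * ?g (insert j A))"
    unfolding koszul_diff_def using False V by (intro sum.mono_neutral_cong_right) auto
  then show ?thesis
    using False by simp
next
  case True
  have fin: "finite (A - {i})"
    using V A finite_subset by blast
  \<comment> \<open>The cycle condition at \<open>A - {i}\<close> contains the wanted
    \<open>f A\<close> as its term with index \<open>i\<close>; the remaining terms are those of the
    differential at \<open>A\<close>.\<close>
  have "0 = (\<Sum>j\<in>V - (A - {i}). koszul_sign j (A - {i}) * f (insert j (A - {i})))"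
    using cyc[of "A - {i}"] A by (auto simp: koszul_diff_def)
  also have "V - (A - {i}) = insert i (V - A)"
    using True V by auto
  also have "(\<Sum>j\<in>insert i (V - A). koszul_sign j (A - {i}) * f (insert j (A - {i})))
      = koszul_sign i A * f A + (\<Sum>j\<in>V - A. koszul_sign j (A - {i}) * f (insert j (A - {i})))"
    using True V by (simp add: insert_absorb)
  finally have *: "koszul_sign i A * f A = - (\<Sum>j\<in>V - A. koszul_sign j (A - {i}) * f (insert j (A - {i})))"
    by (metis add_eq_0_iff2)
  have "koszul_diff V (\<lambda>_. 1) ?g A
      = (\<Sum>j\<in>V - A. koszul_sign i A * (- (koszul_sign j (A - {i}) * f (insert j (A - {i})))))"
    unfolding koszul_diff_def
  proof (intro sum.cong refl)
    fix j assume j: "j \<in> V - A"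
    have *: "koszul_sign j A * koszul_sign i (insert j A) = - (koszul_sign i A * koszul_sign j (A - {i}) :: 'a)"
    proof -
      have "insert j A = insert i (insert j (A - {i}))"
        using True by auto
      then have "koszul_sign i (insert j A) = (koszul_sign i (insert j (A - {i})) :: 'a)"
        by (metis koszul_sign_insert_self)
      then show ?thesis
        using koszul_sign_swap'[OF fin, of i j, where 'r='a] j True by (auto simp: insert_absorb)
    qed
    have "insert j A - {i} = insert j (A - {i})"
      using j True by auto
    then have "koszul_sign j A * 1 * ?g (insert j A) = (koszul_sign j A * koszul_sign i (insert j A)) * f (insert j (A - {i}))"
      using True by (simp add: mult.assoc)
    then show "koszul_sign j A * 1 * ?g (insert j A)
        = koszul_sign i A * (- (koszul_sign j (A - {i}) * f (insert j (A - {i}))))"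
      using * by (simp add: mult.assoc)
  qed
  also have "\<dots> = koszul_sign i A * (koszul_sign i A * f A)"
    unfolding * by (simp add: sum_distrib_left sum_negf)
  finally show ?thesis
    by simp
qed

section \<open>The simplicial coboundary and its duality with the Koszul differential\<close>

definition cobdry :: "(nat set \<Rightarrow> 'r::comm_ring_1) \<Rightarrow> nat set \<Rightarrow> 'r"
  where "cobdry f B = (\<Sum>i\<in>B. koszul_sign i B * f (B - {i}))"

text \<open>The sign with which passing from \<open>A\<close> to \<open>W - A\<close> turns the
  Koszul differential on \<open>W\<close> into the coboundary.\<close>

definition compl_sign :: "nat set \<Rightarrow> nat set \<Rightarrow> 'r::comm_ring_1"
  where "compl_sign W B = (\<Prod>i\<in>B. koszul_sign i W)"

lemma compl_sign_square [simp]: "compl_sign W B * compl_sign W B = 1"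
  by (simp add: compl_sign_def flip: prod.distrib)

lemma koszul_sign_compl:
  assumes "finite W" "A \<subseteq> W"
  shows "koszul_sign i W = (koszul_sign i A * koszul_sign i (W - A) :: 'r::comm_ring_1)"
proof -
  have "card {a\<in>W. a < i} = card ({a\<in>A. a < i} \<union> {a\<in>W - A. a < i})"
    using assms by (intro arg_cong[where f = card]) auto
  also have "\<dots> = card {a\<in>A. a < i} + card {a\<in>W - A. a < i}"
    using assms finite_subset by (intro card_Un_disjoint) auto
  finally show ?thesis
    by (simp add: koszul_sign_def power_add)
qed

text \<open>Removing \<open>i\<close> from \<open>W - A\<close> changes the complement sign by
  \<open>koszul_sign i W\<close>, which factors into the sign used by the differential at
  \<open>A\<close> and the one used by the coboundary at \<open>W - A\<close>.\<close>

lemma cobdry_compl: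
  assumes W: "finite W" "A \<subseteq> W"
  shows "cobdry (\<lambda>B. compl_sign W B * f (W - B)) (W - A)
       = compl_sign W (W - A) * koszul_diff W (\<lambda>_. 1) f A"
  unfolding cobdry_def koszul_diff_def sum_distrib_left
proof (intro sum.cong refl)
  fix i assume i: "i \<in> W - A"
  have fin: "finite (W - A)" using W by auto
  have "compl_sign W (W - A) = koszul_sign i W * (compl_sign W (W - A - {i}) :: 'a)"
    unfolding compl_sign_def using fin i by (simp add: prod.remove)
  also have "\<dots> = koszul_sign i A * koszul_sign i (W - A) * compl_sign W (W - A - {i})"
    by (simp only: koszul_sign_compl[OF W, of i, where 'r='a])
  finally have "compl_sign W (W - A) * koszul_sign i A = koszul_sign i (W - A) * (compl_sign W (W - A - {i}) :: 'a)"
    by (simp add: mult_ac)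
  moreover have "W - (W - A - {i}) = insert i A" using W i by auto
  ultimately show "koszul_sign i (W - A) * (compl_sign W (W - A - {i}) * f (W - (W - A - {i})))
     = compl_sign W (W - A) * (koszul_sign i A * 1 * f (insert i A))"
    by (simp add: mult.assoc[symmetric])
qed

lemma cobdry_cobdry:
  assumes "finite B"
  shows "cobdry (cobdry f) B = 0"
proof -
  define h where "h i j = koszul_sign i B * koszul_sign j (B - {i}) * f (B - {i} - {j})" for i j
  have "cobdry (cobdry f) B = (\<Sum>i\<in>B. \<Sum>j\<in>B - {i}. h i j)"
    unfolding cobdry_def sum_distrib_left h_def by (simp add: mult.assoc)
  also have "\<dots> = 0"
  proof (rule sum_antisymmetric_eq_0)
    fix i j assume ij: "i \<in> B" "j \<in> B" "i \<noteq> j"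
    define A where "A = B - {i} - {j}"
    have "finite A" "i \<notin> A" "j \<notin> A" "B - {i} = insert j A" "B - {j} = insert i A" "B - {j} - {i} = A"
      "B = insert i (insert j A)"
      using assms ij by (auto simp: A_def)
    then have "koszul_sign i B = (koszul_sign i (insert j A) :: 'a)" "koszul_sign j B = (koszul_sign j (insert i A) :: 'a)"
      by (metis koszul_sign_insert_self, metis koszul_sign_insert_self insert_commute)
    then have "h i j = koszul_sign j A * koszul_sign i (insert j A) * f A"
      "h j i = koszul_sign i A * koszul_sign j (insert i A) * f A"
      by (simp_all add: h_def \<open>B - {i} = insert j A\<close> \<open>B - {j} = insert i A\<close>
        \<open>i \<notin> A\<close> \<open>j \<notin> A\<close>)
    then show "h i j = - h j i"
      using koszul_sign_swap[OF \<open>finite A\<close> \<open>i \<notin> A\<close> \<open>j \<notin> A\<close> ij(3), where 'r='a] by simp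
  qed (use assms in auto)
  finally show ?thesis .
qed

lemma cobdry_cong:
  "(\<And>i. i \<in> B \<Longrightarrow> f (B - {i}) = g (B - {i})) \<Longrightarrow> cobdry f B = cobdry g B"
  by (simp add: cobdry_def)

lemma cobdry_diff: "cobdry (\<lambda>B. f B - g B) B = cobdry f B - cobdry g B"
  by (simp add: cobdry_def algebra_simps sum_subtractf)

lemma cobdry_mult: "cobdry (\<lambda>B. a * f B) B = a * cobdry f B"
  by (simp add: cobdry_def sum_distrib_left mult_ac)

subsection \<open>Monomials and polynomials\<close>

abbreviation "lookup \<equiv> Poly_Mapping.lookup"
abbreviation "keys \<equiv> Poly_Mapping.keys"

lemma poly_ring_add: "p \<in> carrier (poly_ring n) \<Longrightarrow> q \<in> carrier (poly_ring n) \<Longrightarrow> p + q \<in> carrier (poly_ring n :: 'a::field mpoly ring)"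
  using ring.ring_simprules(1)[OF cring.axioms(1)[OF cring_poly_ring]] by fastforce

lemma poly_ring_mult: "p \<in> carrier (poly_ring n) \<Longrightarrow> q \<in> carrier (poly_ring n) \<Longrightarrow> p * q \<in> carrier (poly_ring n :: 'a::field mpoly ring)"
  using ring.ring_simprules(5)[OF cring.axioms(1)[OF cring_poly_ring]] by fastforce

lemma poly_ring_uminus: "p \<in> carrier (poly_ring n) \<Longrightarrow> - p \<in> carrier (poly_ring n)"
  by (simp add: mem_poly_ring_iff)

lemma poly_ring_0: "0 \<in> carrier (poly_ring n)" and poly_ring_1: "1 \<in> carrier (poly_ring n)"
  by (simp_all add: mem_poly_ring_iff)

lemma poly_ring_var: "i \<le> n \<Longrightarrow> var i \<in> carrier (poly_ring n)"
  by (simp add: mem_poly_ring_iff var_def)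

lemma poly_ring_const: "Poly_Mapping.single 0 a \<in> carrier (poly_ring n)"
  by (simp add: mem_poly_ring_iff)

lemma poly_ring_sum: "(\<And>i. i \<in> B \<Longrightarrow> f i \<in> carrier (poly_ring n)) \<Longrightarrow> sum f B \<in> carrier (poly_ring n)"
  by (induction B rule: infinite_finite_induct) (auto simp: poly_ring_0 poly_ring_add)

lemma poly_ring_koszul_sign: "koszul_sign i A \<in> carrier (poly_ring n)"
proof -
  have "(- 1) ^ k \<in> carrier (poly_ring n :: 'a mpoly ring)" for k
    by (induction k) (auto simp: poly_ring_1 intro: poly_ring_uminus)
  then show ?thesis
    by (simp add: koszul_sign_def)
qed

lemmas poly_ring_closed = poly_ring_add poly_ring_mult poly_ring_uminus poly_ring_0 poly_ring_1
  poly_ring_var poly_ring_const poly_ring_sum poly_ring_koszul_sign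

lemma lookup_single_mult_add:
  fixes g :: "'b::cancel_comm_monoid_add \<Rightarrow>\<^sub>0 'r::semiring_0"
  shows "lookup (Poly_Mapping.single a c * g) (a + m) = c * lookup g m"
  by (simp add: lookup_mult lookup_single when_mult)

lemma lookup_single_mult_eq_0:
  fixes g :: "'b::cancel_comm_monoid_add \<Rightarrow>\<^sub>0 'r::semiring_0"
  shows "(\<And>q. k \<noteq> a + q) \<Longrightarrow> lookup (Poly_Mapping.single a c * g) k = 0"
  by (simp add: lookup_mult lookup_single when_mult)

lemma lookup_const_mult:
  fixes g :: "'b::cancel_comm_monoid_add \<Rightarrow>\<^sub>0 'r::semiring_0"
  shows "lookup (Poly_Mapping.single 0 c * g) m = c * lookup g m"
  using lookup_single_mult_add[of 0 c g m] by simp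

lemma koszul_sign_mpoly: "(koszul_sign i A :: 'a::field mpoly) = Poly_Mapping.single 0 (koszul_sign i A)"
proof -
  have "(- 1 :: 'a mpoly) ^ k = Poly_Mapping.single 0 ((- 1) ^ k)" for k
    by (induction k) (simp_all add: mult_single flip: single_one single_uminus)
  then show ?thesis
    by (simp add: koszul_sign_def)
qed

lemma mono_deg_superset: "finite B \<Longrightarrow> keys m \<subseteq> B \<Longrightarrow> mono_deg m = (\<Sum>i\<in>B. lookup m i)"
  unfolding mono_deg_def by (rule sum.mono_neutral_left) (auto simp: in_keys_iff)

lemma mono_deg_add: "mono_deg (a + b) = mono_deg a + mono_deg b"
proof -
  let ?B = "keys a \<union> keys b"
  have "keys (a + b) \<subseteq> ?B" by (rule Poly_Mapping.keys_add)
  then show ?thesis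
    by (simp add: mono_deg_superset[of ?B] lookup_add sum.distrib)
qed

lemma mono_deg_0 [simp]: "mono_deg 0 = 0"
  by (simp add: mono_deg_def)

lemma mono_deg_eq_0_iff [simp]: "mono_deg m = 0 \<longleftrightarrow> m = 0"
proof
  assume "mono_deg m = 0"
  then have "lookup m i = 0" for i
    by (cases "i \<in> keys m") (auto simp: mono_deg_def in_keys_iff)
  then show "m = 0" by (intro poly_mapping_eqI) simp
qed simp

lemma mono_deg_single [simp]: "mono_deg (Poly_Mapping.single i k) = k"
  by (simp add: mono_deg_def)

definition mono_of_set :: "nat set \<Rightarrow> nat \<Rightarrow>\<^sub>0 nat"
  where "mono_of_set A = (\<Sum>i\<in>A. Poly_Mapping.single i 1)"

lemma lookup_mono_of_set: "finite A \<Longrightarrow> lookup (mono_of_set A) i = (if i \<in> A then 1 else 0)"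
  by (auto simp: mono_of_set_def lookup_sum lookup_single when_def)

lemma keys_mono_of_set [simp]: "finite A \<Longrightarrow> keys (mono_of_set A) = A"
  by (auto simp: in_keys_iff lookup_mono_of_set split: if_splits)

lemma mono_deg_mono_of_set [simp]: "finite A \<Longrightarrow> mono_deg (mono_of_set A) = card A"
  by (simp add: mono_deg_def lookup_mono_of_set)

lemma mono_of_set_insert: "finite A \<Longrightarrow> i \<notin> A \<Longrightarrow> mono_of_set (insert i A) = Poly_Mapping.single i 1 + mono_of_set A"
  by (simp add: mono_of_set_def)

lemma prod_var: "finite A \<Longrightarrow> (\<Prod>i\<in>A. var i) = Poly_Mapping.single (mono_of_set A) 1"
  by (induction A rule: finite_induct)
    (simp_all add: mono_of_set_insert mult_single var_def, simp add: mono_of_set_def)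

text \<open>Subtraction of exponents is truncated at zero, so cancellation requires that the
  squarefree monomial of \<open>A\<close> divides \<open>m\<close>.\<close>

lemma minus_mono_of_set:
  assumes "A \<subseteq> keys m"
  shows "m - mono_of_set A + mono_of_set A = m"
proof (rule poly_mapping_eqI)
  fix i
  have "finite A" using assms finite_keys finite_subset by blast
  moreover have "i \<in> A \<Longrightarrow> lookup m i > 0" using assms by (auto simp: in_keys_iff)
  ultimately show "lookup (m - mono_of_set A + mono_of_set A) i = lookup m i"
    by (auto simp: lookup_add lookup_minus lookup_mono_of_set)
qed

lemma lookup_var_mult:
  "lookup (var i * p) m = (if i \<in> keys m then lookup p (m - Poly_Mapping.single i 1) else 0)"
proof (cases "i \<in> keys m")
  case True
  have "m = Poly_Mapping.single i 1 + (m - Poly_Mapping.single i 1)"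
    using minus_mono_of_set[of "{i}" m] True by (simp add: mono_of_set_def add.commute)
  then have "lookup (var i * p) m = lookup (var i * p) (Poly_Mapping.single i 1 + (m - Poly_Mapping.single i 1))"
    by simp
  also have "\<dots> = lookup p (m - Poly_Mapping.single i 1)"
    unfolding var_def by (simp add: lookup_single_mult_add)
  finally show ?thesis
    using True by simp
next
  case False
  have "m \<noteq> Poly_Mapping.single i 1 + q" for q
    using False by (auto simp: in_keys_iff lookup_add)
  then show ?thesis
    using False by (simp add: var_def lookup_single_mult_eq_0)
qed

definition mpoly_filter :: "((nat \<Rightarrow>\<^sub>0 nat) \<Rightarrow> bool) \<Rightarrow> 'a::field mpoly \<Rightarrow> 'a mpoly"
  where "mpoly_filter Q p = Poly_Mapping.mapp (\<lambda>m c. if Q m then c else 0) p"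

lemma lookup_mpoly_filter [simp]: "lookup (mpoly_filter Q p) m = (if Q m then lookup p m else 0)"
  by (auto simp: mpoly_filter_def lookup_mapp when_def in_keys_iff)

lemma mpoly_filter_add: "mpoly_filter Q (p + q) = mpoly_filter Q p + mpoly_filter Q q"
  by (rule poly_mapping_eqI) (simp add: lookup_add)

lemma mpoly_filter_0 [simp]: "mpoly_filter Q 0 = 0"
  by (rule poly_mapping_eqI) simp

lemma mpoly_filter_sum: "mpoly_filter Q (sum f B) = (\<Sum>i\<in>B. mpoly_filter Q (f i))"
  by (induction B rule: infinite_finite_induct) (simp_all add: mpoly_filter_add)

lemma mpoly_filter_filter [simp]: "mpoly_filter Q (mpoly_filter Q p) = mpoly_filter Q p"
  by (rule poly_mapping_eqI) simp

lemma keys_mpoly_filter: "keys (mpoly_filter Q p) = {m \<in> keys p. Q m}"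
  by (auto simp: in_keys_iff split: if_splits)

lemma mpoly_filter_eq_self_iff: "mpoly_filter Q p = p \<longleftrightarrow> (\<forall>m\<in>keys p. Q m)"
  by (auto simp: poly_mapping_eq_iff fun_eq_iff in_keys_iff)

text \<open>A homogeneous factor carries homogeneous components to homogeneous components. Here
  \<open>u\<close> and \<open>w\<close> are the degrees of a target and a source basis element;
  additive conditions avoid subtraction on naturals.\<close>

lemma mpoly_filter_mult:
  fixes a p :: "'a::field mpoly"
  assumes "\<And>m. m \<in> keys a \<Longrightarrow> mono_deg m + u = w"
  shows "mpoly_filter (\<lambda>m. mono_deg m + u = t) (a * p) = a * mpoly_filter (\<lambda>m. mono_deg m + w = t) p"
proof -
  let ?P = "mpoly_filter (\<lambda>m. mono_deg m + w = t) p" and ?Q = "mpoly_filter (\<lambda>m. mono_deg m + w \<noteq> t) p"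
  have p: "p = ?P + ?Q"
    by (rule poly_mapping_eqI) (simp add: lookup_add)
  have 1: "mpoly_filter (\<lambda>m. mono_deg m + u = t) (a * ?P) = a * ?P"
    unfolding mpoly_filter_eq_self_iff
  proof
    fix m assume "m \<in> keys (a * ?P)"
    then obtain m1 m2 where "m = m1 + m2" "m1 \<in> keys a" "m2 \<in> keys ?P"
      using Poly_Mapping.keys_mult by blast
    moreover from this have "mono_deg m1 + u = w" "mono_deg m2 + w = t"
      using assms[of m1] by (simp_all add: keys_mpoly_filter)
    ultimately show "mono_deg m + u = t"
      by (simp add: mono_deg_add)
  qed
  have 2: "mpoly_filter (\<lambda>m. mono_deg m + u = t) (a * ?Q) = 0"
  proof (rule poly_mapping_eqI)
    fix m
    show "lookup (mpoly_filter (\<lambda>m. mono_deg m + u = t) (a * ?Q)) m = lookup 0 m"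
    proof (cases "m \<in> keys (a * ?Q)")
      case True
      then obtain m1 m2 where "m = m1 + m2" "m1 \<in> keys a" "m2 \<in> keys ?Q"
        using Poly_Mapping.keys_mult by blast
      moreover from this have "mono_deg m1 + u = w" "mono_deg m2 + w \<noteq> t"
        using assms[of m1] by (simp_all add: keys_mpoly_filter)
      ultimately have "mono_deg m + u \<noteq> t"
        by (simp add: mono_deg_add)
      then show ?thesis by simp
    qed (simp add: in_keys_iff)
  qed
  have "a * p = a * ?P + a * ?Q"
    using p by (metis distrib_left)
  then show ?thesis
    using 1 2 by (simp add: mpoly_filter_add)
qed

lemma mpoly_filter_carrier: "p \<in> carrier (poly_ring n) \<Longrightarrow> mpoly_filter Q p \<in> carrier (poly_ring n)"
  by (simp add: mem_poly_ring_iff keys_mpoly_filter)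

subsection \<open>Multigraded pieces of Koszul complexes of monomial ideals\<close>

text \<open>The basis element e_A has multidegree \<open>mono_of_set A\<close>, so its coefficient
  in multidegree \<open>m\<close> belongs to the monomial \<open>m - mono_of_set A\<close>. The case
  distinction discards index sets at which that subtraction would be truncated.\<close>

definition multi_part :: "(nat \<Rightarrow>\<^sub>0 nat) \<Rightarrow> (nat set \<Rightarrow> 'a::field mpoly) \<Rightarrow> nat set \<Rightarrow> 'a"
  where "multi_part m c A = (if A \<subseteq> keys m then lookup (c A) (m - mono_of_set A) else 0)"

text \<open>Inside a fixed multidegree, multiplication by x_i merely transports a coefficient, and
  indices outside \<open>keys m\<close> contribute nothing because x_i does not divide
  \<open>m\<close>.\<close>

lemma multi_part_koszul_diff:
  assumes "keys m \<subseteq> {0..n}"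
  shows "multi_part m (koszul_diff {0..n} var c) A = koszul_diff (keys m) (\<lambda>_. 1) (multi_part m c) A"
proof (cases "A \<subseteq> keys m")
  case False
  then show ?thesis
    by (auto simp: multi_part_def koszul_diff_def)
next
  case True
  have finA: "finite A" using True finite_keys finite_subset by blast
  have "multi_part m (koszul_diff {0..n} var c) A
      = (\<Sum>i\<in>{0..n} - A. koszul_sign i A * lookup (var i * c (insert i A)) (m - mono_of_set A))"
    using True by (simp add: multi_part_def koszul_diff_def lookup_sum koszul_sign_mpoly mult.assoc lookup_const_mult)
  also have "\<dots> = (\<Sum>i\<in>keys m - A. koszul_sign i A * lookup (var i * c (insert i A)) (m - mono_of_set A))"
    using assms by (intro sum.mono_neutral_right)
      (auto simp: lookup_var_mult in_keys_iff lookup_minus)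
  also have "\<dots> = (\<Sum>i\<in>keys m - A. koszul_sign i A * 1 * multi_part m c (insert i A))"
  proof (intro sum.cong refl)
    fix i assume i: "i \<in> keys m - A"
    have "i \<in> keys (m - mono_of_set A)"
      using i finA by (simp add: in_keys_iff lookup_minus lookup_mono_of_set)
    moreover have "m - mono_of_set A - Poly_Mapping.single i 1 = m - mono_of_set (insert i A)"
      using i finA by (simp add: mono_of_set_insert diff_diff_add add.commute)
    ultimately show "koszul_sign i A * lookup (var i * c (insert i A)) (m - mono_of_set A)
        = koszul_sign i A * 1 * multi_part m c (insert i A)"
      using i True by (simp add: lookup_var_mult multi_part_def)
  qed
  finally show ?thesis by (simp add: koszul_diff_def)
qed

lemma lookup_multi_part:
  assumes "finite A"
  shows "lookup (c A) m = multi_part (m + mono_of_set A) c A"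
proof -
  have "A \<subseteq> keys (m + mono_of_set A)"
    using assms by (auto simp: in_keys_iff lookup_add lookup_mono_of_set)
  then show ?thesis by (simp add: multi_part_def)
qed

text \<open>An identity over the polynomial ring may be checked strand by strand: multidegrees
  involving a variable beyond \<open>n\<close> are absent from both sides, since both lie in the
  carrier.\<close>

lemma koszul_diff_eqI:
  assumes A: "A \<subseteq> {0..n}" and c: "\<And>B. c B \<in> carrier (poly_ring n)" and e: "e \<in> carrier (poly_ring n)"
    and eq: "\<And>m. keys m \<subseteq> {0..n} \<Longrightarrow> A \<subseteq> keys m \<Longrightarrow>
      koszul_diff (keys m) (\<lambda>_. 1) (multi_part m c) A = lookup e (m - mono_of_set A)"
  shows "koszul_diff {0..n} var c A = e"
proof (rule poly_mapping_eqI)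
  fix m
  have finA: "finite A" using A finite_subset by blast
  let ?m = "m + mono_of_set A"
  have Am: "A \<subseteq> keys ?m"
    using finA by (auto simp: in_keys_iff lookup_add lookup_mono_of_set)
  show "lookup (koszul_diff {0..n} var c A) m = lookup e m"
  proof (cases "keys ?m \<subseteq> {0..n}")
    case True
    then show ?thesis
      using eq[OF True Am] by (simp add: lookup_multi_part[OF finA] multi_part_koszul_diff[OF True])
  next
    case False
    then have m: "\<not> keys m \<subseteq> {0..n}"
      using Poly_Mapping.keys_add[of m "mono_of_set A"] finA A by auto
    have "koszul_diff {0..n} var c A \<in> carrier (poly_ring n)"
      unfolding koszul_diff_def by (intro poly_ring_closed c) auto
    then have "m \<notin> keys (koszul_diff {0..n} var c A)" "m \<notin> keys e"
      using m e unfolding mem_poly_ring_iff by blast+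
    then show ?thesis
      by (simp add: in_keys_iff)
  qed
qed

text \<open>\<open>U\<close> stands for the set of monomials of a monomial ideal: e_A may carry a
  coefficient in multidegree \<open>m\<close> exactly when the cofactor of \<open>A\<close> in
  \<open>m\<close> lies in the ideal.\<close>

definition multi_chain :: "(nat \<Rightarrow>\<^sub>0 nat) set \<Rightarrow> (nat \<Rightarrow>\<^sub>0 nat) \<Rightarrow> nat \<Rightarrow> (nat set \<Rightarrow> 'a::field) \<Rightarrow> bool"
  where "multi_chain U m p f \<longleftrightarrow>
    (\<forall>A. f A \<noteq> 0 \<longrightarrow> A \<subseteq> keys m \<and> card A = p \<and> m - mono_of_set A \<in> U)"

text \<open>The type argument carries the coefficient field, on which the homology of a strand may
  depend.\<close>

definition multi_acyclic :: "'a::field itself \<Rightarrow> (nat \<Rightarrow>\<^sub>0 nat) set \<Rightarrow> (nat \<Rightarrow>\<^sub>0 nat) \<Rightarrow> nat \<Rightarrow> bool"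
  where "multi_acyclic _ U m p \<longleftrightarrow>
    (\<forall>f :: nat set \<Rightarrow> 'a. multi_chain U m p f \<and> (\<forall>A. koszul_diff (keys m) (\<lambda>_. 1) f A = 0) \<longrightarrow>
      (\<exists>g. multi_chain U m (Suc p) g \<and> (\<forall>A. koszul_diff (keys m) (\<lambda>_. 1) g A = f A)))"

text \<open>The second assumption says that toggling \<open>i\<close> does not affect membership of
  the cofactor in \<open>U\<close>, so the homotopy of \<open>koszul_diff_cone\<close> stays inside
  the strand.\<close>

lemma multi_acyclic_cone:
  assumes i: "i \<in> keys m"
    and U: "\<And>A. A \<subseteq> keys m \<Longrightarrow> i \<notin> A \<Longrightarrow> m - mono_of_set A \<in> U \<longleftrightarrow> m - mono_of_set (insert i A) \<in> U"
  shows "multi_acyclic TYPE('a::field) U m p"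
  unfolding multi_acyclic_def
proof (intro allI impI, elim conjE)
  fix f :: "nat set \<Rightarrow> 'a"
  assume f: "multi_chain U m p f" and cyc: "\<forall>A. koszul_diff (keys m) (\<lambda>_. 1) f A = 0"
  define g where "g B = (if i \<in> B then koszul_sign i B * f (B - {i}) else 0)" for B
  have "multi_chain U m (Suc p) g"
    unfolding multi_chain_def
  proof (intro allI impI)
    fix B assume "g B \<noteq> 0"
    then have B: "i \<in> B" "f (B - {i}) \<noteq> 0"
      by (auto simp: g_def split: if_splits)
    then have "B - {i} \<subseteq> keys m" "card (B - {i}) = p" "m - mono_of_set (B - {i}) \<in> U"
      using f by (auto simp: multi_chain_def)
    moreover from this(1) have "finite (B - {i})"
      using finite_keys finite_subset by blast
    then have "card B = Suc (card (B - {i}))"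
      using B card_Suc_Diff1[of B i] by simp
    moreover have "insert i (B - {i}) = B" using B by auto
    ultimately show "B \<subseteq> keys m \<and> card B = Suc p \<and> m - mono_of_set B \<in> U"
      using U[of "B - {i}"] i by auto
  qed
  moreover have "koszul_diff (keys m) (\<lambda>_. 1) g A = f A" for A
  proof (cases "A \<subseteq> keys m")
    case True
    then show ?thesis
      using koszul_diff_cone[of "keys m" i A f] i cyc unfolding g_def by simp
  next
    case False
    then have "f A = 0" "\<And>j. g (insert j A) = 0"
      using f \<open>multi_chain U m (Suc p) g\<close> by (auto simp: multi_chain_def)
    then show ?thesis by (simp add: koszul_diff_def)
  qed
  ultimately show "\<exists>g. multi_chain U m (Suc p) g \<and> (\<forall>A. koszul_diff (keys m) (\<lambda>_. 1) g A = f A)"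
    by blast
qed

section \<open>Assembling strands into polynomial chains\<close>

definition monomials_in :: "nat \<Rightarrow> (nat \<Rightarrow>\<^sub>0 nat) set"
  where "monomials_in n = {m. keys m \<subseteq> {0..n}}"

definition poly_chain :: "nat \<Rightarrow> (nat \<Rightarrow>\<^sub>0 nat) set \<Rightarrow> nat \<Rightarrow> (nat set \<Rightarrow> 'a::field mpoly) \<Rightarrow> bool"
  where "poly_chain n U p c \<longleftrightarrow>
    (\<forall>A. c A \<noteq> 0 \<longrightarrow> A \<subseteq> {0..n} \<and> card A = p) \<and> (\<forall>A. keys (c A) \<subseteq> U)"

lemma multi_chain_multi_part:
  assumes "poly_chain n U p c"
  shows "multi_chain U m p (multi_part m c)"
  unfolding multi_chain_def
proof (intro allI impI)
  fix A assume "multi_part m c A \<noteq> 0"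
  then have "A \<subseteq> keys m" "m - mono_of_set A \<in> keys (c A)"
    by (auto simp: multi_part_def in_keys_iff split: if_splits)
  moreover from this have "c A \<noteq> 0" by auto
  ultimately show "A \<subseteq> keys m \<and> card A = p \<and> m - mono_of_set A \<in> U"
    using assms by (auto simp: poly_chain_def)
qed

text \<open>A chain has finitely many strands; each is bounded separately and the results are added
  up. Acyclicity is asked only for multidegrees occurring in \<open>c\<close>, which lets callers
  exclude the multidegree \<open>0\<close> or prescribe a total degree.\<close>

lemma poly_chain_exact:
  fixes c :: "nat set \<Rightarrow> 'a::field mpoly"
  assumes U: "U \<subseteq> monomials_in n"
    and c: "poly_chain n U p c"
    and cyc: "\<And>A. koszul_diff {0..n} var c A = 0"
    and ac: "\<And>m A. m \<in> monomials_in n \<Longrightarrow> A \<subseteq> keys m \<Longrightarrow> m - mono_of_set A \<in> keys (c A) \<Longrightarrow>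
      multi_acyclic TYPE('a) U m p"
  shows "\<exists>b. poly_chain n U (Suc p) b \<and> (\<forall>A. koszul_diff {0..n} var b A = c A)"
proof -
  \<comment> \<open>All multidegrees of terms of \<open>c\<close>, with the multidegree of the basis
    element e_A included.\<close>
  define M where "M = (\<Union>A\<in>Pow {0..n}. (\<lambda>m. m + mono_of_set A) ` keys (c A))"
  have finM: "finite M" unfolding M_def by auto
  have Mn: "keys m \<subseteq> {0..n}" if m: "m \<in> M" for m
  proof -
    obtain A m' where A: "A \<subseteq> {0..n}" "m' \<in> keys (c A)" "m = m' + mono_of_set A"
      using m unfolding M_def by auto
    have "m' \<in> monomials_in n" using A c U unfolding poly_chain_def by blast
    moreover have "finite A" using A finite_subset by blast
    ultimately show ?thesis
      using A Poly_Mapping.keys_add[of m' "mono_of_set A"] by (auto simp: monomials_in_def)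
  qed
  have "\<exists>g. multi_chain U m (Suc p) g \<and> (\<forall>A. koszul_diff (keys m) (\<lambda>_. 1) g A = multi_part m c A)"
    if m: "m \<in> M" for m
  proof -
    obtain A m' where A: "A \<subseteq> {0..n}" "m' \<in> keys (c A)" "m = m' + mono_of_set A"
      using m unfolding M_def by auto
    have "finite A" using A finite_subset by blast
    then have "A \<subseteq> keys m" "m - mono_of_set A = m'"
      using A by (auto simp: in_keys_iff lookup_add lookup_mono_of_set)
    then have "multi_acyclic TYPE('a) U m p"
      using ac[of m A] Mn[OF m] A by (auto simp: monomials_in_def)
    moreover have "koszul_diff (keys m) (\<lambda>_. 1) (multi_part m c) A = 0" for A
      unfolding multi_part_koszul_diff[OF Mn[OF m], symmetric] by (simp add: multi_part_def cyc)
    ultimately show ?thesis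
      using multi_chain_multi_part[OF c, of m] unfolding multi_acyclic_def by blast
  qed
  then have "\<forall>m\<in>M. \<exists>g. multi_chain U m (Suc p) g \<and> (\<forall>A. koszul_diff (keys m) (\<lambda>_. 1) g A = multi_part m c A)"
    by blast
  from bchoice[OF this] obtain g where
    g0: "\<forall>m\<in>M. multi_chain U m (Suc p) (g m) \<and> (\<forall>A. koszul_diff (keys m) (\<lambda>_. 1) (g m) A = multi_part m c A)"
    by (rule exE)
  have g: "\<And>m. m \<in> M \<Longrightarrow> multi_chain U m (Suc p) (g m)"
    "\<And>m A. m \<in> M \<Longrightarrow> koszul_diff (keys m) (\<lambda>_. 1) (g m) A = multi_part m c A"
    using g0 by simp_all
  define b where "b A = (\<Sum>m\<in>M. Poly_Mapping.single (m - mono_of_set A) (g m A))" for A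
  have keys_b: "m' \<in> keys (b A) \<Longrightarrow> \<exists>m\<in>M. m' = m - mono_of_set A \<and> g m A \<noteq> 0" for m' A
  proof -
    assume "m' \<in> keys (b A)"
    then have "m' \<in> (\<Union>m\<in>M. keys (Poly_Mapping.single (m - mono_of_set A) (g m A)))"
      unfolding b_def by (rule subsetD[OF keys_sum])
    then show ?thesis by (auto split: if_splits)
  qed
  have b: "poly_chain n U (Suc p) b"
    unfolding poly_chain_def
  proof (intro conjI allI impI)
    fix A
    show "keys (b A) \<subseteq> U"
    proof
      fix m' assume "m' \<in> keys (b A)"
      then obtain m where "m \<in> M" "m' = m - mono_of_set A" "g m A \<noteq> 0" using keys_b by blast
      then show "m' \<in> U" using g(1)[of m] by (auto simp: multi_chain_def)
    qed
    assume "b A \<noteq> 0"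
    then obtain m' where "m' \<in> keys (b A)" using keys_eq_empty by blast
    then obtain m where "m \<in> M" "g m A \<noteq> 0" using keys_b by blast
    then show "A \<subseteq> {0..n}" "card A = Suc p"
      using g(1)[of m] Mn[of m] by (auto simp: multi_chain_def)
  qed
  \<comment> \<open>Distinct multidegrees do not interfere: where \<open>A\<close> divides both,
    \<open>m - mono_of_set A\<close> determines \<open>m\<close>.\<close>
  have part_b: "multi_part m b A = (if m \<in> M then g m A else 0)" for m A
  proof (cases "A \<subseteq> keys m")
    case False
    then show ?thesis using g(1)[of m] by (auto simp: multi_part_def multi_chain_def)
  next
    case True
    have "lookup (Poly_Mapping.single (m' - mono_of_set A) (g m' A)) (m - mono_of_set A) = (if m' = m then g m A else 0)"
      if "m' \<in> M" for m'
    proof (cases "g m' A = 0")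
      case False
      then have "A \<subseteq> keys m'" using g(1)[OF that] by (auto simp: multi_chain_def)
      then have "m' - mono_of_set A = m - mono_of_set A \<longleftrightarrow> m' = m"
        using minus_mono_of_set[OF True] minus_mono_of_set[of A m'] by auto
      then show ?thesis by (simp add: lookup_single when_def)
    qed auto
    then show ?thesis using True finM by (simp add: multi_part_def b_def lookup_sum)
  qed
  have "koszul_diff {0..n} var b A = c A" for A
  proof (cases "A \<subseteq> {0..n}")
    case False
    then have "c A = 0" "\<And>j. b (insert j A) = 0"
      using b c by (auto simp: poly_chain_def)
    then show ?thesis by (simp add: koszul_diff_def)
  next
    case True
    have finA: "finite A" using True finite_subset by blast
    have carr: "b B \<in> carrier (poly_ring n)" "c B \<in> carrier (poly_ring n)" for B
      using b c U unfolding poly_chain_def mem_poly_ring_iff monomials_in_def by blast+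
    show ?thesis
    proof (rule koszul_diff_eqI[OF True carr])
      fix m :: "nat \<Rightarrow>\<^sub>0 nat" assume m: "keys m \<subseteq> {0..n}" "A \<subseteq> keys m"
      have "koszul_diff (keys m) (\<lambda>_. 1) (multi_part m b) A
          = (if m \<in> M then koszul_diff (keys m) (\<lambda>_. 1) (g m) A else 0)"
        by (auto simp: part_b koszul_diff_def)
      also have "\<dots> = multi_part m c A"
      proof (cases "m \<in> M")
        case False
        have "m - mono_of_set A \<notin> keys (c A)"
        proof
          assume "m - mono_of_set A \<in> keys (c A)"
          then have "m - mono_of_set A + mono_of_set A \<in> M"
            using True unfolding M_def by blast
          then show False using False minus_mono_of_set[OF m(2)] by simp
        qed
        then show ?thesis using False by (simp add: in_keys_iff multi_part_def)
      qed (simp add: g)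
      finally show "koszul_diff (keys m) (\<lambda>_. 1) (multi_part m b) A = lookup (c A) (m - mono_of_set A)"
        using m by (simp add: multi_part_def)
    qed
  qed
  then show ?thesis using b by blast
qed

subsection \<open>Graded submodules of free modules and their Koszul homology\<close>

definition vec_part :: "(nat \<Rightarrow> nat) \<Rightarrow> nat \<Rightarrow> (nat \<Rightarrow> 'a::field mpoly) \<Rightarrow> nat \<Rightarrow> 'a mpoly"
  where "vec_part d t v = (\<lambda>k. mpoly_filter (\<lambda>m. mono_deg m + d k = t) (v k))"

definition graded_submodule :: "nat \<Rightarrow> nat \<Rightarrow> (nat \<Rightarrow> nat) \<Rightarrow> (nat \<Rightarrow> 'a::field mpoly) set \<Rightarrow> bool"
  where "graded_submodule n r d M \<longleftrightarrow> M \<subseteq> free_module n r \<and> (\<lambda>_. 0) \<in> M \<and>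
    (\<forall>v\<in>M. \<forall>w\<in>M. (\<lambda>k. v k + w k) \<in> M) \<and>
    (\<forall>s\<in>carrier (poly_ring n). \<forall>v\<in>M. (\<lambda>k. s * v k) \<in> M) \<and>
    (\<forall>v\<in>M. \<forall>t. vec_part d t v \<in> M)"

lemma
  assumes "graded_submodule n r d M"
  shows graded_submodule_free: "v \<in> M \<Longrightarrow> v \<in> free_module n r"
    and graded_submodule_0: "(\<lambda>_. 0) \<in> M"
    and graded_submodule_add: "v \<in> M \<Longrightarrow> w \<in> M \<Longrightarrow> (\<lambda>k. v k + w k) \<in> M"
    and graded_submodule_scale: "s \<in> carrier (poly_ring n) \<Longrightarrow> v \<in> M \<Longrightarrow> (\<lambda>k. s * v k) \<in> M"
    and graded_submodule_part: "v \<in> M \<Longrightarrow> vec_part d t v \<in> M"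
  using assms by (auto simp: graded_submodule_def)

lemma vec_part_0 [simp]: "vec_part d t (\<lambda>_. 0) = (\<lambda>_. 0)"
  by (simp add: vec_part_def)

lemma graded_submodule_diff:
  assumes "graded_submodule n r d M" "v \<in> M" "w \<in> M"
  shows "(\<lambda>k. v k - w k) \<in> M"
  using graded_submodule_add[OF assms(1,2) graded_submodule_scale[OF assms(1) poly_ring_uminus[OF poly_ring_1] assms(3)]]
  by simp

lemma graded_submodule_sum:
  assumes "graded_submodule n r d M" "\<And>i. i \<in> B \<Longrightarrow> f i \<in> M"
  shows "(\<lambda>k. \<Sum>i\<in>B. f i k) \<in> M"
  using assms(2)
  by (induction B rule: infinite_finite_induct)
    (auto intro: graded_submodule_0[OF assms(1)] graded_submodule_add[OF assms(1)])

lemma graded_submodule_free_module: "graded_submodule n r d (free_module n r)"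
  unfolding graded_submodule_def free_module_def
  by (auto intro: poly_ring_closed mpoly_filter_carrier simp: vec_part_def)

text \<open>Values off the admissible index sets are forced to be zero, so that equality of
  functions is equality of chains.\<close>

definition koszul_chains :: "nat \<Rightarrow> (nat \<Rightarrow> 'a::field mpoly) set \<Rightarrow> nat \<Rightarrow> (nat set \<Rightarrow> nat \<Rightarrow> 'a mpoly) set"
  where "koszul_chains n M p =
    {c. \<forall>A. if A \<subseteq> {0..n} \<and> card A = p then c A \<in> M else c A = (\<lambda>_. 0)}"

definition module_diff :: "nat \<Rightarrow> (nat set \<Rightarrow> nat \<Rightarrow> 'a::field mpoly) \<Rightarrow> nat set \<Rightarrow> nat \<Rightarrow> 'a mpoly"
  where "module_diff n c = (\<lambda>A k. koszul_diff {0..n} var (\<lambda>B. c B k) A)"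

definition chain_part :: "(nat \<Rightarrow> nat) \<Rightarrow> nat \<Rightarrow> (nat set \<Rightarrow> nat \<Rightarrow> 'a::field mpoly) \<Rightarrow> nat set \<Rightarrow> nat \<Rightarrow> 'a mpoly"
  where "chain_part d t c = (\<lambda>A k. mpoly_filter (\<lambda>m. mono_deg m + (card A + d k) = t) (c A k))"

text \<open>For a graded submodule \<open>M\<close> this is the vanishing of Tor_p(K, M) in internal
  degree \<open>t\<close>; being fixed by \<open>chain_part d t\<close> expresses homogeneity of
  degree \<open>t\<close>, where e_A counts with degree \<open>card A\<close>.\<close>

definition koszul_exact :: "nat \<Rightarrow> (nat \<Rightarrow> nat) \<Rightarrow> (nat \<Rightarrow> 'a::field mpoly) set \<Rightarrow> nat \<Rightarrow> nat \<Rightarrow> bool"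
  where "koszul_exact n d M p t \<longleftrightarrow>
    (\<forall>c\<in>koszul_chains n M p. chain_part d t c = c \<and> module_diff n c = (\<lambda>_ _. 0) \<longrightarrow>
      (\<exists>b\<in>koszul_chains n M (Suc p). chain_part d t b = b \<and> module_diff n b = c))"

lemma koszul_chains_in: "c \<in> koszul_chains n M p \<Longrightarrow> A \<subseteq> {0..n} \<Longrightarrow> card A = p \<Longrightarrow> c A \<in> M"
  by (auto simp: koszul_chains_def)

lemma koszul_chains_0: "c \<in> koszul_chains n M p \<Longrightarrow> \<not> (A \<subseteq> {0..n} \<and> card A = p) \<Longrightarrow> c A = (\<lambda>_. 0)"
  by (auto simp: koszul_chains_def)

lemma koszul_chains_mem:
  assumes "graded_submodule n r d M" "c \<in> koszul_chains n M p"
  shows "c A \<in> M"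
  using assms graded_submodule_0[OF assms(1)] by (auto simp: koszul_chains_def split: if_splits)

lemma koszul_chainsI:
  "(\<And>A. A \<subseteq> {0..n} \<Longrightarrow> card A = p \<Longrightarrow> c A \<in> M) \<Longrightarrow>
   (\<And>A. \<not> (A \<subseteq> {0..n} \<and> card A = p) \<Longrightarrow> c A = (\<lambda>_. 0)) \<Longrightarrow> c \<in> koszul_chains n M p"
  by (auto simp: koszul_chains_def)

lemma koszul_chains_mono: "M \<subseteq> N \<Longrightarrow> c \<in> koszul_chains n M p \<Longrightarrow> c \<in> koszul_chains n N p"
  by (auto simp: koszul_chains_def split: if_splits)

lemma koszul_chains_diff:
  assumes "graded_submodule n r d M" "b \<in> koszul_chains n M p" "c \<in> koszul_chains n M p"
  shows "(\<lambda>A k. b A k - c A k) \<in> koszul_chains n M p"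
  using assms by (auto simp: koszul_chains_def intro!: graded_submodule_diff[OF assms(1)])

lemma module_diff_chains:
  assumes M: "graded_submodule n r d M" and c: "c \<in> koszul_chains n M (Suc p)"
  shows "module_diff n c \<in> koszul_chains n M p"
proof (rule koszul_chainsI)
  fix A :: "nat set" assume "A \<subseteq> {0..n}" "card A = p"
  show "module_diff n c A \<in> M"
    unfolding module_diff_def koszul_diff_def
    by (intro graded_submodule_sum[OF M] graded_submodule_scale[OF M] poly_ring_closed
        koszul_chains_mem[OF M c]) auto
next
  fix A :: "nat set" assume A: "\<not> (A \<subseteq> {0..n} \<and> card A = p)"
  have "c (insert i A) = (\<lambda>_. 0)" if "i \<in> {0..n} - A" for i
  proof (rule koszul_chains_0[OF c])
    have "finite A" if "A \<subseteq> {0..n}" using that finite_subset by blast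
    then show "\<not> (insert i A \<subseteq> {0..n} \<and> card (insert i A) = Suc p)"
      using A that by auto
  qed
  then show "module_diff n c A = (\<lambda>_. 0)"
    by (simp add: module_diff_def koszul_diff_def)
qed

lemma module_diff_0_chain:
  assumes c: "c \<in> koszul_chains n M 0"
  shows "module_diff n c = (\<lambda>_ _. 0)"
proof (intro ext)
  fix A k
  have "c (insert i A) = (\<lambda>_. 0)" for i
    by (rule koszul_chains_0[OF c]) (auto simp: card_eq_0_iff dest: finite_subset)
  then show "module_diff n c A k = 0"
    by (simp add: module_diff_def koszul_diff_def)
qed

lemma module_diff_outside:
  assumes "c \<in> koszul_chains n M p" "\<not> A \<subseteq> {0..n}"
  shows "module_diff n c A k = 0"
proof -
  have "c (insert i A) = (\<lambda>_. 0)" for i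
    by (rule koszul_chains_0[OF assms(1)]) (use assms(2) in auto)
  then show ?thesis
    by (simp add: module_diff_def koszul_diff_def)
qed

lemma module_diff_diff:
  assumes "c \<in> koszul_chains n M p"
  shows "module_diff n (module_diff n c) = (\<lambda>_ _. 0)"
proof (intro ext)
  fix A k
  show "module_diff n (module_diff n c) A k = 0"
  proof (cases "A \<subseteq> {0..n}")
    case True
    then have "finite A" using finite_subset by blast
    then show ?thesis by (simp add: module_diff_def koszul_diff_diff)
  next
    case False
    have "module_diff n c (insert i A) k = 0" for i
      by (rule module_diff_outside[OF assms]) (use False in auto)
    then show ?thesis
      unfolding module_diff_def[of n "module_diff n c"] by (simp add: koszul_diff_def)
  qed
qed

lemma module_diff_minus: "module_diff n (\<lambda>A k. b A k - c A k) = (\<lambda>A k. module_diff n b A k - module_diff n c A k)"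
  by (simp add: module_diff_def koszul_diff_def fun_eq_iff right_diff_distrib sum_subtractf)

lemma chain_part_idem [simp]: "chain_part d t (chain_part d t c) = chain_part d t c"
  by (simp add: chain_part_def)

lemma chain_part_vec_part:
  "chain_part d t c A = (if card A \<le> t then vec_part d (t - card A) (c A) else (\<lambda>_. 0))"
  by (auto simp: chain_part_def vec_part_def fun_eq_iff intro!: poly_mapping_eqI)

lemma chain_part_chains:
  assumes "graded_submodule n r d M" "c \<in> koszul_chains n M p"
  shows "chain_part d t c \<in> koszul_chains n M p"
proof (rule koszul_chainsI)
  fix A :: "nat set"
  show "chain_part d t c A \<in> M"
    by (simp add: chain_part_vec_part graded_submodule_0[OF assms(1)]
        graded_submodule_part[OF assms(1) koszul_chains_mem[OF assms]])
next
  fix A :: "nat set" assume "\<not> (A \<subseteq> {0..n} \<and> card A = p)"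
  then show "chain_part d t c A = (\<lambda>_. 0)"
    using koszul_chains_0[OF assms(2)] by (simp add: chain_part_def)
qed

lemma module_diff_chain_part:
  assumes c: "c \<in> koszul_chains n M p"
  shows "module_diff n (chain_part d t c) = chain_part d t (module_diff n c)"
proof (intro ext)
  fix A k
  show "module_diff n (chain_part d t c) A k = chain_part d t (module_diff n c) A k"
  proof (cases "A \<subseteq> {0..n}")
    case True
    then have finA: "finite A" using finite_subset by blast
    show ?thesis
      unfolding module_diff_def chain_part_def koszul_diff_def mpoly_filter_sum
    proof (intro sum.cong refl mpoly_filter_mult[symmetric])
      fix i m assume i: "i \<in> {0..n} - A"
      assume "m \<in> keys (koszul_sign i A * var i :: 'a mpoly)"
      then have "m = Poly_Mapping.single i 1"
        by (auto simp: koszul_sign_mpoly var_def mult_single split: if_splits)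
      then show "mono_deg m + (card A + d k) = card (insert i A) + d k"
        using i finA by simp
    qed
  next
    case False
    have "c (insert i A) = (\<lambda>_. 0)" for i
      by (rule koszul_chains_0[OF c]) (use False in auto)
    then show ?thesis
      using module_diff_outside[OF c False] by (simp add: module_diff_def koszul_diff_def chain_part_def)
  qed
qed

lemma chain_part_minus:
  "chain_part d t b = b \<Longrightarrow> chain_part d t c = c \<Longrightarrow>
    chain_part d t (\<lambda>A k. b A k - c A k) = (\<lambda>A k. b A k - c A k)"
proof (intro ext poly_mapping_eqI)
  fix A k m
  assume "chain_part d t b = b" "chain_part d t c = c"
  from this[THEN fun_cong[of _ _ A], THEN fun_cong[of _ _ k]]
  have "lookup (chain_part d t b A k) m = lookup (b A k) m" "lookup (chain_part d t c A k) m = lookup (c A k) m"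
    by simp_all
  then show "lookup (chain_part d t (\<lambda>A k. b A k - c A k) A k) m = lookup (b A k - c A k) m"
    by (auto simp: chain_part_def lookup_minus split: if_splits)
qed

text \<open>Coordinatewise, every strand of multidegree other than \<open>0\<close> is contracted by
  any variable dividing it. The multidegree \<open>0\<close> carries the residue field in
  homological degree 0, and \<open>const\<close> excludes it.\<close>

lemma free_module_exact:
  fixes c :: "nat set \<Rightarrow> nat \<Rightarrow> 'a::field mpoly"
  assumes c: "c \<in> koszul_chains n (free_module n r) p" "chain_part d t c = c" "module_diff n c = (\<lambda>_ _. 0)"
    and const: "\<And>k. lookup (c {} k) 0 = 0"
  shows "\<exists>b\<in>koszul_chains n (free_module n r) (Suc p). chain_part d t b = b \<and> module_diff n b = c"
proof -
  have "\<forall>k. \<exists>b. poly_chain n (monomials_in n) (Suc p) b \<and> (\<forall>A. koszul_diff {0..n} var b A = c A k)"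
  proof (intro allI poly_chain_exact)
    fix k
    have cA: "c A k \<in> carrier (poly_ring n)" for A
      using koszul_chains_mem[OF graded_submodule_free_module[of n r "\<lambda>_. 0"] c(1), of A]
      by (cases "k < r") (auto simp: free_module_def poly_ring_0)
    show "poly_chain n (monomials_in n) p (\<lambda>A. c A k)"
      unfolding poly_chain_def
    proof (intro conjI allI impI)
      fix A
      show "keys (c A k) \<subseteq> monomials_in n"
        using cA[of A] by (auto simp: mem_poly_ring_iff monomials_in_def)
      assume "c A k \<noteq> 0"
      then have "A \<subseteq> {0..n} \<and> card A = p"
        using koszul_chains_0[OF c(1), of A] by metis
      then show "A \<subseteq> {0..n}" "card A = p" by auto
    qed
    show "koszul_diff {0..n} var (\<lambda>A. c A k) A = 0" for A
      using c(3) by (auto simp: module_diff_def fun_eq_iff)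
    fix m A assume m: "m \<in> monomials_in n" "A \<subseteq> keys m" "m - mono_of_set A \<in> keys (c A k)"
    \<comment> \<open>In multidegree \<open>0\<close> the index set can only be empty, and there the
      constant term vanishes by assumption.\<close>
    have "m \<noteq> 0"
    proof
      assume "m = 0"
      then have "A = {}" using m by auto
      then show False using m const[of k] \<open>m = 0\<close> by (simp add: in_keys_iff mono_of_set_def)
    qed
    then obtain i where i: "i \<in> keys m"
      by (metis equals0I keys_eq_empty)
    have "m - x \<in> monomials_in n" for x
      using m(1) by (auto simp: monomials_in_def in_keys_iff lookup_minus)
    then show "multi_acyclic TYPE('a) (monomials_in n) m p"
      by (intro multi_acyclic_cone[OF i]) auto
  qed simp
  from choice[OF this] obtain b0 where
    b0: "\<And>k. poly_chain n (monomials_in n) (Suc p) (b0 k)" "\<And>k A. koszul_diff {0..n} var (b0 k) A = c A k"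
    by auto
  define b where "b = (\<lambda>A k. if k < r then b0 k A else 0)"
  have b: "b \<in> koszul_chains n (free_module n r) (Suc p)"
  proof (rule koszul_chainsI)
    fix A :: "nat set"
    have "b0 k A \<in> carrier (poly_ring n)" for k
      using b0(1)[of k] unfolding poly_chain_def mem_poly_ring_iff monomials_in_def by blast
    then show "b A \<in> free_module n r"
      by (auto simp: b_def free_module_def)
  next
    fix A :: "nat set" assume "\<not> (A \<subseteq> {0..n} \<and> card A = Suc p)"
    then show "b A = (\<lambda>_. 0)"
      using b0(1) by (auto simp: b_def fun_eq_iff poly_chain_def)
  qed
  have "module_diff n b A k = c A k" for A k
  proof (cases "k < r")
    case True
    then show ?thesis by (simp add: module_diff_def b_def b0)
  next
    case False
    then have "c A k = 0"
      using koszul_chains_mem[OF graded_submodule_free_module[of n r "\<lambda>_. 0"] c(1), of A]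
      by (auto simp: free_module_def)
    then show ?thesis using False by (simp add: module_diff_def b_def koszul_diff_def)
  qed
  then have "module_diff n b = c" by (intro ext)
  \<comment> \<open>The chain \<open>b\<close> assembled from the strands need not be homogeneous;
    its component of degree \<open>t\<close> has the same boundary, because \<open>c\<close> is
    homogeneous of degree \<open>t\<close>.\<close>
  then have "module_diff n (chain_part d t b) = c"
    using module_diff_chain_part[OF b, of d t] c(2) by simp
  then show ?thesis
    using chain_part_chains[OF graded_submodule_free_module b, of d t] chain_part_idem by blast
qed

subsection \<open>Minimal covers and the dimension shift\<close>

definition mat_map :: "nat \<Rightarrow> nat \<Rightarrow> (nat \<Rightarrow> nat \<Rightarrow> 'a::field mpoly) \<Rightarrow> (nat \<Rightarrow> 'a mpoly) \<Rightarrow> nat \<Rightarrow> 'a mpoly"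
  where "mat_map r' r P v = (\<lambda>k. if k < r' then \<Sum>l<r. P k l * v l else 0)"

lemma mat_map_minus: "mat_map r' r P (\<lambda>k. v k - w k) = (\<lambda>k. mat_map r' r P v k - mat_map r' r P w k)"
  by (simp add: mat_map_def fun_eq_iff right_diff_distrib sum_subtractf)

lemma mat_map_add: "mat_map r' r P (\<lambda>k. v k + w k) = (\<lambda>k. mat_map r' r P v k + mat_map r' r P w k)"
  by (simp add: mat_map_def fun_eq_iff distrib_left sum.distrib)

lemma mat_map_scale: "mat_map r' r P (\<lambda>k. s * v k) = (\<lambda>k. s * mat_map r' r P v k)"
  by (simp add: mat_map_def fun_eq_iff sum_distrib_left mult_ac)

lemma mat_map_0 [simp]: "mat_map r' r P (\<lambda>_. 0) = (\<lambda>_. 0)"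
  by (simp add: mat_map_def fun_eq_iff)

lemma module_diff_mat_map:
  "module_diff n (\<lambda>A. mat_map r' r P (c A)) = (\<lambda>A. mat_map r' r P (module_diff n c A))"
proof (intro ext)
  fix A k
  show "module_diff n (\<lambda>A. mat_map r' r P (c A)) A k = mat_map r' r P (module_diff n c A) k"
    by (simp add: module_diff_def mat_map_def koszul_diff_def sum_distrib_left sum.swap[of _ "{..<r}"] mult_ac)
qed

locale graded_map =
  fixes n r' :: nat and d' :: "nat \<Rightarrow> nat" and r :: nat and d :: "nat \<Rightarrow> nat"
    and P :: "nat \<Rightarrow> nat \<Rightarrow> 'a::field mpoly"
  assumes entries: "k < r' \<Longrightarrow> l < r \<Longrightarrow> P k l \<in> carrier (poly_ring n)"
    and homogeneous: "k < r' \<Longrightarrow> l < r \<Longrightarrow> m \<in> keys (P k l) \<Longrightarrow> mono_deg m + d' k = d l"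
begin

abbreviation "phi \<equiv> mat_map r' r P"

definition im where "im = phi ` free_module n r"
definition ker where "ker = {v \<in> free_module n r. phi v = (\<lambda>_. 0)}"

lemma phi_vec_part: "phi (vec_part d t v) = vec_part d' t (phi v)"
proof
  fix k
  show "phi (vec_part d t v) k = vec_part d' t (phi v) k"
  proof (cases "k < r'")
    case True
    then show ?thesis
      by (auto simp: mat_map_def vec_part_def mpoly_filter_sum homogeneous
          intro!: sum.cong mpoly_filter_mult[symmetric])
  qed (simp add: mat_map_def vec_part_def)
qed

lemma phi_chain_part: "(\<lambda>A. phi (chain_part d t c A)) = chain_part d' t (\<lambda>A. phi (c A))"
  by (auto simp: chain_part_vec_part phi_vec_part fun_eq_iff)

lemma graded_submodule_ker: "graded_submodule n r d ker"
  using graded_submodule_free_module[of n r d]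
  by (auto simp: graded_submodule_def ker_def mat_map_add mat_map_scale phi_vec_part)

text \<open>A coefficientwise lift becomes homogeneous after projection to degree \<open>t\<close>;
  the projection commutes with \<open>phi\<close> and fixes \<open>c\<close>, so the result is still
  a lift.\<close>

lemma chain_lift:
  assumes c: "c \<in> koszul_chains n im p" "chain_part d' t c = c"
  shows "\<exists>f\<in>koszul_chains n (free_module n r) p. chain_part d t f = f \<and> (\<lambda>A. phi (f A)) = c"
proof -
  have "\<forall>A. \<exists>v\<in>free_module n r. phi v = c A \<and> (\<not> (A \<subseteq> {0..n} \<and> card A = p) \<longrightarrow> v = (\<lambda>_. 0))"
  proof
    fix A
    show "\<exists>v\<in>free_module n r. phi v = c A \<and> (\<not> (A \<subseteq> {0..n} \<and> card A = p) \<longrightarrow> v = (\<lambda>_. 0))"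
    proof (cases "A \<subseteq> {0..n} \<and> card A = p")
      case True
      then have "c A \<in> im" using koszul_chains_in[OF c(1)] by simp
      then show ?thesis using True by (auto simp: im_def)
    next
      case False
      then show ?thesis
        using koszul_chains_0[OF c(1) False] graded_submodule_0[OF graded_submodule_free_module[of n r d]]
        by (intro bexI[of _ "\<lambda>_. 0"]) auto
    qed
  qed
  then have "\<forall>A. \<exists>v. v \<in> free_module n r \<and> phi v = c A \<and> (\<not> (A \<subseteq> {0..n} \<and> card A = p) \<longrightarrow> v = (\<lambda>_. 0))"
    by blast
  from choice[OF this] obtain f where f: "\<And>A. f A \<in> free_module n r" "\<And>A. phi (f A) = c A"
    "\<And>A. \<not> (A \<subseteq> {0..n} \<and> card A = p) \<Longrightarrow> f A = (\<lambda>_. 0)"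
    by auto
  then have "f \<in> koszul_chains n (free_module n r) p"
    by (intro koszul_chainsI)
  then have "chain_part d t f \<in> koszul_chains n (free_module n r) p"
    by (rule chain_part_chains[OF graded_submodule_free_module])
  moreover have "(\<lambda>A. phi (chain_part d t f A)) = c"
    unfolding phi_chain_part f(2) using c(2) by simp
  ultimately show ?thesis by (intro bexI[of _ "chain_part d t f"]) auto
qed

lemma phi_chains:
  "f \<in> koszul_chains n (free_module n r) p \<Longrightarrow> (\<lambda>A. phi (f A)) \<in> koszul_chains n im p"
  by (auto simp: koszul_chains_def im_def split: if_splits)

lemma ker_chainsI:
  assumes "f \<in> koszul_chains n (free_module n r) p" "(\<lambda>A. phi (f A)) = (\<lambda>_ _. 0)"
  shows "f \<in> koszul_chains n ker p"
  using assms by (auto simp: koszul_chains_def ker_def fun_eq_iff split: if_splits)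

end

text \<open>Minimality is expressed through relations: the kernel of the cover lies in (x_0, ...,
  x_n) times the free module.\<close>

locale minimal_cover = graded_map +
  assumes minimal: "v \<in> free_module n r \<Longrightarrow> mat_map r' r P v = (\<lambda>_. 0) \<Longrightarrow> lookup (v l) 0 = 0"
begin

text \<open>The connecting homomorphism of the cover, minimality handling the case \<open>p = 0\<close>.\<close>

lemma koszul_exact_shift: "koszul_exact n d ker p t \<longleftrightarrow> koszul_exact n d' im (Suc p) t"
proof
  note F = graded_submodule_free_module[of n r d]
  have kerF: "ker \<subseteq> free_module n r" by (auto simp: ker_def)
  {
    assume ex: "koszul_exact n d' im (Suc p) t"
    show "koszul_exact n d ker p t"
      unfolding koszul_exact_def
    proof (intro ballI impI, elim conjE)
      fix z assume z: "z \<in> koszul_chains n ker p" "chain_part d t z = z" "module_diff n z = (\<lambda>_ _. 0)"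
      have "lookup (z {} k) 0 = 0" for k
        using koszul_chains_mem[OF graded_submodule_ker z(1), of "{}"] minimal[of "z {}"] by (auto simp: ker_def)
      then obtain f where f: "f \<in> koszul_chains n (free_module n r) (Suc p)" "chain_part d t f = f" "module_diff n f = z"
        using free_module_exact[OF koszul_chains_mono[OF kerF z(1)] z(2,3)] by blast
      have "module_diff n (\<lambda>A. phi (f A)) = (\<lambda>_ _. 0)"
      proof
        fix A
        show "module_diff n (\<lambda>A. phi (f A)) A = (\<lambda>_. 0)"
          using koszul_chains_mem[OF graded_submodule_ker z(1), of A]
          by (simp add: module_diff_mat_map f ker_def)
      qed
      moreover have "chain_part d' t (\<lambda>A. phi (f A)) = (\<lambda>A. phi (f A))"
        using f(2) by (simp flip: phi_chain_part)
      ultimately obtain b where b: "b \<in> koszul_chains n im (Suc (Suc p))" "chain_part d' t b = b"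
        "module_diff n b = (\<lambda>A. phi (f A))"
        using ex phi_chains[OF f(1)] unfolding koszul_exact_def by blast
      obtain f' where f': "f' \<in> koszul_chains n (free_module n r) (Suc (Suc p))" "chain_part d t f' = f'"
        "(\<lambda>A. phi (f' A)) = b"
        using chain_lift[OF b(1,2)] by blast
      \<comment> \<open>The bounding chain \<open>f\<close> lies in the free module, not yet in
        \<open>ker\<close>. Subtracting the boundary of a lift of \<open>b\<close> makes its image
        vanish and leaves its own boundary \<open>z\<close> unchanged.\<close>
      define g where "g = (\<lambda>A k. f A k - module_diff n f' A k)"
      have df': "module_diff n f' \<in> koszul_chains n (free_module n r) (Suc p)"
        by (rule module_diff_chains[OF F f'(1)])
      have phi_f': "phi (module_diff n f' A) = phi (f A)" for A
        using module_diff_mat_map[of n r' r P f'] f'(3) b(3) by metis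
      have "g \<in> koszul_chains n (free_module n r) (Suc p)"
        unfolding g_def by (rule koszul_chains_diff[OF F f(1) df'])
      moreover have "(\<lambda>A. phi (g A)) = (\<lambda>_ _. 0)"
        by (simp add: g_def mat_map_minus phi_f')
      ultimately have "g \<in> koszul_chains n ker (Suc p)"
        by (rule ker_chainsI)
      moreover have "chain_part d t g = g"
        unfolding g_def using f(2) f'(2) module_diff_chain_part[OF f'(1), of d t]
        by (intro chain_part_minus) auto
      moreover have "module_diff n g = z"
        unfolding g_def module_diff_minus module_diff_diff[OF f'(1)] f(3) by simp
      ultimately show "\<exists>b\<in>koszul_chains n ker (Suc p). chain_part d t b = b \<and> module_diff n b = z"
        by blast
    qed
  next
    assume ex: "koszul_exact n d ker p t"
    show "koszul_exact n d' im (Suc p) t"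
      unfolding koszul_exact_def
    proof (intro ballI impI, elim conjE)
      fix c assume c: "c \<in> koszul_chains n im (Suc p)" "chain_part d' t c = c" "module_diff n c = (\<lambda>_ _. 0)"
      obtain f where f: "f \<in> koszul_chains n (free_module n r) (Suc p)" "chain_part d t f = f" "(\<lambda>A. phi (f A)) = c"
        using chain_lift[OF c(1,2)] by blast
      have "(\<lambda>A. phi (module_diff n f A)) = (\<lambda>_ _. 0)"
        using module_diff_mat_map[of n r' r P f] f(3) c(3) by metis
      then have "module_diff n f \<in> koszul_chains n ker p"
        by (rule ker_chainsI[OF module_diff_chains[OF F f(1)]])
      moreover have "chain_part d t (module_diff n f) = module_diff n f"
        using module_diff_chain_part[OF f(1), of d t] f(2) by simp
      ultimately obtain z where z: "z \<in> koszul_chains n ker (Suc p)" "chain_part d t z = z"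
        "module_diff n z = module_diff n f"
        using ex module_diff_diff[OF f(1)] unfolding koszul_exact_def by blast
      \<comment> \<open>Correcting the lift by a chain of the kernel makes it a cycle without
        changing its image \<open>c\<close>.\<close>
      define g where "g = (\<lambda>A k. f A k - z A k)"
      have g: "g \<in> koszul_chains n (free_module n r) (Suc p)"
        unfolding g_def by (rule koszul_chains_diff[OF F f(1) koszul_chains_mono[OF kerF z(1)]])
      have gt: "chain_part d t g = g"
        unfolding g_def by (rule chain_part_minus[OF f(2) z(2)])
      have dg: "module_diff n g = (\<lambda>_ _. 0)"
        by (simp add: g_def module_diff_minus z(3))
      \<comment> \<open>The homological degree is positive, so the constant term condition of
        \<open>free_module_exact\<close> holds trivially.\<close>
      have "g {} = (\<lambda>_. 0)"
        by (rule koszul_chains_0[OF g]) simp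
      then obtain h where h: "h \<in> koszul_chains n (free_module n r) (Suc (Suc p))" "chain_part d t h = h" "module_diff n h = g"
        using free_module_exact[OF g gt dg] by auto
      have "phi (z A) = (\<lambda>_. 0)" for A
        using koszul_chains_mem[OF graded_submodule_ker z(1), of A] by (simp add: ker_def)
      then have "(\<lambda>A. phi (g A)) = c"
        using f(3) by (simp add: g_def mat_map_minus fun_eq_iff)
      then have "module_diff n (\<lambda>A. phi (h A)) = c"
        by (simp add: module_diff_mat_map h(3))
      moreover have "chain_part d' t (\<lambda>A. phi (h A)) = (\<lambda>A. phi (h A))"
        using h(2) by (simp flip: phi_chain_part)
      ultimately show "\<exists>b\<in>koszul_chains n im (Suc (Suc p)). chain_part d' t b = b \<and> module_diff n b = c"
        using phi_chains[OF h(1)] by blast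
    qed
  }
qed

definition unit_vec :: "nat \<Rightarrow> nat \<Rightarrow> 'a mpoly"
  where "unit_vec l = (\<lambda>k. if k = l then 1 else 0)"

lemma unit_vec_free: "l < r \<Longrightarrow> unit_vec l \<in> free_module n r"
  by (auto simp: unit_vec_def free_module_def poly_ring_0 poly_ring_1)

text \<open>Koszul homology in degree 0 is M / (x_0, ..., x_n) M for the image M of the cover, and
  for a minimal cover the generators form a basis of this quotient.\<close>

lemma generator_degree_iff: "(\<exists>l<r. d l = t) \<longleftrightarrow> \<not> koszul_exact n d' im 0 t"
proof
  note F = graded_submodule_free_module[of n r d]
  assume "\<exists>l<r. d l = t"
  then obtain l where l: "l < r" "d l = t" by blast
  show "\<not> koszul_exact n d' im 0 t"
  proof
    assume ex: "koszul_exact n d' im 0 t"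
    define e :: "nat set \<Rightarrow> nat \<Rightarrow> 'a mpoly" where "e = (\<lambda>A. if A = {} then unit_vec l else (\<lambda>_. 0))"
    have e: "e \<in> koszul_chains n (free_module n r) 0"
      using unit_vec_free[OF l(1)] by (auto simp: e_def koszul_chains_def card_eq_0_iff dest: finite_subset)
    have et: "chain_part d t e = e"
      using l by (auto simp: chain_part_def e_def unit_vec_def fun_eq_iff mpoly_filter_eq_self_iff)
    have "chain_part d' t (\<lambda>A. phi (e A)) = (\<lambda>A. phi (e A))"
      using et by (simp flip: phi_chain_part)
    then obtain b where b: "b \<in> koszul_chains n im (Suc 0)" "chain_part d' t b = b" "module_diff n b = (\<lambda>A. phi (e A))"
      using ex phi_chains[OF e] module_diff_0_chain[OF phi_chains[OF e]] unfolding koszul_exact_def by blast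
    obtain f where f: "f \<in> koszul_chains n (free_module n r) (Suc 0)" "(\<lambda>A. phi (f A)) = b"
      using chain_lift[OF b(1,2)] by blast
    \<comment> \<open>If the image of e_l were a boundary, lifting the bounding chain would yield
      this relation among the generators. Its entry at \<open>l\<close> has constant term 1, against
      minimality.\<close>
    define v where "v = (\<lambda>k. unit_vec l k - module_diff n f {} k)"
    have phi_f: "phi (module_diff n f {}) = phi (unit_vec l)"
      using module_diff_mat_map[of n r' r P f] f(2) b(3) by (metis e_def)
    have "v \<in> free_module n r"
      unfolding v_def by (intro graded_submodule_diff[OF F] unit_vec_free l(1)
        koszul_chains_mem[OF F module_diff_chains[OF F f(1)]])
    moreover have "phi v = (\<lambda>_. 0)"
      by (simp add: v_def mat_map_minus phi_f)
    ultimately have "lookup (v l) 0 = 0"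
      by (rule minimal)
    moreover have "lookup (module_diff n f {} l) 0 = 0"
      by (simp add: module_diff_def koszul_diff_def lookup_sum koszul_sign_mpoly mult.assoc lookup_const_mult lookup_var_mult)
    ultimately show False
      by (simp add: v_def unit_vec_def lookup_minus lookup_one)
  qed
next
  assume "\<not> koszul_exact n d' im 0 t"
  show "\<exists>l<r. d l = t"
  proof (rule ccontr)
    assume no: "\<not> (\<exists>l<r. d l = t)"
    have "koszul_exact n d' im 0 t"
      unfolding koszul_exact_def
    proof (intro ballI impI, elim conjE)
      fix c assume c: "c \<in> koszul_chains n im 0" "chain_part d' t c = c" "module_diff n c = (\<lambda>_ _. 0)"
      obtain f where f: "f \<in> koszul_chains n (free_module n r) 0" "chain_part d t f = f" "(\<lambda>A. phi (f A)) = c"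
        using chain_lift[OF c(1,2)] by blast
      \<comment> \<open>A constant term in coordinate \<open>k\<close> of a chain of degree
        \<open>t\<close> would require \<open>d k = t\<close>.\<close>
      have "lookup (f {} k) 0 = 0" for k
      proof (cases "k < r")
        case True
        then have "lookup (chain_part d t f {} k) 0 = 0"
          using no by (auto simp: chain_part_def)
        then show ?thesis using f(2) by simp
      next
        case False
        then show ?thesis
          using koszul_chains_mem[OF graded_submodule_free_module[of n r d] f(1), of "{}"] by (simp add: free_module_def)
      qed
      then obtain h where h: "h \<in> koszul_chains n (free_module n r) (Suc 0)" "chain_part d t h = h" "module_diff n h = f"
        using free_module_exact[OF f(1,2) module_diff_0_chain[OF f(1)]] by blast
      have "module_diff n (\<lambda>A. phi (h A)) = c"
        by (simp add: module_diff_mat_map h(3) f(3))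
      moreover have "chain_part d' t (\<lambda>A. phi (h A)) = (\<lambda>A. phi (h A))"
        using h(2) by (simp flip: phi_chain_part)
      ultimately show "\<exists>b\<in>koszul_chains n im (Suc 0). chain_part d' t b = b \<and> module_diff n b = c"
        using phi_chains[OF h(1)] by blast
    qed
    then show False using \<open>\<not> koszul_exact n d' im 0 t\<close> by contradiction
  qed
qed

end

subsection \<open>Existence of minimal covers\<close>

definition poly_submodule :: "nat \<Rightarrow> (nat \<Rightarrow> 'a::field mpoly) set \<Rightarrow> bool"
  where "poly_submodule n N \<longleftrightarrow> (\<lambda>_. 0) \<in> N \<and> (\<forall>v\<in>N. \<forall>w\<in>N. (\<lambda>k. v k + w k) \<in> N) \<and>
    (\<forall>s\<in>carrier (poly_ring n). \<forall>v\<in>N. (\<lambda>k. s * v k) \<in> N)"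

definition poly_span :: "nat \<Rightarrow> (nat \<Rightarrow> 'a::field mpoly) set \<Rightarrow> (nat \<Rightarrow> 'a mpoly) set"
  where "poly_span n B = {(\<lambda>k. \<Sum>b\<in>B. a b * b k) | a. \<forall>b. a b \<in> carrier (poly_ring n)}"

lemma graded_submodule_imp_poly_submodule: "graded_submodule n r d M \<Longrightarrow> poly_submodule n M"
  by (auto simp: graded_submodule_def poly_submodule_def)

lemma poly_submodule_scaled_sum:
  assumes "poly_submodule n N" "\<And>i. i \<in> B \<Longrightarrow> s i \<in> carrier (poly_ring n)" "\<And>i. i \<in> B \<Longrightarrow> f i \<in> N"
  shows "(\<lambda>k. \<Sum>i\<in>B. s i * f i k) \<in> N"
  using assms(2,3)
  by (induction B rule: infinite_finite_induct) (use assms(1) in \<open>auto simp: poly_submodule_def\<close>)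

lemma poly_span_minimal: "poly_submodule n N \<Longrightarrow> B \<subseteq> N \<Longrightarrow> poly_span n B \<subseteq> N"
  unfolding poly_span_def using poly_submodule_scaled_sum[of n N B _ "\<lambda>b. b"] by auto

lemma poly_submodule_span: "poly_submodule n (poly_span n B)"
  unfolding poly_submodule_def
proof (intro conjI ballI)
  show "(\<lambda>_. 0) \<in> poly_span n B"
    by (auto simp: poly_span_def poly_ring_0 intro!: exI[of _ "\<lambda>_. 0"])
  fix v assume "v \<in> poly_span n B"
  then obtain a where a: "v = (\<lambda>k. \<Sum>b\<in>B. a b * b k)" "\<forall>b. a b \<in> carrier (poly_ring n)"
    by (auto simp: poly_span_def)
  {
    fix s :: "'a mpoly" assume s: "s \<in> carrier (poly_ring n)"
    show "(\<lambda>k. s * v k) \<in> poly_span n B"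
      using a s by (auto simp: poly_span_def sum_distrib_left mult.assoc poly_ring_mult intro!: exI[of _ "\<lambda>b. s * a b"])
  }
  fix w assume "w \<in> poly_span n B"
  then obtain a' where a': "w = (\<lambda>k. \<Sum>b\<in>B. a' b * b k)" "\<forall>b. a' b \<in> carrier (poly_ring n)"
    by (auto simp: poly_span_def)
  show "(\<lambda>k. v k + w k) \<in> poly_span n B"
    using a a' by (auto simp: poly_span_def sum.distrib distrib_right poly_ring_add intro!: exI[of _ "\<lambda>b. a b + a' b"])
qed

lemma poly_span_superset:
  assumes "finite B"
  shows "B \<subseteq> poly_span n B"
proof
  fix v assume "v \<in> B"
  then have "v = (\<lambda>k. \<Sum>b\<in>B. (if b = v then 1 else 0) * b k)"
    using assms by (simp add: if_distrib[of "\<lambda>x. x * _"] cong: if_cong)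
  then show "v \<in> poly_span n B"
    unfolding poly_span_def by (auto simp: poly_ring_0 poly_ring_1 intro!: exI[of _ "\<lambda>b. if b = v then 1 else 0"])
qed

lemma finite_monomials_bounded: "finite {m. keys m \<subseteq> {0..n} \<and> mono_deg m \<le> t}"
proof -
  let ?S = "{m. keys m \<subseteq> {0..n} \<and> mono_deg m \<le> t}"
  have "lookup ` ?S \<subseteq> {f. \<forall>i. (i \<in> {0..n} \<longrightarrow> f i \<in> {0..t}) \<and> (i \<notin> {0..n} \<longrightarrow> f i = 0)}"
  proof (safe; simp)
    fix m i assume m: "keys m \<subseteq> {0..n}" "mono_deg m \<le> t"
    show "lookup m i \<le> t"
    proof (cases "i \<in> keys m")
      case True
      then have "lookup m i \<le> mono_deg m"
        unfolding mono_deg_def by (intro member_le_sum) auto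
      then show ?thesis using m by simp
    qed (simp add: in_keys_iff)
    show "\<not> i \<le> n \<Longrightarrow> lookup m i = 0"
      using m by (auto simp: in_keys_iff)
  qed
  then have "finite (lookup ` ?S)"
    by (rule finite_subset) (rule finite_set_of_finite_funs; simp)
  then show ?thesis
    by (rule finite_imageD) (simp add: inj_on_def)
qed

lemma sum_fun_apply: "(\<Sum>i\<in>B. f i) k = (\<Sum>i\<in>B. f i k)"
  by (induction B rule: infinite_finite_induct) auto

text \<open>The part of degree \<open>t\<close> is a vector space over the field, contained in the
  span of the finitely many monomial vectors of bounded degree, so a maximal independent subset is
  finite.\<close>

lemma homogeneous_part_finitely_spanned:
  fixes M :: "(nat \<Rightarrow> 'a::field mpoly) set"
  assumes M: "graded_submodule n r d M"
  shows "\<exists>B. finite B \<and> B \<subseteq> {v \<in> M. vec_part d t v = v} \<and> {v \<in> M. vec_part d t v = v} \<subseteq> poly_span n B"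
proof -
  define scale :: "'a \<Rightarrow> (nat \<Rightarrow> 'a mpoly) \<Rightarrow> nat \<Rightarrow> 'a mpoly"
    where "scale a v = (\<lambda>k. Poly_Mapping.single 0 a * v k)" for a v
  interpret vs: vector_space scale
    by unfold_locales (auto simp: scale_def fun_eq_iff distrib_left distrib_right single_add mult_single
      simp flip: mult.assoc)
  define E :: "nat \<times> (nat \<Rightarrow>\<^sub>0 nat) \<Rightarrow> nat \<Rightarrow> 'a mpoly"
    where "E x = (\<lambda>k. if k = fst x then Poly_Mapping.single (snd x) 1 else 0)" for x
  define S where "S = {..<r} \<times> {m. keys m \<subseteq> {0..n} \<and> mono_deg m \<le> t}"
  have finS: "finite S"
    by (simp add: S_def finite_monomials_bounded)
  let ?M = "{v \<in> M. vec_part d t v = v}"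
  have span: "?M \<subseteq> vs.span (E ` S)"
  proof
    fix v assume "v \<in> ?M"
    then have v: "v \<in> free_module n r" "vec_part d t v = v"
      using graded_submodule_free[OF M] by auto
    have "v = (\<Sum>x\<in>S. scale (lookup (v (fst x)) (snd x)) (E x))"
    proof (intro ext poly_mapping_eqI)
      fix k m
      have "lookup ((\<Sum>x\<in>S. scale (lookup (v (fst x)) (snd x)) (E x)) k) m
          = (\<Sum>x\<in>S. if x = (k, m) then lookup (v k) m else 0)"
        unfolding sum_fun_apply lookup_sum
        by (intro sum.cong) (auto simp: scale_def E_def mult_single lookup_single when_def)
      also have "\<dots> = lookup (v k) m"
      proof (cases "(k, m) \<in> S")
        case False
        have "m \<notin> keys (v k)"
        proof
          assume m: "m \<in> keys (v k)"
          then have "k < r" using v(1) by (cases "k < r") (auto simp: free_module_def)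
          moreover from this have "keys m \<subseteq> {0..n}"
            using m v(1) by (auto simp: free_module_def mem_poly_ring_iff)
          moreover have "m \<in> keys (vec_part d t v k)" using m v(2) by simp
          then have "mono_deg m + d k = t" by (simp add: vec_part_def keys_mpoly_filter)
          ultimately show False using False by (simp add: S_def)
        qed
        then show ?thesis using False finS by (simp add: in_keys_iff)
      qed (use finS in simp)
      finally show "lookup (v k) m = lookup ((\<Sum>x\<in>S. scale (lookup (v (fst x)) (snd x)) (E x)) k) m"
        by simp
    qed
    also have "\<dots> \<in> vs.span (E ` S)"
      by (intro vs.span_sum vs.span_scale vs.span_base) auto
    finally show "v \<in> vs.span (E ` S)" .
  qed
  obtain B where B: "B \<subseteq> ?M" "vs.independent B" "?M \<subseteq> vs.span B"
    using vs.maximal_independent_subset by blast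
  have finB: "finite B"
    using vs.independent_span_bound[of "E ` S" B] finS B span by auto
  have "vs.subspace (poly_span n B)"
    using poly_submodule_span[of n B]
    by (auto simp: vs.subspace_def poly_submodule_def zero_fun_def plus_fun_def scale_def intro: poly_ring_const)
  then have "vs.span B \<subseteq> poly_span n B"
    by (rule vs.span_minimal[OF poly_span_superset[OF finB]])
  then show ?thesis using B finB by blast
qed

lemma sum_vec_part:
  assumes "v \<in> free_module n r"
  shows "\<exists>N. v = (\<lambda>k. \<Sum>t\<le>N. vec_part d t v k)"
proof -
  define X where "X = (\<Union>k<r. (\<lambda>m. mono_deg m + d k) ` keys (v k))"
  have "finite X" by (simp add: X_def)
  have "v = (\<lambda>k. \<Sum>t\<le>Max X. vec_part d t v k)"
  proof (intro ext poly_mapping_eqI)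
    fix k m
    have "lookup (\<Sum>t\<le>Max X. vec_part d t v k) m = (\<Sum>t\<le>Max X. if t = mono_deg m + d k then lookup (v k) m else 0)"
      by (auto simp: lookup_sum vec_part_def intro!: sum.cong)
    also have "\<dots> = lookup (v k) m"
    proof (cases "m \<in> keys (v k)")
      case True
      then have "k < r" using assms by (cases "k < r") (auto simp: free_module_def)
      then have "mono_deg m + d k \<in> X" using True by (auto simp: X_def)
      then show ?thesis using \<open>finite X\<close> by simp
    qed (simp add: in_keys_iff)
    finally show "lookup (v k) m = lookup (\<Sum>t\<le>Max X. vec_part d t v k) m" by simp
  qed
  then show ?thesis by blast
qed

text \<open>Beyond \<open>D\<close>, exactness in homological degree 0 says that each homogeneous
  element is a combination of the variables with coefficients in \<open>M\<close> of degree one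
  less. By induction on the degree the parts up to \<open>D\<close> generate everything.\<close>

lemma homogeneous_generators_exist:
  fixes M :: "(nat \<Rightarrow> 'a::field mpoly) set"
  assumes M: "graded_submodule n r d M" and ex: "\<And>t. t > D \<Longrightarrow> koszul_exact n d M 0 t"
  shows "\<exists>B. finite B \<and> (\<forall>b\<in>B. \<exists>t. vec_part d t b = b) \<and> poly_span n B = M"
proof -
  have "\<forall>t. \<exists>B. finite B \<and> B \<subseteq> {v \<in> M. vec_part d t v = v} \<and> {v \<in> M. vec_part d t v = v} \<subseteq> poly_span n B"
    by (intro allI homogeneous_part_finitely_spanned[OF M])
  from choice[OF this] obtain B0 where B0: "\<And>t. finite (B0 t)" "\<And>t. B0 t \<subseteq> {v \<in> M. vec_part d t v = v}"
    "\<And>t. {v \<in> M. vec_part d t v = v} \<subseteq> poly_span n (B0 t)"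
    by (elim exE) blast
  define B where "B = (\<Union>t\<le>D. B0 t)"
  have finB: "finite B" by (simp add: B_def B0)
  have sub: "poly_submodule n (poly_span n B)" by (rule poly_submodule_span)
  have low: "poly_span n (B0 t) \<subseteq> poly_span n B" if "t \<le> D" for t
    by (rule poly_span_minimal[OF sub]) (use that poly_span_superset[OF finB] in \<open>auto simp: B_def\<close>)
  have parts: "v \<in> poly_span n B" if "v \<in> M" "vec_part d t v = v" for v t
    using that
  proof (induction t arbitrary: v rule: less_induct)
    case (less t)
    show ?case
    proof (cases "t \<le> D")
      case True
      then show ?thesis using less.prems B0(3)[of t] low[of t] by blast
    next
      case False
      \<comment> \<open>A module element is a 0-chain placed at the empty set, and bounding it by
        \<open>b\<close> means writing it as the sum of all x_i times \<open>b {i}\<close>.\<close>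
      define c where "c = (\<lambda>A::nat set. if A = {} then v else (\<lambda>_. 0))"
      have c: "c \<in> koszul_chains n M 0"
        using less.prems(1) by (auto simp: c_def koszul_chains_def card_eq_0_iff dest: finite_subset)
      have "chain_part d t c = c"
        using less.prems(2) by (auto simp: chain_part_vec_part c_def fun_eq_iff)
      then obtain b where b: "b \<in> koszul_chains n M (Suc 0)" "chain_part d t b = b" "module_diff n b = c"
        using ex[of t] False c module_diff_0_chain[OF c] unfolding koszul_exact_def by auto
      have "b {i} \<in> poly_span n B" for i
      proof (rule less.IH)
        show "t - 1 < t" using False by simp
        show "b {i} \<in> M" by (rule koszul_chains_mem[OF M b(1)])
        have "chain_part d t b {i} = b {i}" by (simp add: b(2))
        then show "vec_part d (t - 1) (b {i}) = b {i}"
          using False by (simp add: chain_part_vec_part)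
      qed
      then have "(\<lambda>k. \<Sum>i\<in>{0..n}. (koszul_sign i {} * var i) * b {i} k) \<in> poly_span n B"
        by (intro poly_submodule_scaled_sum[OF sub] poly_ring_closed) auto
      moreover have "v = module_diff n b {}" by (simp add: b(3) c_def)
      ultimately show ?thesis by (simp add: module_diff_def koszul_diff_def)
    qed
  qed
  have "M \<subseteq> poly_span n B"
  proof
    fix v assume v: "v \<in> M"
    obtain N where N: "v = (\<lambda>k. \<Sum>t\<le>N. vec_part d t v k)"
      using sum_vec_part[OF graded_submodule_free[OF M v]] by blast
    have "vec_part d t v \<in> poly_span n B" for t
      by (rule parts[of _ t]) (simp_all add: graded_submodule_part[OF M v], simp add: vec_part_def)
    then have "(\<lambda>k. \<Sum>t\<le>N. 1 * vec_part d t v k) \<in> poly_span n B"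
      by (intro poly_submodule_scaled_sum[OF sub] poly_ring_closed) auto
    then show "v \<in> poly_span n B" by (subst N) simp
  qed
  moreover have "poly_span n B \<subseteq> M"
    using B0(2) by (intro poly_span_minimal graded_submodule_imp_poly_submodule[OF M]) (auto simp: B_def)
  moreover have "\<forall>b\<in>B. \<exists>t. vec_part d t b = b"
    using B0(2) unfolding B_def by blast
  ultimately show ?thesis using finB by blast
qed

text \<open>A homogeneous generating set of least cardinality is taken. A relation with a nonzero
  constant entry could be solved for the corresponding generator, giving a smaller generating
  set.\<close>

lemma minimal_cover_exists:
  fixes M :: "(nat \<Rightarrow> 'a::field mpoly) set"
  assumes M: "graded_submodule n r' d' M" and ex: "\<And>t. t > D \<Longrightarrow> koszul_exact n d' M 0 t"
  shows "\<exists>r d P. minimal_cover n r' d' r d P \<and> graded_map.im n r' r P = M"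
proof -
  define good where "good B \<longleftrightarrow> finite B \<and> (\<forall>b\<in>B. \<exists>t. vec_part d' t b = b) \<and> poly_span n B = M" for B
  have "\<exists>B. good B"
    unfolding good_def by (rule homogeneous_generators_exist[OF M ex])
  then obtain B where B: "good B" and least: "\<And>B'. good B' \<Longrightarrow> card B \<le> card B'"
    using ex_has_least_nat[of good _ card] by blast
  have finB: "finite B" and spanB: "poly_span n B = M" using B by (auto simp: good_def)
  define r where "r = card B"
  obtain h where h: "bij_betw h {..<r} B"
    using ex_bij_betw_nat_finite[OF finB] by (auto simp: r_def atLeast0LessThan)
  have hB: "h l \<in> B" if "l < r" for l
    using h that by (auto simp: bij_betw_def)
  define d where "d l = (SOME t. vec_part d' t (h l) = h l)" for l
  have d: "vec_part d' (d l) (h l) = h l" if "l < r" for l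
    unfolding d_def by (rule someI_ex) (use B hB[OF that] in \<open>auto simp: good_def\<close>)
  define P where "P k l = h l k" for k l
  have BM: "B \<subseteq> M" using poly_span_superset[OF finB, of n] spanB by simp
  have hM: "h l \<in> M" if "l < r" for l using BM hB[OF that] by blast
  have hF: "h l \<in> free_module n r'" if "l < r" for l
    by (rule graded_submodule_free[OF M hM[OF that]])
  interpret graded_map n r' d' r d P
  proof
    fix k l assume kl: "k < r'" "l < r"
    show "P k l \<in> carrier (poly_ring n)"
      using hF[OF kl(2)] kl(1) by (simp add: P_def free_module_def)
    fix m assume "m \<in> keys (P k l)"
    then have "m \<in> keys (vec_part d' (d l) (h l) k)"
      by (simp add: d[OF kl(2)] P_def)
    then show "mono_deg m + d' k = d l"
      by (simp add: vec_part_def keys_mpoly_filter)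
  qed
  have phi_eq: "phi v = (\<lambda>k. \<Sum>l<r. v l * h l k)" for v
    using hF by (auto simp: mat_map_def P_def fun_eq_iff free_module_def mult.commute intro!: sum.neutral)
  have im: "im = M"
  proof
    show "im \<subseteq> M"
      unfolding im_def phi_eq
      by (auto intro!: poly_submodule_scaled_sum[OF graded_submodule_imp_poly_submodule[OF M]] hM
          simp: free_module_def)
    show "M \<subseteq> im"
    proof
      fix v assume "v \<in> M"
      then obtain a where a: "v = (\<lambda>k. \<Sum>b\<in>B. a b * b k)" "\<forall>b. a b \<in> carrier (poly_ring n)"
        unfolding spanB[symmetric] by (auto simp: poly_span_def)
      define w where "w l = (if l < r then a (h l) else 0)" for l
      have "phi w = v"
        unfolding phi_eq a
        by (rule ext) (simp add: w_def sum.reindex_bij_betw[OF h, symmetric])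
      moreover have "w \<in> free_module n r"
        using a(2) by (auto simp: w_def free_module_def)
      ultimately show "v \<in> im" unfolding im_def by blast
    qed
  qed
  have "minimal_cover n r' d' r d P"
  proof
    fix v l assume v: "v \<in> free_module n r" "phi v = (\<lambda>_. 0)"
    show "lookup (v l) 0 = 0"
    proof (rule ccontr)
      assume nz: "lookup (v l) 0 \<noteq> 0"
      then have l: "l < r"
        using v(1) by (cases "l < r") (auto simp: free_module_def)
      define a where "a = lookup (v l) 0"
      \<comment> \<open>In degree \<open>d l\<close> the entry at \<open>l\<close> can only be a
        constant, so \<open>u\<close> is a relation in which the generator \<open>h l\<close> has a
        nonzero scalar coefficient.\<close>
      define u where "u = vec_part d (d l) v"
      have u: "u \<in> free_module n r"
        unfolding u_def by (rule graded_submodule_part[OF graded_submodule_free_module v(1)])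
      have phi_u: "phi u = (\<lambda>_. 0)"
        unfolding u_def phi_vec_part v(2) by simp
      have ul: "u l = Poly_Mapping.single 0 a"
        by (rule poly_mapping_eqI) (auto simp: u_def vec_part_def a_def lookup_single when_def)
      let ?B = "B - {h l}"
      have sub: "poly_submodule n (poly_span n ?B)" by (rule poly_submodule_span)
      have "h l = (\<lambda>k. \<Sum>l'\<in>{..<r} - {l}. (Poly_Mapping.single 0 (- 1 / a) * u l') * h l' k)"
      proof
        fix k
        have "0 = phi u k" by (simp add: phi_u)
        also have "\<dots> = u l * h l k + (\<Sum>l'\<in>{..<r} - {l}. u l' * h l' k)"
          unfolding phi_eq using l by (intro sum.remove) auto
        finally have "(\<Sum>l'\<in>{..<r} - {l}. u l' * h l' k) = - (Poly_Mapping.single 0 a * h l k)"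
          by (simp add: ul eq_neg_iff_add_eq_0 add.commute)
        then have "(\<Sum>l'\<in>{..<r} - {l}. (Poly_Mapping.single 0 (- 1 / a) * u l') * h l' k)
            = Poly_Mapping.single 0 (- 1 / a) * (- (Poly_Mapping.single 0 a * h l k))"
          by (simp add: sum_distrib_left[symmetric] mult.assoc)
        also have "\<dots> = h l k"
          using nz by (simp add: mult.assoc[symmetric] mult_single a_def single_uminus)
        finally show "h l k = (\<Sum>l'\<in>{..<r} - {l}. (Poly_Mapping.single 0 (- 1 / a) * u l') * h l' k)" by simp
      qed
      moreover have "h l' \<in> ?B" if "l' \<in> {..<r} - {l}" for l'
        using that h l by (auto simp: bij_betw_def inj_on_def)
      then have "(\<lambda>k. \<Sum>l'\<in>{..<r} - {l}. (Poly_Mapping.single 0 (- 1 / a) * u l') * h l' k) \<in> poly_span n ?B"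
        using u poly_span_superset[of ?B n] finB
        by (intro poly_submodule_scaled_sum[OF sub] poly_ring_closed) (auto simp: free_module_def)
      ultimately have "h l \<in> poly_span n ?B" by simp
      then have "B \<subseteq> poly_span n ?B"
        using poly_span_superset[of ?B n] finB by auto
      then have "M \<subseteq> poly_span n ?B"
        unfolding spanB[symmetric] by (rule poly_span_minimal[OF sub])
      moreover have "poly_span n ?B \<subseteq> M"
        using BM by (intro poly_span_minimal graded_submodule_imp_poly_submodule[OF M]) auto
      ultimately have "good ?B" using B by (auto simp: good_def)
      then have "card B \<le> card ?B" by (rule least)
      then show False
        using card_Diff1_less[OF finB hB[OF l]] by simp
    qed
  qed
  then show ?thesis using im by blast
qed

subsection \<open>Minimal resolutions\<close>

text \<open>The ideal is viewed as a submodule of the free module of rank one, so that it can play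
  the part of a syzygy module.\<close>

definition ideal_module :: "'a::field mpoly set \<Rightarrow> (nat \<Rightarrow> 'a mpoly) set"
  where "ideal_module I = (\<lambda>p k. if k = 0 then p else 0) ` I"

lemma lookup_mult_0: "lookup a 0 = 0 \<Longrightarrow> lookup (a * b :: 'a::field mpoly) 0 = 0"
proof (rule ccontr)
  assume a: "lookup a 0 = 0" and "lookup (a * b) 0 \<noteq> 0"
  then have "0 \<in> keys (a * b)" by (simp add: in_keys_iff)
  then obtain m1 m2 where m: "0 = m1 + m2" "m1 \<in> keys a"
    using Poly_Mapping.keys_mult by blast
  have "mono_deg m1 + mono_deg m2 = 0"
    by (simp flip: m(1) mono_deg_add)
  then have "m1 = 0" by simp
  then show False using m a by (simp add: in_keys_iff)
qed

text \<open>Stage \<open>i\<close> is the map out of F_i. The polynomial ring itself, of rank 1 and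
  with generator in degree 0, is put in front as its target for \<open>i = 0\<close>, so the
  augmentation and the differentials are treated alike.\<close>

definition stage_rank :: "'a::field graded_resolution \<Rightarrow> nat \<Rightarrow> nat"
  where "stage_rank R i = (case i of 0 \<Rightarrow> 1 | Suc j \<Rightarrow> res_rank R j)"

definition stage_deg :: "'a::field graded_resolution \<Rightarrow> nat \<Rightarrow> nat \<Rightarrow> nat"
  where "stage_deg R i = (case i of 0 \<Rightarrow> (\<lambda>_. 0) | Suc j \<Rightarrow> res_deg R j)"

definition stage_map :: "'a::field graded_resolution \<Rightarrow> nat \<Rightarrow> nat \<Rightarrow> nat \<Rightarrow> 'a mpoly"
  where "stage_map R i = (case i of 0 \<Rightarrow> (\<lambda>k. res_aug R) | Suc j \<Rightarrow> res_diff R j)"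

lemma aug_map_mat_map: "mat_map 1 (res_rank R 0) (\<lambda>_. res_aug R) v = (\<lambda>k. if k = 0 then aug_map R v else 0)"
  by (simp add: mat_map_def aug_map_def fun_eq_iff)

lemma diff_map_mat_map: "diff_map R i = mat_map (res_rank R i) (res_rank R (Suc i)) (res_diff R i)"
  by (simp add: mat_map_def diff_map_def fun_eq_iff)

context
  fixes n :: nat and I :: "'a::field mpoly set" and R :: "'a graded_resolution"
  assumes res: "minimal_graded_free_resolution n I R"
begin

lemma stage_graded_map:
  "graded_map n (stage_rank R i) (stage_deg R i) (res_rank R i) (res_deg R i) (stage_map R i)"
  using res unfolding minimal_graded_free_resolution_def graded_map_def
  by (cases i) (auto simp: stage_rank_def stage_deg_def stage_map_def)

lemma stage_im_0: "graded_map.im n (stage_rank R 0) (res_rank R 0) (stage_map R 0) = ideal_module I"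
proof -
  have I: "I = aug_map R ` free_module n (res_rank R 0)"
    using res unfolding minimal_graded_free_resolution_def by (elim conjE) (rule sym)
  show ?thesis
    unfolding graded_map.im_def[OF stage_graded_map]
    unfolding stage_rank_def stage_map_def I ideal_module_def image_image
    using aug_map_mat_map[of R] by simp
qed

lemma stage_im_Suc:
  "graded_map.im n (stage_rank R (Suc i)) (res_rank R (Suc i)) (stage_map R (Suc i))
   = graded_map.ker n (stage_rank R i) (res_rank R i) (stage_map R i)"
proof (cases i)
  case 0
  have "{v \<in> free_module n (res_rank R 0). aug_map R v = 0} = diff_map R 0 ` free_module n (res_rank R (Suc 0))"
    using res unfolding minimal_graded_free_resolution_def by blast
  then show ?thesis
    unfolding graded_map.im_def[OF stage_graded_map] graded_map.ker_def[OF stage_graded_map]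
    using 0 aug_map_mat_map[of R] by (auto simp: stage_rank_def stage_map_def diff_map_mat_map fun_eq_iff)
next
  case (Suc j)
  have "{v \<in> free_module n (res_rank R (Suc j)). diff_map R j v = (\<lambda>_. 0)} =
      diff_map R (Suc j) ` free_module n (res_rank R (Suc (Suc j)))"
    using res unfolding minimal_graded_free_resolution_def by blast
  then show ?thesis
    unfolding graded_map.im_def[OF stage_graded_map] graded_map.ker_def[OF stage_graded_map]
    using Suc by (simp add: stage_rank_def stage_map_def diff_map_mat_map)
qed

text \<open>By exactness a relation at stage \<open>i\<close> is a combination of columns of the
  next matrix, whose entries have no constant term.\<close>

lemma stage_minimal_cover:
  "minimal_cover n (stage_rank R i) (stage_deg R i) (res_rank R i) (res_deg R i) (stage_map R i)"
proof (rule minimal_cover.intro[OF stage_graded_map], unfold_locales)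
  fix v l
  assume "v \<in> free_module n (res_rank R i)" "mat_map (stage_rank R i) (res_rank R i) (stage_map R i) v = (\<lambda>_. 0)"
  then have "v \<in> graded_map.im n (stage_rank R (Suc i)) (res_rank R (Suc i)) (stage_map R (Suc i))"
    unfolding stage_im_Suc graded_map.ker_def[OF stage_graded_map] by simp
  then obtain w where w: "v = mat_map (res_rank R i) (res_rank R (Suc i)) (res_diff R i) w"
    unfolding graded_map.im_def[OF stage_graded_map] by (auto simp: stage_rank_def stage_map_def)
  have const: "\<forall>k<res_rank R i. \<forall>l<res_rank R (Suc i). lookup (res_diff R i k l) 0 = 0"
    using res unfolding minimal_graded_free_resolution_def by blast
  then show "lookup (v l) 0 = 0"
    by (auto simp: w mat_map_def lookup_sum intro!: sum.neutral lookup_mult_0)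
qed

text \<open>Iterating the dimension shift \<open>i\<close> times leads from the image of stage
  \<open>i\<close> back to the ideal.\<close>

lemma koszul_exact_stage:
  "koszul_exact n (stage_deg R i) (graded_map.im n (stage_rank R i) (res_rank R i) (stage_map R i)) p t
   \<longleftrightarrow> koszul_exact n (\<lambda>_. 0) (ideal_module I) (i + p) t"
proof (induction i arbitrary: p)
  case 0
  then show ?case by (simp add: stage_im_0 stage_deg_def[of R 0])
next
  case (Suc i)
  have "stage_deg R (Suc i) = res_deg R i" by (simp add: stage_deg_def)
  then show ?case
    unfolding stage_im_Suc
    using minimal_cover.koszul_exact_shift[OF stage_minimal_cover[of i], of p t] Suc.IH[of "Suc p"] by simp
qed

text \<open>The basis degrees of F_i are read off from the stage it covers, via Koszul homology in
  degree 0. As \<open>R\<close> is arbitrary, they depend on the ideal alone.\<close>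

lemma resolution_degree_iff:
  "(\<exists>k<res_rank R i. res_deg R i k = t) \<longleftrightarrow> \<not> koszul_exact n (\<lambda>_. 0) (ideal_module I) i t"
  using minimal_cover.generator_degree_iff[OF stage_minimal_cover[of i], of t] koszul_exact_stage[of i 0 t] by simp

end

text \<open>Covers are chosen successively by dependent choice. The vanishing is assumed for all
  \<open>p\<close> because the shift consumes one homological degree per step; in this way the
  single bound \<open>D\<close> limits the generator degrees of every syzygy module.\<close>

lemma minimal_resolution_exists:
  fixes I :: "'a::field mpoly set"
  assumes M: "graded_submodule n 1 (\<lambda>_. 0) (ideal_module I)"
    and ex: "\<And>p t. t > D \<Longrightarrow> koszul_exact n (\<lambda>_. 0) (ideal_module I) p t"
  shows "\<exists>R. minimal_graded_free_resolution n I R"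
proof -
  define good :: "nat \<Rightarrow> nat \<times> (nat \<Rightarrow> nat) \<times> nat \<times> (nat \<Rightarrow> nat) \<times> (nat \<Rightarrow> nat \<Rightarrow> 'a mpoly) \<Rightarrow> bool"
    where "good i = (\<lambda>(r', d', r, d, P). minimal_cover n r' d' r d P \<and>
      (\<forall>p. \<forall>t>D. koszul_exact n d' (graded_map.im n r' r P) p t) \<and>
      (i = 0 \<longrightarrow> r' = 1 \<and> d' = (\<lambda>_. 0) \<and> graded_map.im n r' r P = ideal_module I))" for i
  define step :: "nat \<times> (nat \<Rightarrow> nat) \<times> nat \<times> (nat \<Rightarrow> nat) \<times> (nat \<Rightarrow> nat \<Rightarrow> 'a mpoly) \<Rightarrow>
      nat \<times> (nat \<Rightarrow> nat) \<times> nat \<times> (nat \<Rightarrow> nat) \<times> (nat \<Rightarrow> nat \<Rightarrow> 'a mpoly) \<Rightarrow> bool"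
    where "step = (\<lambda>(r', d', r, d, P) (s', e', s, e, Q). s' = r \<and> e' = d \<and>
      graded_map.im n s' s Q = graded_map.ker n r' r P)"
  have "\<exists>f. \<forall>i. good i (f i) \<and> step (f i) (f (Suc i))"
  proof (rule dependent_nat_choice)
    obtain r d P where "minimal_cover n 1 (\<lambda>_. 0) r d P" "graded_map.im n 1 r P = ideal_module I"
      using minimal_cover_exists[OF M, of D] ex by blast
    then have "good 0 (1, \<lambda>_. 0, r, d, P)" using ex by (simp add: good_def)
    then show "\<exists>x. good 0 x" by blast
  next
    fix x i assume x: "good i x"
    obtain r' d' r d P where x_eq: "x = (r', d', r, d, P)" by (cases x)
    interpret minimal_cover n r' d' r d P
      using x by (simp add: good_def x_eq)
    have exk: "koszul_exact n d ker p t" if "t > D" for p t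
      using x that by (simp add: good_def x_eq koszul_exact_shift)
    obtain s e Q where "minimal_cover n r d s e Q" "graded_map.im n r s Q = ker"
      using minimal_cover_exists[OF graded_submodule_ker, of D] exk by blast
    then have "good (Suc i) (r, d, s, e, Q)" "step x (r, d, s, e, Q)"
      using exk by (simp_all add: good_def step_def x_eq)
    then show "\<exists>y. good (Suc i) y \<and> step x y" by blast
  qed
  then obtain f where f: "\<And>i. good i (f i)" "\<And>i. step (f i) (f (Suc i))" by blast
  define r where "r i = fst (snd (snd (f i)))" for i
  define d where "d i = fst (snd (snd (snd (f i))))" for i
  define P where "P i = snd (snd (snd (snd (f i))))" for i
  define r' where "r' i = fst (f i)" for i
  define d' where "d' i = fst (snd (f i))" for i
  have f_eq: "f i = (r' i, d' i, r i, d i, P i)" for i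
    by (simp add: r'_def d'_def r_def d_def P_def)
  have cover: "minimal_cover n (r' i) (d' i) (r i) (d i) (P i)" for i
    using f(1)[of i] by (simp add: good_def f_eq)
  note gm = minimal_cover.axioms(1)[OF cover]
  have zero: "r' 0 = 1" "d' 0 = (\<lambda>_. 0)" "graded_map.im n (r' 0) (r 0) (P 0) = ideal_module I"
    using f(1)[of 0] unfolding good_def f_eq prod.case by blast+
  have suc: "r' (Suc i) = r i" "d' (Suc i) = d i"
    "graded_map.im n (r' (Suc i)) (r (Suc i)) (P (Suc i)) = graded_map.ker n (r' i) (r i) (P i)" for i
    using f(2)[of i] unfolding step_def f_eq prod.case by blast+
  define R :: "'a graded_resolution"
    where "R = \<lparr>res_rank = r, res_deg = d, res_aug = P 0 0, res_diff = (\<lambda>i. P (Suc i))\<rparr>"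
  have [simp]: "res_rank R = r" "res_deg R = d" "res_aug R = P 0 0" "res_diff R = (\<lambda>i. P (Suc i))"
    by (simp_all add: R_def)
  have aug: "mat_map (r' 0) (r 0) (P 0) v = (\<lambda>k. if k = 0 then aug_map R v else 0)" for v
    by (simp add: zero mat_map_def aug_map_def fun_eq_iff)
  have diff: "diff_map R i = mat_map (r' (Suc i)) (r (Suc i)) (P (Suc i))" for i
    by (simp add: suc mat_map_def diff_map_def fun_eq_iff)
  have "minimal_graded_free_resolution n I R"
    unfolding minimal_graded_free_resolution_def
  proof (intro conjI allI impI ballI)
    fix l assume l: "l < res_rank R 0"
    show "res_aug R l \<in> carrier (poly_ring n)"
      using graded_map.entries[OF gm[of 0]] l zero by simp
    fix m assume "m \<in> keys (res_aug R l)"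
    then show "mono_deg m = res_deg R 0 l"
      using graded_map.homogeneous[OF gm[of 0], of 0 l m] l zero by simp
  next
    fix i k l assume kl: "k < res_rank R i" "l < res_rank R (Suc i)"
    show "res_diff R i k l \<in> carrier (poly_ring n)"
      using graded_map.entries[OF gm[of "Suc i"]] kl suc by simp
    show "mono_deg m + res_deg R i k = res_deg R (Suc i) l" if "m \<in> keys (res_diff R i k l)" for m
      using graded_map.homogeneous[OF gm[of "Suc i"], of k l m] kl suc that by simp
    interpret S: minimal_cover n "r' (Suc i)" "d' (Suc i)" "r (Suc i)" "d (Suc i)" "P (Suc i)"
      by (rule cover)
    \<comment> \<open>The entries of column \<open>l\<close> are the coordinates of an element in
      the kernel of the previous cover, and minimality of that cover removes their constant
      terms.\<close>
    have "S.phi (S.unit_vec l) \<in> S.im"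
      using S.unit_vec_free kl by (simp add: S.im_def)
    then have "S.phi (S.unit_vec l) \<in> graded_map.ker n (r' i) (r i) (P i)"
      by (simp add: suc(3))
    then have "lookup (S.phi (S.unit_vec l) k) 0 = 0"
      using minimal_cover.minimal[OF cover[of i], of "S.phi (S.unit_vec l)"]
      by (simp add: graded_map.ker_def[OF gm])
    moreover have "S.phi (S.unit_vec l) k = P (Suc i) k l"
      using kl suc(1) by (simp add: mat_map_def S.unit_vec_def if_distrib[of "\<lambda>x. _ * x"] cong: if_cong)
    ultimately show "Poly_Mapping.lookup (res_diff R i k l) 0 = 0" by simp
  next
    have "(\<lambda>v. mat_map (r' 0) (r 0) (P 0) v 0) ` free_module n (r 0) = (\<lambda>v. v 0) ` ideal_module I"
      unfolding zero(3)[symmetric] graded_map.im_def[OF gm] by (simp add: image_image)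
    then show "aug_map R ` free_module n (res_rank R 0) = I"
      by (simp add: aug ideal_module_def image_image)
  next
    show "{v \<in> free_module n (res_rank R 0). aug_map R v = 0} = diff_map R 0 ` free_module n (res_rank R (Suc 0))"
      using suc(3)[of 0] unfolding graded_map.im_def[OF gm] graded_map.ker_def[OF gm] aug diff
      by (auto simp: fun_eq_iff)
  next
    fix i
    show "{v \<in> free_module n (res_rank R (Suc i)). diff_map R i v = (\<lambda>_. 0)} =
        diff_map R (Suc i) ` free_module n (res_rank R (Suc (Suc i)))"
      using suc(3)[of "Suc i"] unfolding graded_map.im_def[OF gm] graded_map.ker_def[OF gm] diff by simp
  qed
  then show ?thesis by blast
qed

lemma graded_betti_neq_0_iff:
  fixes I :: "'a::field mpoly set"
  assumes "graded_submodule n 1 (\<lambda>_. 0) (ideal_module I)"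
    and "\<And>p t. t > D \<Longrightarrow> koszul_exact n (\<lambda>_. 0) (ideal_module I) p t"
  shows "graded_betti n I i t \<noteq> 0 \<longleftrightarrow> \<not> koszul_exact n (\<lambda>_. 0) (ideal_module I) i t"
proof -
  define R where "R = (SOME R. minimal_graded_free_resolution n I R)"
  have "minimal_graded_free_resolution n I R"
    unfolding R_def by (rule someI_ex) (rule minimal_resolution_exists[OF assms])
  moreover have "graded_betti n I i t \<noteq> 0 \<longleftrightarrow> (\<exists>k<res_rank R i. res_deg R i k = t)"
    by (auto simp: graded_betti_def R_def[symmetric] card_eq_0_iff)
  ultimately show ?thesis by (simp add: resolution_degree_iff)
qed

subsection \<open>Circuit ideals and Hochster's formula\<close>

text \<open>When \<open>D\<close> is the complement of a clutter, the faces are the sets all of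
  whose 3-subsets are circuits, including every set of fewer than three vertices: the clique complex
  of the clutter.\<close>

definition nonface :: "nat set set \<Rightarrow> nat set \<Rightarrow> bool"
  where "nonface D B \<longleftrightarrow> (\<exists>F\<in>D. F \<subseteq> B)"

definition ideal_monomials :: "nat \<Rightarrow> nat set set \<Rightarrow> (nat \<Rightarrow>\<^sub>0 nat) set"
  where "ideal_monomials n D = {m \<in> monomials_in n. nonface D (keys m)}"

lemma keys_add_nat: "keys (a + m) = keys a \<union> keys (m :: nat \<Rightarrow>\<^sub>0 nat)"
  by (auto simp: in_keys_iff lookup_add)

lemma ideal_monomials_add:
  "a \<in> monomials_in n \<Longrightarrow> m \<in> ideal_monomials n D \<Longrightarrow> a + m \<in> ideal_monomials n D"
  unfolding ideal_monomials_def monomials_in_def nonface_def by (auto simp: keys_add_nat)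

definition monomial_ideal :: "(nat \<Rightarrow>\<^sub>0 nat) set \<Rightarrow> 'a::field mpoly set"
  where "monomial_ideal U = {p. keys p \<subseteq> U}"

lemma monomial_ideal_add: "p \<in> monomial_ideal U \<Longrightarrow> q \<in> monomial_ideal U \<Longrightarrow> p + q \<in> monomial_ideal U"
  unfolding monomial_ideal_def using Poly_Mapping.keys_add[of p q] by blast

lemma monomial_ideal_mult:
  assumes "s \<in> carrier (poly_ring n)" "p \<in> monomial_ideal (ideal_monomials n D)"
  shows "s * p \<in> monomial_ideal (ideal_monomials n D)"
  unfolding monomial_ideal_def
proof safe
  fix m assume "m \<in> keys (s * p)"
  then obtain a b where "m = a + b" "a \<in> keys s" "b \<in> keys p"
    using Poly_Mapping.keys_mult[of s p] by blast
  then show "m \<in> ideal_monomials n D"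
    using assms by (auto simp: monomial_ideal_def mem_poly_ring_iff monomials_in_def intro: ideal_monomials_add)
qed

text \<open>Each term of a polynomial on the right is a multiple of a generator; conversely, the
  polynomials supported on these monomials form an ideal containing the generators.\<close>

lemma circuit_ideal_eq:
  assumes D: "\<And>F. F \<in> D \<Longrightarrow> F \<subseteq> {0..n}"
  shows "(circuit_ideal n D :: 'a::field mpoly set) = monomial_ideal (ideal_monomials n D)"
proof
  let ?R = "poly_ring n :: 'a mpoly ring" and ?U = "ideal_monomials n D"
  interpret R: cring ?R by (rule cring_poly_ring)
  have finF: "finite F" if "F \<in> D" for F using D[OF that] finite_subset by blast
  have gens: "(\<lambda>F. \<Prod>i\<in>F. var i) ` D \<subseteq> carrier ?R"
    using finF D by (auto simp: prod_var mem_poly_ring_iff)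
  have minus: "\<ominus>\<^bsub>?R\<^esub> p = - p" if "p \<in> carrier ?R" for p :: "'a mpoly"
    by (rule R.minus_equality) (use that in \<open>auto intro: poly_ring_uminus\<close>)
  have "ideal (monomial_ideal ?U) ?R"
  proof (rule idealI)
    show "ring ?R" by unfold_locales
    show "subgroup (monomial_ideal ?U) (add_monoid ?R)"
    proof
      show sub: "monomial_ideal ?U \<subseteq> carrier (add_monoid ?R)"
        unfolding monomial_ideal_def ideal_monomials_def monomials_in_def poly_ring_def by auto
      show "\<one>\<^bsub>add_monoid ?R\<^esub> \<in> monomial_ideal ?U" by (simp add: monomial_ideal_def)
      show "x \<otimes>\<^bsub>add_monoid ?R\<^esub> y \<in> monomial_ideal ?U"
        if "x \<in> monomial_ideal ?U" "y \<in> monomial_ideal ?U" for x y :: "'a mpoly"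
        using that by (simp add: monomial_ideal_add)
      fix x :: "'a mpoly" assume x: "x \<in> monomial_ideal ?U"
      then have "x \<in> carrier ?R" using sub by auto
      then have "inv\<^bsub>add_monoid ?R\<^esub> x = - x"
        using minus[of x] by (simp add: a_inv_def)
      then show "inv\<^bsub>add_monoid ?R\<^esub> x \<in> monomial_ideal ?U"
        using x by (simp add: monomial_ideal_def)
    qed
    fix a x :: "'a mpoly" assume "a \<in> monomial_ideal ?U" "x \<in> carrier ?R"
    then have "x * a \<in> monomial_ideal ?U" by (rule monomial_ideal_mult[rotated])
    then show "x \<otimes>\<^bsub>?R\<^esub> a \<in> monomial_ideal ?U" "a \<otimes>\<^bsub>?R\<^esub> x \<in> monomial_ideal ?U"
      by (simp_all add: mult.commute)
  qed
  moreover have "(\<lambda>F. \<Prod>i\<in>F. var i :: 'a mpoly) ` D \<subseteq> monomial_ideal ?U"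
  proof (rule image_subsetI)
    fix F assume F: "F \<in> D"
    have "mono_of_set F \<in> ?U"
      using D[OF F] finF[OF F] F by (auto simp: ideal_monomials_def monomials_in_def nonface_def)
    then show "(\<Prod>i\<in>F. var i :: 'a mpoly) \<in> monomial_ideal ?U"
      by (simp add: monomial_ideal_def prod_var finF[OF F])
  qed
  ultimately show "circuit_ideal n D \<subseteq> (monomial_ideal ?U :: 'a mpoly set)"
    unfolding circuit_ideal_def by (rule R.genideal_minimal)
  show "monomial_ideal ?U \<subseteq> (circuit_ideal n D :: 'a mpoly set)"
  proof
    fix p :: "'a mpoly" assume p: "p \<in> monomial_ideal ?U"
    interpret I: ideal "circuit_ideal n D" ?R
      unfolding circuit_ideal_def by (rule R.genideal_ideal[OF gens])
    have single: "Poly_Mapping.single m (lookup p m) \<in> circuit_ideal n D" if "m \<in> keys p" for m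
    proof -
      have "m \<in> ?U" using p that by (auto simp: monomial_ideal_def)
      then obtain F where F: "F \<in> D" "F \<subseteq> keys m" "keys m \<subseteq> {0..n}"
        by (auto simp: ideal_monomials_def nonface_def monomials_in_def)
      have "(\<Prod>i\<in>F. var i :: 'a mpoly) \<in> circuit_ideal n D"
        unfolding circuit_ideal_def by (rule subsetD[OF R.genideal_self[OF gens]]) (rule imageI[OF F(1)])
      moreover have "Poly_Mapping.single (m - mono_of_set F) (lookup p m) \<in> carrier ?R"
        using F(3) by (auto simp: mem_poly_ring_iff in_keys_iff lookup_minus)
      ultimately have "Poly_Mapping.single (m - mono_of_set F) (lookup p m) * (\<Prod>i\<in>F. var i) \<in> circuit_ideal n D"
        using I.I_l_closed by simp
      then show ?thesis
        using minus_mono_of_set[OF F(2)] by (simp add: prod_var[OF finF[OF F(1)]] mult_single)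
    qed
    have "(\<Sum>m\<in>X. Poly_Mapping.single m (lookup p m)) \<in> circuit_ideal n D" if "finite X" "X \<subseteq> keys p" for X
      using that
    proof (induction X rule: finite_induct)
      case empty
      show ?case using I.zero_closed by simp
    next
      case (insert m X)
      then show ?case using I.a_closed single[of m] by auto
    qed
    moreover have "p = (\<Sum>m\<in>keys p. Poly_Mapping.single m (lookup p m))"
      by (rule poly_mapping_eqI) (simp add: lookup_sum lookup_single when_def in_keys_iff)
    ultimately show "p \<in> circuit_ideal n D" by (metis finite_keys order_refl)
  qed
qed

lemma ideal_module_iff: "v \<in> ideal_module I \<longleftrightarrow> v 0 \<in> I \<and> (\<forall>k\<noteq>0. v k = 0)"
  unfolding ideal_module_def by (auto simp: fun_eq_iff intro!: image_eqI[of _ _ "v 0"])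

lemma graded_submodule_monomial_ideal:
  "graded_submodule n 1 (\<lambda>_. 0) (ideal_module (monomial_ideal (ideal_monomials n D) :: 'a::field mpoly set))"
  unfolding graded_submodule_def
proof (intro conjI ballI allI)
  let ?I = "monomial_ideal (ideal_monomials n D) :: 'a mpoly set"
  have "?I \<subseteq> carrier (poly_ring n)"
    unfolding monomial_ideal_def ideal_monomials_def monomials_in_def poly_ring_def by auto
  then show "ideal_module ?I \<subseteq> free_module n 1"
    by (auto simp: ideal_module_iff free_module_def)
  show "(\<lambda>_. 0) \<in> ideal_module ?I"
    by (simp add: ideal_module_iff monomial_ideal_def)
  fix v assume v: "v \<in> ideal_module ?I"
  show "(\<lambda>k. v k + w k) \<in> ideal_module ?I" if "w \<in> ideal_module ?I" for w
    using v that by (simp add: ideal_module_iff monomial_ideal_add)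
  show "(\<lambda>k. s * v k) \<in> ideal_module ?I" if "s \<in> carrier (poly_ring n)" for s
    using v that by (simp add: ideal_module_iff monomial_ideal_mult)
  show "vec_part (\<lambda>_. 0) t v \<in> ideal_module ?I" for t
    using v by (auto simp: ideal_module_iff vec_part_def monomial_ideal_def keys_mpoly_filter)
qed

text \<open>The part of total degree \<open>t\<close> is the direct sum of the strands of the
  multidegrees of degree \<open>t\<close>, and each strand can be treated on its own.\<close>

lemma koszul_exact_monomial_ideal_iff:
  fixes n D
  defines "U \<equiv> ideal_monomials n D"
  shows "koszul_exact n (\<lambda>_. 0) (ideal_module (monomial_ideal U :: 'a::field mpoly set)) p t
    \<longleftrightarrow> (\<forall>m\<in>monomials_in n. mono_deg m = t \<longrightarrow> multi_acyclic TYPE('a) U m p)"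
proof
  let ?M = "ideal_module (monomial_ideal U :: 'a mpoly set)"
  have M: "graded_submodule n 1 (\<lambda>_. 0) ?M"
    unfolding U_def by (rule graded_submodule_monomial_ideal)
  have Un: "U \<subseteq> monomials_in n" by (auto simp: U_def ideal_monomials_def)
  have chain: "poly_chain n U q (\<lambda>A. c A 0)" if c: "c \<in> koszul_chains n ?M q" for c q
    unfolding poly_chain_def
  proof (intro conjI allI impI)
    fix A
    show "keys (c A 0) \<subseteq> U"
      using koszul_chains_mem[OF M c, of A] by (simp add: ideal_module_iff monomial_ideal_def)
    assume "c A 0 \<noteq> 0"
    then have "A \<subseteq> {0..n} \<and> card A = q"
      using koszul_chains_0[OF c, of A] by metis
    then show "A \<subseteq> {0..n}" "card A = q" by auto
  qed
  {
    assume ac: "\<forall>m\<in>monomials_in n. mono_deg m = t \<longrightarrow> multi_acyclic TYPE('a) U m p"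
    show "koszul_exact n (\<lambda>_. 0) ?M p t"
      unfolding koszul_exact_def
    proof (intro ballI impI, elim conjE)
      fix c assume c: "c \<in> koszul_chains n ?M p" "chain_part (\<lambda>_. 0) t c = c" "module_diff n c = (\<lambda>_ _. 0)"
      have "\<exists>b. poly_chain n U (Suc p) b \<and> (\<forall>A. koszul_diff {0..n} var b A = c A 0)"
      proof (rule poly_chain_exact[OF Un chain[OF c(1)]])
        show "koszul_diff {0..n} var (\<lambda>A. c A 0) A = 0" for A
          using c(3) by (simp add: module_diff_def fun_eq_iff)
        fix m A assume m: "m \<in> monomials_in n" "A \<subseteq> keys m" "m - mono_of_set A \<in> keys (c A 0)"
        have "m - mono_of_set A \<in> keys (chain_part (\<lambda>_. 0) t c A 0)"
          using m(3) by (simp add: c(2))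
        then have "mono_deg (m - mono_of_set A) + card A = t"
          by (simp add: chain_part_def keys_mpoly_filter)
        moreover have "finite A" using m(2) finite_keys finite_subset by blast
        ultimately have "mono_deg (m - mono_of_set A + mono_of_set A) = t"
          by (simp add: mono_deg_add)
        then show "multi_acyclic TYPE('a) U m p"
          using ac m minus_mono_of_set[OF m(2)] by simp
      qed
      then obtain b0 where b0: "poly_chain n U (Suc p) b0" "\<And>A. koszul_diff {0..n} var b0 A = c A 0" by blast
      define b where "b = (\<lambda>A k::nat. if k = 0 then b0 A else 0)"
      have b: "b \<in> koszul_chains n ?M (Suc p)"
      proof (rule koszul_chainsI)
        fix A
        show "b A \<in> ?M"
          using b0(1) by (simp add: ideal_module_iff b_def monomial_ideal_def poly_chain_def)
      next
        fix A assume "\<not> (A \<subseteq> {0..n} \<and> card A = Suc p)"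
        then show "b A = (\<lambda>_. 0)"
          using b0(1) by (auto simp: b_def poly_chain_def fun_eq_iff)
      qed
      have "module_diff n b = c"
      proof (intro ext)
        fix A and k :: nat
        show "module_diff n b A k = c A k"
        proof (cases "k = 0")
          case True
          then show ?thesis by (simp add: module_diff_def b_def b0)
        next
          case False
          then show ?thesis
            using koszul_chains_mem[OF M c(1), of A]
            by (simp add: module_diff_def b_def koszul_diff_def ideal_module_iff)
        qed
      qed
      then have "module_diff n (chain_part (\<lambda>_. 0) t b) = c"
        using module_diff_chain_part[OF b, of "\<lambda>_. 0" t] c(2) by simp
      then show "\<exists>b\<in>koszul_chains n ?M (Suc p). chain_part (\<lambda>_. 0) t b = b \<and> module_diff n b = c"
        using chain_part_chains[OF M b] chain_part_idem by blast
    qed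
  }
  assume ex: "koszul_exact n (\<lambda>_. 0) ?M p t"
  show "\<forall>m\<in>monomials_in n. mono_deg m = t \<longrightarrow> multi_acyclic TYPE('a) U m p"
  proof (intro ballI impI)
    fix m assume m: "m \<in> monomials_in n" and deg: "mono_deg m = t"
    have mn: "keys m \<subseteq> {0..n}" using m by (simp add: monomials_in_def)
    show "multi_acyclic TYPE('a) U m p"
      unfolding multi_acyclic_def
    proof (intro allI impI, elim conjE)
      fix f :: "nat set \<Rightarrow> 'a"
      assume f: "multi_chain U m p f" and cyc: "\<forall>A. koszul_diff (keys m) (\<lambda>_. 1) f A = 0"
      have fA: "f A \<noteq> 0 \<Longrightarrow> A \<subseteq> keys m \<and> card A = p \<and> m - mono_of_set A \<in> U" for A
        using f by (simp add: multi_chain_def)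
      \<comment> \<open>The strand chain \<open>f\<close> is realised as a polynomial chain
        concentrated in multidegree \<open>m\<close>; its bounding chain is afterwards cut down to
        that multidegree.\<close>
      define c where "c = (\<lambda>A (k::nat). if k = 0 then Poly_Mapping.single (m - mono_of_set A) (f A) else 0)"
      have c: "c \<in> koszul_chains n ?M p"
      proof (rule koszul_chainsI)
        fix A
        show "c A \<in> ?M"
          using fA[of A] by (auto simp: c_def ideal_module_iff monomial_ideal_def)
      next
        fix A assume "\<not> (A \<subseteq> {0..n} \<and> card A = p)"
        then have "f A = 0" using fA[of A] mn by blast
        then show "c A = (\<lambda>_. 0)" by (simp add: c_def fun_eq_iff)
      qed
      have part_c: "multi_part m' (\<lambda>A. c A 0) A = (if m' = m then f A else 0)" for m' A
      proof (cases "f A = 0")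
        case True
        then show ?thesis by (simp add: multi_part_def c_def)
      next
        case False
        then have Am: "A \<subseteq> keys m" using fA by blast
        then show ?thesis
          using minus_mono_of_set[OF Am] minus_mono_of_set[of A m']
          by (auto simp: multi_part_def c_def lookup_single when_def)
      qed
      have ct: "chain_part (\<lambda>_. 0) t c = c"
      proof (intro ext)
        fix A and k :: nat
        show "chain_part (\<lambda>_. 0) t c A k = c A k"
        proof (cases "f A = 0")
          case True
          then show ?thesis by (simp add: chain_part_def c_def)
        next
          case False
          then have Am: "A \<subseteq> keys m" using fA by blast
          then have "finite A" using finite_keys finite_subset by blast
          then have "mono_deg (m - mono_of_set A) + card A = t"
            using minus_mono_of_set[OF Am] deg mono_deg_add[of "m - mono_of_set A" "mono_of_set A"] by simp
          then show ?thesis by (simp add: chain_part_def c_def mpoly_filter_eq_self_iff)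
        qed
      qed
      have "module_diff n c = (\<lambda>_ _. 0)"
      proof (intro ext)
        fix A and k :: nat
        have carr: "c B 0 \<in> carrier (poly_ring n)" for B
          using chain[OF c] Un unfolding poly_chain_def mem_poly_ring_iff monomials_in_def by blast
        show "module_diff n c A k = 0"
        proof (cases "A \<subseteq> {0..n} \<and> k = 0")
          case False
          then show ?thesis
            using module_diff_outside[OF c, of A k] by (auto simp: module_diff_def c_def koszul_diff_def)
        next
          case True
          have "koszul_diff {0..n} var (\<lambda>B. c B 0) A = 0"
          proof (rule koszul_diff_eqI[OF _ carr poly_ring_0])
            show "A \<subseteq> {0..n}" using True by simp
            fix m' :: "nat \<Rightarrow>\<^sub>0 nat"
            show "koszul_diff (keys m') (\<lambda>_. 1) (multi_part m' (\<lambda>B. c B 0)) A = lookup 0 (m' - mono_of_set A)"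
              using cyc by (cases "m' = m") (simp_all add: part_c koszul_diff_def)
          qed
          then show ?thesis using True by (simp add: module_diff_def)
        qed
      qed
      then obtain b where b: "b \<in> koszul_chains n ?M (Suc p)" "module_diff n b = c"
        using ex c ct unfolding koszul_exact_def by blast
      define g where "g = multi_part m (\<lambda>A. b A 0)"
      have "multi_chain U m (Suc p) g"
        unfolding g_def by (rule multi_chain_multi_part[OF chain[OF b(1)]])
      moreover have "koszul_diff (keys m) (\<lambda>_. 1) g A = f A" for A
      proof -
        have "koszul_diff (keys m) (\<lambda>_. 1) g A = multi_part m (\<lambda>A. module_diff n b A 0) A"
          using multi_part_koszul_diff[OF mn, of "\<lambda>A. b A 0" A] by (simp add: g_def module_diff_def)
        then show ?thesis by (simp add: b(2) part_c)
      qed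
      ultimately show "\<exists>g. multi_chain U m (Suc p) g \<and> (\<forall>A. koszul_diff (keys m) (\<lambda>_. 1) g A = f A)"
        by blast
    qed
  qed
qed

text \<open>A variable whose square divides \<open>m\<close> still divides the cofactor after being
  removed once, so the support of the cofactor, which decides membership in the ideal, ignores
  whether \<open>i\<close> is in the index set.\<close>

lemma multi_acyclic_not_squarefree:
  assumes m: "m \<in> monomials_in n" "m \<noteq> mono_of_set (keys m)"
  shows "multi_acyclic TYPE('a::field) (ideal_monomials n D) m p"
proof -
  obtain i where i: "lookup m i \<noteq> lookup (mono_of_set (keys m)) i"
    using m(2) poly_mapping_eqI by metis
  then have 2: "lookup m i \<ge> 2"
    by (auto simp: lookup_mono_of_set in_keys_iff split: if_splits)
  show ?thesis
  proof (rule multi_acyclic_cone)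
    show "i \<in> keys m" using 2 by (simp add: in_keys_iff)
    fix A assume A: "A \<subseteq> keys m" "i \<notin> A"
    have "finite A" using A finite_keys finite_subset by blast
    then have "keys (m - mono_of_set A) = keys (m - mono_of_set (insert i A))"
      using 2 A by (auto simp: in_keys_iff lookup_minus lookup_mono_of_set split: if_splits)
    then show "m - mono_of_set A \<in> ideal_monomials n D \<longleftrightarrow> m - mono_of_set (insert i A) \<in> ideal_monomials n D"
      by (simp add: ideal_monomials_def monomials_in_def)
  qed
qed

text \<open>
  Exactness in degree \<open>q\<close>, counted in vertices, of the cochain complex of the full simplex on
  \<open>W\<close> relative to its subcomplex of faces (sets without a member of \<open>D\<close>). With \<open>W\<close> of size
  \<open>j\<close>, degree \<open>q\<close> belongs to the Betti numbers with \<open>j - i = q\<close>.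
\<close>

definition nonface_exact :: "'a::field itself \<Rightarrow> nat set set \<Rightarrow> nat set \<Rightarrow> nat \<Rightarrow> bool"
  where "nonface_exact _ D W q \<longleftrightarrow>
    (\<forall>f :: nat set \<Rightarrow> 'a. (\<forall>B. f B \<noteq> 0 \<longrightarrow> B \<subseteq> W \<and> card B = q \<and> nonface D B) \<and>
        (\<forall>B\<subseteq>W. cobdry f B = 0) \<longrightarrow>
      (\<exists>g. (\<forall>B. g B \<noteq> 0 \<longrightarrow> B \<subseteq> W \<and> Suc (card B) = q \<and> nonface D B) \<and> (\<forall>B\<subseteq>W. cobdry g B = f B)))"

lemma nonface_exact_trivial:
  assumes "\<And>B. B \<subseteq> W \<Longrightarrow> card B = q \<Longrightarrow> \<not> nonface D B"
  shows "nonface_exact TYPE('a::field) D W q"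
  unfolding nonface_exact_def
proof (intro allI impI, elim conjE)
  fix f :: "nat set \<Rightarrow> 'a"
  assume "\<forall>B. f B \<noteq> 0 \<longrightarrow> B \<subseteq> W \<and> card B = q \<and> nonface D B"
  then have "f B = 0" for B using assms by blast
  then show "\<exists>g. (\<forall>B. g B \<noteq> 0 \<longrightarrow> B \<subseteq> W \<and> Suc (card B) = q \<and> nonface D B) \<and> (\<forall>B\<subseteq>W. cobdry g B = f B)"
    by (intro exI[of _ "\<lambda>_. 0"]) (simp add: cobdry_def)
qed

lemma koszul_diff_compl:
  assumes W: "finite W" "A \<subseteq> W" and f: "\<And>A. A \<subseteq> W \<Longrightarrow> f A = compl_sign W (W - A) * h (W - A)"
  shows "koszul_diff W (\<lambda>_. 1) f A = compl_sign W (W - A) * (cobdry h (W - A) :: 'a::field)"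
proof -
  have "cobdry h (W - A) = cobdry (\<lambda>B. compl_sign W B * f (W - B)) (W - A)"
  proof (rule cobdry_cong)
    fix i
    have "W - (W - (W - A - {i})) = W - A - {i}" by auto
    then show "h (W - A - {i}) = compl_sign W (W - A - {i}) * f (W - (W - A - {i}))"
      by (simp add: f mult.assoc[symmetric])
  qed
  then show ?thesis
    by (simp add: cobdry_compl[OF W] mult.assoc[symmetric])
qed

text \<open>For squarefree \<open>m\<close> the cofactor of \<open>A\<close> is the monomial of
  \<open>W - A\<close>, so taking complements matches Koszul \<open>p\<close>-chains with cochains
  on nonfaces of size \<open>card W - p\<close>. The bound on \<open>p\<close> keeps this
  subtraction genuine.\<close>

lemma multi_acyclic_squarefree_iff:
  assumes W: "W \<subseteq> {0..n}" and p: "p \<le> card W"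
  shows "multi_acyclic TYPE('a::field) (ideal_monomials n D) (mono_of_set W) p
    \<longleftrightarrow> nonface_exact TYPE('a) D W (card W - p)"
proof -
  have finW: "finite W" using W finite_subset by blast
  let ?U = "ideal_monomials n D" and ?m = "mono_of_set W"
  have U: "?m - mono_of_set A \<in> ?U \<longleftrightarrow> nonface D (W - A)" if "A \<subseteq> W" for A
  proof -
    have "finite A" using that finW finite_subset by blast
    then have "keys (?m - mono_of_set A) = W - A"
      using finW by (auto simp: in_keys_iff lookup_minus lookup_mono_of_set split: if_splits)
    then show ?thesis using W by (auto simp: ideal_monomials_def monomials_in_def)
  qed
  have card: "card (W - A) = card W - card A" "card A \<le> card W" if "A \<subseteq> W" for A
    using that finW by (auto simp: card_Diff_subset finite_subset card_mono)
  define dual :: "(nat set \<Rightarrow> 'a) \<Rightarrow> nat set \<Rightarrow> 'a"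
    where "dual h A = (if A \<subseteq> W then compl_sign W (W - A) * h (W - A) else 0)" for h A
  define dual' :: "(nat set \<Rightarrow> 'a) \<Rightarrow> nat set \<Rightarrow> 'a"
    where "dual' f B = (if B \<subseteq> W then compl_sign W B * f (W - B) else 0)" for f B
  have W2: "W - (W - A) = A" if "A \<subseteq> W" for A using that by auto
  have diff_dual: "koszul_diff W (\<lambda>_. 1) (dual h) A = compl_sign W (W - A) * cobdry h (W - A)" if "A \<subseteq> W" for h A
    by (rule koszul_diff_compl[OF finW that]) (simp add: dual_def)
  have diff_dual': "cobdry (dual' f) B = compl_sign W B * koszul_diff W (\<lambda>_. 1) f (W - B)" if "B \<subseteq> W" for f B
  proof -
    have "koszul_diff W (\<lambda>_. 1) f (W - B) = compl_sign W (W - (W - B)) * cobdry (dual' f) (W - (W - B))"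
      by (rule koszul_diff_compl[OF finW]) (auto simp: dual'_def W2 mult.assoc[symmetric])
    then show ?thesis using that by (simp add: W2 mult.assoc[symmetric])
  qed
  have outside: "koszul_diff W (\<lambda>_. 1) f A = 0" if "multi_chain ?U ?m q f" "\<not> A \<subseteq> W" for f :: "nat set \<Rightarrow> 'a" and q A
    using that finW by (intro koszul_diff_eq_0) (auto simp: multi_chain_def)
  show ?thesis
  proof
    assume ac: "multi_acyclic TYPE('a) ?U ?m p"
    show "nonface_exact TYPE('a) D W (card W - p)"
      unfolding nonface_exact_def
    proof (intro allI impI, elim conjE)
      fix h :: "nat set \<Rightarrow> 'a"
      assume h: "\<forall>B. h B \<noteq> 0 \<longrightarrow> B \<subseteq> W \<and> card B = card W - p \<and> nonface D B"
        and cyc: "\<forall>B\<subseteq>W. cobdry h B = 0"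
      have ch: "multi_chain ?U ?m p (dual h)"
        unfolding multi_chain_def
      proof (intro allI impI)
        fix A assume "dual h A \<noteq> 0"
        then have A: "A \<subseteq> W" "h (W - A) \<noteq> 0" by (auto simp: dual_def split: if_splits)
        then have "card (W - A) = card W - p" "nonface D (W - A)" using h by auto
        then show "A \<subseteq> keys ?m \<and> card A = p \<and> ?m - mono_of_set A \<in> ?U"
          using A card[of A] p U[of A] finW by auto
      qed
      moreover have "koszul_diff (keys ?m) (\<lambda>_. 1) (dual h) A = 0" for A
        using outside[OF ch, of A] diff_dual[of A h] cyc finW by (cases "A \<subseteq> W") auto
      ultimately obtain g where g: "multi_chain ?U ?m (Suc p) g" "\<And>A. koszul_diff W (\<lambda>_. 1) g A = dual h A"
        using ac finW unfolding multi_acyclic_def by auto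
      have "\<forall>B. dual' g B \<noteq> 0 \<longrightarrow> B \<subseteq> W \<and> Suc (card B) = card W - p \<and> nonface D B"
      proof (intro allI impI)
        fix B assume "dual' g B \<noteq> 0"
        then have B: "B \<subseteq> W" "g (W - B) \<noteq> 0" by (auto simp: dual'_def split: if_splits)
        then have "card (W - B) = Suc p" "?m - mono_of_set (W - B) \<in> ?U"
          using g(1) by (auto simp: multi_chain_def)
        then show "B \<subseteq> W \<and> Suc (card B) = card W - p \<and> nonface D B"
          using B card[of B] U[of "W - B"] W2[of B] by auto
      qed
      moreover have "\<forall>B\<subseteq>W. cobdry (dual' g) B = h B"
        using W2 by (auto simp: diff_dual' g(2) dual_def mult.assoc[symmetric])
      ultimately show "\<exists>g. (\<forall>B. g B \<noteq> 0 \<longrightarrow> B \<subseteq> W \<and> Suc (card B) = card W - p \<and> nonface D B) \<and> (\<forall>B\<subseteq>W. cobdry g B = h B)"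
        by blast
    qed
  next
    assume ex: "nonface_exact TYPE('a) D W (card W - p)"
    show "multi_acyclic TYPE('a) ?U ?m p"
      unfolding multi_acyclic_def
    proof (intro allI impI, elim conjE)
      fix f :: "nat set \<Rightarrow> 'a"
      assume f: "multi_chain ?U ?m p f" and "\<forall>A. koszul_diff (keys ?m) (\<lambda>_. 1) f A = 0"
      then have cyc: "koszul_diff W (\<lambda>_. 1) f A = 0" for A using finW by simp
      have "\<forall>B. dual' f B \<noteq> 0 \<longrightarrow> B \<subseteq> W \<and> card B = card W - p \<and> nonface D B"
      proof (intro allI impI)
        fix B assume "dual' f B \<noteq> 0"
        then have B: "B \<subseteq> W" "f (W - B) \<noteq> 0" by (auto simp: dual'_def split: if_splits)
        then have "card (W - B) = p" "?m - mono_of_set (W - B) \<in> ?U"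
          using f by (auto simp: multi_chain_def)
        then show "B \<subseteq> W \<and> card B = card W - p \<and> nonface D B"
          using B card[of B] U[of "W - B"] W2[of B] by auto
      qed
      moreover have "\<forall>B\<subseteq>W. cobdry (dual' f) B = 0"
        by (simp add: diff_dual' cyc)
      ultimately have "\<exists>h. (\<forall>B. h B \<noteq> 0 \<longrightarrow> B \<subseteq> W \<and> Suc (card B) = card W - p \<and> nonface D B) \<and>
          (\<forall>B\<subseteq>W. cobdry h B = dual' f B)"
        using ex unfolding nonface_exact_def by (elim allE[of _ "dual' f"] impE) (rule conjI)
      then obtain h where h: "\<And>B. h B \<noteq> 0 \<Longrightarrow> B \<subseteq> W \<and> Suc (card B) = card W - p \<and> nonface D B"
        "\<And>B. B \<subseteq> W \<Longrightarrow> cobdry h B = dual' f B"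
        by (elim exE conjE) blast
      have ch: "multi_chain ?U ?m (Suc p) (dual h)"
        unfolding multi_chain_def
      proof (intro allI impI)
        fix A assume "dual h A \<noteq> 0"
        then have A: "A \<subseteq> W" "h (W - A) \<noteq> 0" by (auto simp: dual_def split: if_splits)
        then have "Suc (card (W - A)) = card W - p" "nonface D (W - A)" using h(1)[of "W - A"] by auto
        then show "A \<subseteq> keys ?m \<and> card A = Suc p \<and> ?m - mono_of_set A \<in> ?U"
          using A card[of A] p U[of A] finW by auto
      qed
      moreover have "koszul_diff (keys ?m) (\<lambda>_. 1) (dual h) A = f A" for A
      proof (cases "A \<subseteq> W")
        case True
        then show ?thesis
          using finW W2 by (simp add: diff_dual h(2) dual'_def mult.assoc[symmetric])
      next
        case False
        then have "f A = 0" using f finW by (auto simp: multi_chain_def)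
        then show ?thesis using outside[OF ch False] finW by simp
      qed
      ultimately show "\<exists>g. multi_chain ?U ?m (Suc p) g \<and> (\<forall>A. koszul_diff (keys ?m) (\<lambda>_. 1) g A = f A)"
        by blast
    qed
  qed
qed

text \<open>Adding or removing \<open>w\<close> never changes whether a subset of \<open>W\<close>
  is a nonface, so \<open>w\<close> contracts the corresponding squarefree Koszul strand.\<close>

lemma nonface_exact_cone:
  assumes W: "finite W" "w \<in> W"
    and cone: "\<And>B. B \<subseteq> W \<Longrightarrow> w \<notin> B \<Longrightarrow> nonface D (insert w B) \<Longrightarrow> nonface D B"
  shows "nonface_exact TYPE('a::field) D W q"
proof (cases "q \<le> card W")
  case False
  then show ?thesis
    using card_mono[OF W(1)] by (intro nonface_exact_trivial) auto
next
  case True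
  \<comment> \<open>An auxiliary number of variables, large enough to contain \<open>W\<close>; the
    claim itself mentions no ring.\<close>
  define n where "n = Max W"
  have Wn: "W \<subseteq> {0..n}" using W by (auto simp: n_def)
  have "multi_acyclic TYPE('a) (ideal_monomials n D) (mono_of_set W) (card W - q)"
  proof (rule multi_acyclic_cone)
    show "w \<in> keys (mono_of_set W)" using W by simp
    fix A assume A: "A \<subseteq> keys (mono_of_set W)" "w \<notin> A"
    then have "finite A" using finite_keys finite_subset by blast
    then have "keys (mono_of_set W - mono_of_set A) = W - A"
      "keys (mono_of_set W - mono_of_set (insert w A)) = W - A - {w}"
      using W by (auto simp: in_keys_iff lookup_minus lookup_mono_of_set split: if_splits)
    moreover have "nonface D (W - A) \<longleftrightarrow> nonface D (W - A - {w})"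
    proof
      have "insert w (W - A - {w}) = W - A" using A W by auto
      then show "nonface D (W - A) \<Longrightarrow> nonface D (W - A - {w})"
        using cone[of "W - A - {w}"] by auto
    qed (auto simp: nonface_def)
    ultimately show "mono_of_set W - mono_of_set A \<in> ideal_monomials n D \<longleftrightarrow>
        mono_of_set W - mono_of_set (insert w A) \<in> ideal_monomials n D"
      using Wn by (auto simp: ideal_monomials_def monomials_in_def)
  qed
  then show ?thesis
    using multi_acyclic_squarefree_iff[OF Wn, of "card W - q" D, where 'a='a] True by simp
qed

text \<open>A nonzero Betti number in homological degree \<open>i\<close> comes from a squarefree
  multidegree \<open>W\<close> with \<open>j = card W\<close>, so \<open>j - i\<close> is the
  cochain degree \<open>q = card W - i\<close>. The facts \<open>le\<close> and \<open>le'\<close>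
  confine both sides to the range where these subtractions are not truncated.\<close>

theorem cm_regularity_circuit_ideal:
  assumes D: "\<And>F. F \<in> D \<Longrightarrow> F \<subseteq> {0..n}"
  shows "cm_regularity n (circuit_ideal n D :: 'a::field mpoly set)
    = Sup {ereal (real q) | q. \<exists>W\<subseteq>{0..n}. \<not> nonface_exact TYPE('a) D W q}"
proof -
  let ?U = "ideal_monomials n D"
  let ?I = "monomial_ideal ?U :: 'a mpoly set"
  have I: "circuit_ideal n D = ?I" by (rule circuit_ideal_eq[OF D])
  have sqf: "m = mono_of_set (keys m)"
    if "m \<in> monomials_in n" "\<not> multi_acyclic TYPE('a) ?U m p" for m p
    using multi_acyclic_not_squarefree[OF that(1)] that(2) by blast
  \<comment> \<open>Squarefree monomials in the variables x_0, ..., x_n have degree at most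
    \<open>n + 1\<close>; this is the degree bound that secures a minimal resolution.\<close>
  have bound: "koszul_exact n (\<lambda>_. 0) (ideal_module ?I) p t" if "t > Suc n" for p t
    unfolding koszul_exact_monomial_ideal_iff
  proof (intro ballI impI, rule ccontr)
    fix m assume m: "m \<in> monomials_in n" "mono_deg m = t" "\<not> multi_acyclic TYPE('a) ?U m p"
    have "mono_deg m = card (keys m)"
      using arg_cong[OF sqf[OF m(1,3)], of mono_deg] by simp
    also have "\<dots> \<le> card {0..n}"
      using m(1) by (intro card_mono) (auto simp: monomials_in_def)
    finally show False using m(2) that by simp
  qed
  have betti: "graded_betti n ?I i j \<noteq> 0 \<longleftrightarrow>
      (\<exists>W\<subseteq>{0..n}. card W = j \<and> \<not> multi_acyclic TYPE('a) ?U (mono_of_set W) i)" for i j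
  proof -
    have "graded_betti n ?I i j \<noteq> 0 \<longleftrightarrow> \<not> koszul_exact n (\<lambda>_. 0) (ideal_module ?I) i j"
      by (rule graded_betti_neq_0_iff[OF graded_submodule_monomial_ideal bound])
    also have "\<dots> \<longleftrightarrow> (\<exists>m\<in>monomials_in n. mono_deg m = j \<and> \<not> multi_acyclic TYPE('a) ?U m i)"
      by (auto simp: koszul_exact_monomial_ideal_iff)
    also have "\<dots> \<longleftrightarrow> (\<exists>W\<subseteq>{0..n}. card W = j \<and> \<not> multi_acyclic TYPE('a) ?U (mono_of_set W) i)"
    proof
      assume "\<exists>m\<in>monomials_in n. mono_deg m = j \<and> \<not> multi_acyclic TYPE('a) ?U m i"
      then obtain m where m: "m \<in> monomials_in n" "mono_deg m = j" "\<not> multi_acyclic TYPE('a) ?U m i" by blast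
      have eq: "mono_of_set (keys m) = m" using sqf[OF m(1,3)] by simp
      moreover have "card (keys m) = j"
        using m(2) mono_deg_mono_of_set[OF finite_keys[of m]] eq by simp
      ultimately show "\<exists>W\<subseteq>{0..n}. card W = j \<and> \<not> multi_acyclic TYPE('a) ?U (mono_of_set W) i"
        using m by (intro exI[of _ "keys m"]) (simp add: monomials_in_def)
    next
      assume "\<exists>W\<subseteq>{0..n}. card W = j \<and> \<not> multi_acyclic TYPE('a) ?U (mono_of_set W) i"
      then obtain W where W: "W \<subseteq> {0..n}" "card W = j" "\<not> multi_acyclic TYPE('a) ?U (mono_of_set W) i" by blast
      have "finite W" using W(1) finite_subset by blast
      then show "\<exists>m\<in>monomials_in n. mono_deg m = j \<and> \<not> multi_acyclic TYPE('a) ?U m i"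
        using W by (intro bexI[of _ "mono_of_set W"]) (simp_all add: monomials_in_def)
    qed
    finally show ?thesis .
  qed
  have le: "i \<le> card W" if "W \<subseteq> {0..n}" "\<not> multi_acyclic TYPE('a) ?U (mono_of_set W) i" for W i
  proof (rule ccontr)
    have finW: "finite W" using that(1) finite_subset by blast
    assume "\<not> i \<le> card W"
    then have "f = (\<lambda>_. 0)" if "multi_chain ?U (mono_of_set W) i f" for f :: "nat set \<Rightarrow> 'a"
      using that finW card_mono[OF finW] by (fastforce simp: multi_chain_def fun_eq_iff)
    then have "multi_acyclic TYPE('a) ?U (mono_of_set W) i"
      unfolding multi_acyclic_def
      by (intro allI impI exI[of _ "\<lambda>_. 0"]) (auto simp: multi_chain_def koszul_diff_def)
    then show False using that(2) by contradiction
  qed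
  have le': "q \<le> card W" if "W \<subseteq> {0..n}" "\<not> nonface_exact TYPE('a) D W q" for W q
  proof (rule ccontr)
    have finW: "finite W" using that(1) finite_subset by blast
    assume "\<not> q \<le> card W"
    then have "nonface_exact TYPE('a) D W q"
      using card_mono[OF finW] by (intro nonface_exact_trivial) auto
    then show False using that(2) by contradiction
  qed
  have "{ereal (real j - real i) | i j. graded_betti n ?I i j \<noteq> 0}
      = {ereal (real q) | q. \<exists>W\<subseteq>{0..n}. \<not> nonface_exact TYPE('a) D W q}"
  proof (intro equalityI subsetI)
    fix x assume "x \<in> {ereal (real j - real i) | i j. graded_betti n ?I i j \<noteq> 0}"
    then obtain i j where ij: "x = ereal (real j - real i)" "graded_betti n ?I i j \<noteq> 0" by blast
    then obtain W where "W \<subseteq> {0..n}" "card W = j" "\<not> multi_acyclic TYPE('a) ?U (mono_of_set W) i"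
      using betti by blast
    with ij(1) have W: "x = ereal (real (card W) - real i)" "W \<subseteq> {0..n}"
      "\<not> multi_acyclic TYPE('a) ?U (mono_of_set W) i"
      by simp_all
    have i: "i \<le> card W" by (rule le[OF W(2,3)])
    then have "\<not> nonface_exact TYPE('a) D W (card W - i)"
      using multi_acyclic_squarefree_iff[OF W(2)] W(3) by blast
    moreover have "x = ereal (real (card W - i))" using i W(1) by (simp add: of_nat_diff)
    ultimately show "x \<in> {ereal (real q) | q. \<exists>W\<subseteq>{0..n}. \<not> nonface_exact TYPE('a) D W q}"
      using W(2) by blast
  next
    fix x assume "x \<in> {ereal (real q) | q. \<exists>W\<subseteq>{0..n}. \<not> nonface_exact TYPE('a) D W q}"
    then obtain q W where W: "x = ereal (real q)" "W \<subseteq> {0..n}" "\<not> nonface_exact TYPE('a) D W q" by blast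
    have q: "q \<le> card W" by (rule le'[OF W(2,3)])
    then have "\<not> multi_acyclic TYPE('a) ?U (mono_of_set W) (card W - q)"
      using multi_acyclic_squarefree_iff[OF W(2), of "card W - q" D, where 'a='a] W(3) by simp
    then have "graded_betti n ?I (card W - q) (card W) \<noteq> 0"
      using betti W(2) by blast
    moreover have "x = ereal (real (card W) - real (card W - q))" using q W(1) by (simp add: of_nat_diff)
    ultimately show "x \<in> {ereal (real j - real i) | i j. graded_betti n ?I i j \<noteq> 0}" by blast
  qed
  then show ?thesis by (simp add: cm_regularity_def I)
qed

subsection \<open>Subdividing a triangle\<close>

lemma koszul_sign_empty [simp]: "koszul_sign i {} = 1"
  by (simp add: koszul_sign_def)

lemma cobdry_triple: "i < j \<Longrightarrow> j < l \<Longrightarrow> cobdry f {i, j, l} = f {j, l} - f {i, l} + f {i, j}"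
  by (simp add: cobdry_def koszul_sign_insert insert_Diff_if)

lemma cobdry_0123: "cobdry f {0, 1, 2, 3::nat} = f {1, 2, 3} - f {0, 2, 3} + f {0, 1, 3} - f {0, 1, 2}"
  by (simp add: cobdry_def koszul_sign_insert insert_Diff_if)

lemma koszul_sign_0 [simp]: "koszul_sign 0 B = 1"
  by (simp add: koszul_sign_def)

text \<open>As the least vertex, \<open>0\<close> is removed with sign 1 and reverses the sign of
  every other removal.\<close>

lemma cobdry_insert_0:
  assumes "finite A" "0 \<notin> A"
  shows "cobdry f (insert 0 A) = f A - cobdry (\<lambda>B. f (insert 0 B)) A"
proof -
  have "cobdry f (insert 0 A) = f A + (\<Sum>i\<in>A. koszul_sign i (insert 0 A) * f (insert 0 A - {i}))"
    using assms by (simp add: cobdry_def)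
  also have "(\<Sum>i\<in>A. koszul_sign i (insert 0 A) * f (insert 0 A - {i})) = (\<Sum>i\<in>A. - (koszul_sign i A * f (insert 0 (A - {i}))))"
  proof (intro sum.cong refl)
    fix i assume "i \<in> A"
    then have "0 < i" using assms(2) by (cases i) auto
    moreover from this have "insert 0 A - {i} = insert 0 (A - {i})" by auto
    ultimately show "koszul_sign i (insert 0 A) * f (insert 0 A - {i}) = - (koszul_sign i A * f (insert 0 (A - {i})))"
      using assms by (simp add: koszul_sign_insert)
  qed
  finally show ?thesis by (simp add: cobdry_def sum_negf)
qed

text \<open>Contraction with the vertex \<open>0\<close> yields a primitive of a cocycle on a
  simplex containing \<open>0\<close>.\<close>

lemma cobdry_cone_0:
  assumes B: "finite B" and cyc: "cobdry f (insert 0 B) = 0"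
  shows "cobdry (\<lambda>B. if 0 \<in> B then 0 else f (insert 0 B)) B = f B"
proof (cases "0 \<in> B")
  case True
  have "cobdry (\<lambda>B. if 0 \<in> B then 0 else f (insert 0 B)) B
      = (\<Sum>i\<in>{0}. koszul_sign i B * (if 0 \<in> B - {i} then 0 else f (insert 0 (B - {i}))))"
    unfolding cobdry_def using B True by (intro sum.mono_neutral_right) auto
  also have "\<dots> = f B" using True by (simp add: insert_absorb)
  finally show ?thesis .
next
  case False
  have "cobdry (\<lambda>B. if 0 \<in> B then 0 else f (insert 0 B)) B = cobdry (\<lambda>B. f (insert 0 B)) B"
    using False by (intro cobdry_cong) auto
  then show ?thesis
    using cyc cobdry_insert_0[OF B False, of f] by simp
qed

lemma cobdry_neq_0:
  "cobdry f B \<noteq> 0 \<Longrightarrow> \<exists>i\<in>B. f (B - {i}) \<noteq> 0"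
  unfolding cobdry_def by (rule ccontr) simp

lemma nonface_card_ge:
  assumes "\<And>F. F \<in> E \<Longrightarrow> card F = k" "finite B" "nonface E B"
  shows "k \<le> card B"
proof -
  obtain F where "F \<in> E" "F \<subseteq> B" using assms(3) by (auto simp: nonface_def)
  then show ?thesis using card_mono[OF assms(2), of F] assms(1)[of F] by simp
qed

lemma nonface_card_eq:
  assumes card: "\<And>F. F \<in> E \<Longrightarrow> card F = 3" and B: "card B = 3"
  shows "nonface E B \<longleftrightarrow> B \<in> E"
proof
  have fin: "finite B" by (rule card_ge_0_finite) (simp add: B)
  assume "nonface E B"
  then obtain F where F: "F \<in> E" "F \<subseteq> B" by (auto simp: nonface_def)
  then have "F = B" by (intro card_subset_eq[OF fin]) (simp_all add: card B)
  then show "B \<in> E" using F by simp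
qed (auto simp: nonface_def)

lemma nonface_exactD:
  fixes f :: "nat set \<Rightarrow> 'a::field"
  assumes "nonface_exact TYPE('a) D W q"
    and "\<And>B. f B \<noteq> 0 \<Longrightarrow> B \<subseteq> W \<and> card B = q \<and> nonface D B"
    and "\<And>B. B \<subseteq> W \<Longrightarrow> cobdry f B = 0"
  shows "\<exists>g. (\<forall>B. g B \<noteq> 0 \<longrightarrow> B \<subseteq> W \<and> Suc (card B) = q \<and> nonface D B) \<and> (\<forall>B\<subseteq>W. cobdry g B = f B)"
  using assms unfolding nonface_exact_def by simp

text \<open>With \<open>{{}}\<close> as the set of circuits every set is a nonface, so this is the
  whole augmented simplex, a cone over any of its vertices.\<close>

lemma simplex_exact:
  fixes f :: "nat set \<Rightarrow> 'a::field"
  assumes W: "finite W" "W \<noteq> {}"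
    and f: "\<And>B. f B \<noteq> 0 \<Longrightarrow> B \<subseteq> W \<and> card B = q" "\<And>B. B \<subseteq> W \<Longrightarrow> cobdry f B = 0"
  shows "\<exists>g. (\<forall>B. g B \<noteq> 0 \<longrightarrow> B \<subseteq> W \<and> Suc (card B) = q) \<and> (\<forall>B\<subseteq>W. cobdry g B = f B)"
proof -
  obtain w where "w \<in> W" using W(2) by blast
  then have "nonface_exact TYPE('a) {{}} W q"
    by (intro nonface_exact_cone[OF W(1)]) (auto simp: nonface_def)
  then show ?thesis
    using f unfolding nonface_exact_def by (elim allE[of _ f]) (auto simp: nonface_def)
qed

section \<open>The two clutters, their nonfaces, and the transfer of exactness\<close>

context
  fixes n :: nat and C :: "nat set set"
  assumes C: "C \<subseteq> three_subsets {1..n}" and triangle_in_C: "{1, 2, 3} \<in> C"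
    and facet: "\<And>r. 3 < r \<Longrightarrow> r \<le> n \<Longrightarrow> \<not> {{1, 2, r}, {1, 3, r}, {2, 3, r}} \<subseteq> C"
begin

abbreviation (input) "triangle123 \<equiv> {1, 2, 3::nat}"

definition "subdivided = (C - {triangle123}) \<union> {{0, 1, 2}, {0, 1, 3}, {0, 2, 3}}"
definition "missing = clutter_complement {1..n} C"
definition "missing' = clutter_complement {0..n} subdivided"

lemma n_ge_3: "3 \<le> n"
  using C triangle_in_C by (auto simp: three_subsets_def)

lemma missing_iff: "F \<in> missing \<longleftrightarrow> F \<subseteq> {1..n} \<and> card F = 3 \<and> F \<notin> C"
  by (auto simp: missing_def clutter_complement_def three_subsets_def)

lemma missing'_iff: "F \<in> missing' \<longleftrightarrow> F \<subseteq> {0..n} \<and> card F = 3 \<and> F \<notin> subdivided"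
  by (auto simp: missing'_def clutter_complement_def three_subsets_def)

lemma not_in_C: "0 \<in> F \<Longrightarrow> F \<notin> C"
  using C by (fastforce simp: three_subsets_def)

lemma subdivided_0: "F \<in> subdivided \<Longrightarrow> 0 \<in> F \<Longrightarrow> F \<subseteq> {0, 1, 2, 3}"
  by (auto simp: subdivided_def dest: not_in_C)

lemma triangle_in_missing': "triangle123 \<in> missing'"
  using n_ge_3 by (auto simp: missing'_iff subdivided_def)

lemma nonface_card: "finite B \<Longrightarrow> nonface missing B \<Longrightarrow> 3 \<le> card B"
  by (rule nonface_card_ge) (simp_all add: missing_iff)

lemma nonface'_card: "finite B \<Longrightarrow> nonface missing' B \<Longrightarrow> 3 \<le> card B"
  by (rule nonface_card_ge) (simp_all add: missing'_iff)

lemma nonface_card_3: "card B = 3 \<Longrightarrow> nonface missing B \<longleftrightarrow> B \<in> missing"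
  by (rule nonface_card_eq) (simp_all add: missing_iff)

lemma nonface'_card_3: "card B = 3 \<Longrightarrow> nonface missing' B \<longleftrightarrow> B \<in> missing'"
  by (rule nonface_card_eq) (simp_all add: missing'_iff)

text \<open>The circuits in \<open>missing\<close> avoid \<open>0\<close>, which makes
  \<open>0\<close> a cone apex for the original complex.\<close>

lemma nonface_remove_0: "nonface missing (insert 0 B) \<Longrightarrow> nonface missing B"
proof -
  assume "nonface missing (insert 0 B)"
  then obtain F where F: "F \<in> missing" "F \<subseteq> insert 0 B" by (auto simp: nonface_def)
  then have "0 \<notin> F" using missing_iff[of F] by auto
  then show ?thesis using F unfolding nonface_def by blast
qed

lemma nonface'_iff:
  assumes "B \<subseteq> {1..n}"
  shows "nonface missing' B \<longleftrightarrow> nonface missing B \<or> triangle123 \<subseteq> B"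
proof -
  have "F \<in> missing' \<longleftrightarrow> F \<in> missing \<or> F = triangle123" if "F \<subseteq> B" for F
  proof -
    have F: "F \<subseteq> {1..n}" "F \<subseteq> {0..n}" using that assms by auto
    then have "0 \<notin> F" by auto
    then have "F \<in> subdivided \<longleftrightarrow> F \<in> C \<and> F \<noteq> triangle123" by (auto simp: subdivided_def)
    then show ?thesis
      using F triangle_in_missing' missing_iff[of F] missing'_iff[of F] by (cases "F = triangle123") simp_all
  qed
  then show ?thesis unfolding nonface_def by blast
qed

text \<open>The hypothesis \<open>facet\<close> enters here: a further vertex \<open>r\<close> of
  \<open>B\<close> exceeds 3, and one of the three sets formed by \<open>r\<close> and two vertices
  of the triangle is missing.\<close>

lemma nonface_superset_triangle:
  assumes "B \<subseteq> {1..n}" "triangle123 \<subseteq> B" "card B \<noteq> 3"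
  shows "nonface missing B"
proof -
  have "B \<noteq> triangle123" using assms(3) by auto
  then obtain r where r: "r \<in> B" "r \<notin> triangle123" using assms(2) by blast
  have "1 \<le> r" "r \<le> n" using assms(1) r(1) by auto
  moreover have "r \<noteq> 1" "r \<noteq> 2" "r \<noteq> 3" using r(2) by auto
  ultimately have r3: "3 < r" "r \<le> n" by linarith+
  then obtain F where F: "F \<in> {{1, 2, r}, {1, 3, r}, {2, 3, r}}" "F \<notin> C"
    using facet by blast
  then have "F \<in> missing" "F \<subseteq> B"
    using r3 r(1) assms(1,2) by (auto simp: missing_iff)
  then show ?thesis by (auto simp: nonface_def)
qed

lemma nonface'_eq:
  assumes "B \<subseteq> {1..n}" "4 \<le> card B"
  shows "nonface missing' B \<longleftrightarrow> nonface missing B"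
  using nonface'_iff[OF assms(1)] nonface_superset_triangle[OF assms(1)] assms(2) by auto

lemma nonface'_imp:
  assumes "B \<subseteq> {1..n}" "nonface missing' B" "B \<noteq> triangle123"
  shows "nonface missing B"
proof -
  have fin: "finite B" using assms(1) finite_subset by blast
  have "card B \<noteq> 3" if "triangle123 \<subseteq> B"
    using that assms(3) card_subset_eq[OF fin that] by auto
  then show ?thesis
    using nonface'_iff[OF assms(1)] nonface_superset_triangle[OF assms(1)] assms(2) by blast
qed

text \<open>Either \<open>B\<close> is the tetrahedron \<open>{0, 1, 2, 3}\<close> and contains the
  deleted triangle, or it has a vertex \<open>r\<close> beyond 3, and no circuit contains both
  \<open>0\<close> and \<open>r\<close>.\<close>

lemma nonface'_0:
  assumes B: "B \<subseteq> {0..n}" "0 \<in> B" "4 \<le> card B"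
  shows "nonface missing' B"
proof (cases "B \<subseteq> {0, 1, 2, 3}")
  case True
  then have "B = {0, 1, 2, 3}"
    using B(3) by (intro card_seteq) auto
  then have "triangle123 \<subseteq> B" by auto
  then show ?thesis using triangle_in_missing' unfolding nonface_def by blast
next
  case False
  then obtain r where r: "r \<in> B" "r \<notin> {0, 1, 2, 3}" by blast
  have "\<not> B \<subseteq> {0, r}"
  proof
    assume "B \<subseteq> {0, r}"
    then have "card B \<le> card {0, r}" by (intro card_mono) auto
    also have "\<dots> \<le> 2" by (simp add: card_insert_if)
    finally show False using B(3) by simp
  qed
  then obtain s where s: "s \<in> B" "s \<noteq> 0" "s \<noteq> r" by blast
  have "{0, r, s} \<notin> subdivided"
  proof
    assume "{0, r, s} \<in> subdivided"
    then have "{0, r, s} \<subseteq> {0, 1, 2, 3}"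
      by (rule subdivided_0) simp
    then show False using r(2) by simp
  qed
  then have "{0, r, s} \<in> missing'"
    using r s B by (auto simp: missing'_iff)
  moreover have "{0, r, s} \<subseteq> B" using r s B by simp
  ultimately show ?thesis unfolding nonface_def by (rule bexI[rotated])
qed

lemma not_nonface'_0:
  assumes B: "B \<subseteq> {0..n}" "0 \<in> B" "card B = 3" "\<not> nonface missing' B"
  shows "B \<in> {{0, 1, 2}, {0, 1, 3}, {0, 2, 3}}"
proof -
  have "B \<in> subdivided"
    using B missing'_iff[of B] nonface'_card_3[OF B(3)] by blast
  then show ?thesis
    unfolding subdivided_def by (elim UnE DiffE) (use not_in_C[OF B(2)] in blast)+
qed

lemma faces'_0: "\<not> nonface missing' {0, 1, 2}" "\<not> nonface missing' {0, 1, 3}" "\<not> nonface missing' {0, 2, 3}"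
  by (simp_all add: nonface'_card_3 missing'_iff subdivided_def)

text \<open>For \<open>W' = insert 0 W\<close>, contraction with \<open>0\<close> gives a primitive
  \<open>h\<close> of \<open>f\<close> on the full simplex, without control of its support. After a
  correction at \<open>{1, 2, 3}\<close>, it differs on \<open>W\<close> from a primitive
  \<open>g\<close> over \<open>missing\<close> by the coboundary of some \<open>k\<close>.
  Subtracting from \<open>h\<close> the coboundary of an extension \<open>k1\<close> of
  \<open>k\<close> repairs the support. On the edges from \<open>0\<close> to \<open>2\<close> and
  \<open>3\<close>, \<open>k1\<close> is the pullback of \<open>k\<close> under moving
  \<open>0\<close> to \<open>1\<close>, or to \<open>2\<close> if \<open>1\<close> is not in
  \<open>W\<close>.\<close>

lemma subdivision_exact:
  assumes q: "4 \<le> q" and ex: "\<And>W. W \<subseteq> {1..n} \<Longrightarrow> nonface_exact TYPE('a::field) missing W q"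
    and W': "W' \<subseteq> {0..n}"
  shows "nonface_exact TYPE('a) missing' W' q"
  unfolding nonface_exact_def
proof (intro allI impI, elim conjE)
  fix f :: "nat set \<Rightarrow> 'a"
  assume "\<forall>B. f B \<noteq> 0 \<longrightarrow> B \<subseteq> W' \<and> card B = q \<and> nonface missing' B" "\<forall>B\<subseteq>W'. cobdry f B = 0"
  then have f: "f B \<noteq> 0 \<Longrightarrow> B \<subseteq> W' \<and> card B = q \<and> nonface missing' B"
    and cyc: "B \<subseteq> W' \<Longrightarrow> cobdry f B = 0" for B
    by blast+
  define W where "W = W' - {0}"
  have W: "W \<subseteq> {1..n}" using W' by (force simp: W_def)
  have finW: "finite W" using W finite_subset by blast
  have finW': "finite W'" using W' finite_subset by blast
  have 0: "0 \<notin> W" "W \<subseteq> W'" by (auto simp: W_def)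
  have NN': "nonface missing B \<Longrightarrow> B \<subseteq> W \<Longrightarrow> nonface missing' B" for B
    using nonface'_iff[of B] W by blast
  have N'N: "nonface missing' B \<Longrightarrow> B \<subseteq> W \<Longrightarrow> card B = q \<Longrightarrow> nonface missing B" for B
    using nonface'_eq[of B] W q by auto
  show "\<exists>g. (\<forall>B. g B \<noteq> 0 \<longrightarrow> B \<subseteq> W' \<and> Suc (card B) = q \<and> nonface missing' B) \<and> (\<forall>B\<subseteq>W'. cobdry g B = f B)"
  proof (cases "0 \<in> W' \<and> W \<noteq> {}")
    case False
    have "W' = W \<or> W' = {0}" using False by (auto simp: W_def)
    then show ?thesis
    proof
      \<comment> \<open>Without the vertex \<open>0\<close> the nonfaces of size \<open>q\<close>
        agree, and those of size \<open>q - 1\<close> over \<open>missing\<close> remain nonfaces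
        over \<open>missing'\<close>.\<close>
      assume eq: "W' = W"
      have fN: "f B \<noteq> 0 \<Longrightarrow> B \<subseteq> W \<and> card B = q \<and> nonface missing B" for B
        using f[of B] N'N[of B] eq by blast
      obtain g where g: "\<And>B. g B \<noteq> 0 \<Longrightarrow> B \<subseteq> W \<and> Suc (card B) = q \<and> nonface missing B"
        "\<And>B. B \<subseteq> W \<Longrightarrow> cobdry g B = f B"
        using nonface_exactD[OF ex[OF W] fN cyc[unfolded eq]] by blast
      then show ?thesis using NN' unfolding eq by (intro exI[of _ g] conjI) auto
    next
      assume eq: "W' = {0}"
      have "f B = 0" for B
      proof (rule ccontr)
        assume "f B \<noteq> 0"
        then have "card B \<le> card {0::nat}" "card B = q"
          using f[of B] eq by (auto intro: card_mono simp del: card.insert)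
        then show False using q by simp
      qed
      then show ?thesis by (intro exI[of _ "\<lambda>_. 0"]) (simp add: cobdry_def)
    qed
  next
    case True
    then have W'_eq: "W' = insert 0 W" by (auto simp: W_def)
    define h where "h B = (if 0 \<in> B then 0 else f (insert 0 B))" for B
    have h: "B \<subseteq> W \<and> Suc (card B) = q" if "h B \<noteq> 0" for B
    proof -
      have "0 \<notin> B" "f (insert 0 B) \<noteq> 0" using that by (auto simp: h_def split: if_splits)
      moreover from this f[of "insert 0 B"] have "B \<subseteq> W" "card (insert 0 B) = q" by (auto simp: W_def)
      moreover from this finW have "finite B" using finite_subset by blast
      ultimately show ?thesis by simp
    qed
    have dh: "cobdry h B = f B" if "B \<subseteq> W'" for B
    proof -
      have "finite B" "insert 0 B \<subseteq> W'" using that finW' finite_subset W'_eq by auto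
      then show ?thesis
        using cobdry_cone_0[of B f] cyc[of "insert 0 B"] unfolding h_def by blast
    qed
    \<comment> \<open>\<open>h\<close> may be nonzero on the triangle, which is a face of the original complex only; \<open>c\<close> is the
      correction that makes \<open>f\<close> a relative cocycle there.\<close>
    define c where "c = h triangle123"
    have c: "triangle123 \<subseteq> W \<and> q = 4" if "c \<noteq> 0"
      using h[of triangle123] that by (simp add: c_def)
    define t where "t B = (if B = triangle123 then 1 else 0 :: 'a)" for B
    have dt: "card B = 4 \<and> triangle123 \<subseteq> B" if "cobdry t B \<noteq> 0" for B
    proof -
      obtain i where i: "i \<in> B" "t (B - {i}) \<noteq> 0" using cobdry_neq_0[OF \<open>cobdry t B \<noteq> 0\<close>] by blast
      then have "B - {i} = triangle123" by (auto simp: t_def split: if_splits)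
      then have "B = insert i triangle123" "i \<notin> triangle123" using i by auto
      then show ?thesis by auto
    qed
    define f1 where "f1 B = (if B \<subseteq> W then f B - c * cobdry t B else 0)" for B
    have f1: "B \<subseteq> W \<and> card B = q \<and> nonface missing B" if "f1 B \<noteq> 0" for B
    proof -
      have B: "B \<subseteq> W" using that by (auto simp: f1_def split: if_splits)
      have "f B \<noteq> 0 \<or> (c \<noteq> 0 \<and> cobdry t B \<noteq> 0)"
        using that B by (auto simp: f1_def)
      then show ?thesis
      proof
        assume "f B \<noteq> 0"
        then show ?thesis using f[of B] N'N[of B] B by blast
      next
        assume "c \<noteq> 0 \<and> cobdry t B \<noteq> 0"
        then have "card B = q" "card B = 4" "triangle123 \<subseteq> B" using dt[of B] c by auto
        then show ?thesis using nonface_superset_triangle[of B] B W by auto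
      qed
    qed
    have df1: "cobdry f1 B = 0" if "B \<subseteq> W" for B
    proof -
      have "cobdry f1 B = cobdry (\<lambda>B. f B - c * cobdry t B) B"
        using that by (intro cobdry_cong) (auto simp: f1_def)
      moreover have "finite B" using that finW finite_subset by blast
      ultimately show ?thesis
        using cyc[of B] that 0 by (simp add: cobdry_diff cobdry_mult cobdry_cobdry)
    qed
    obtain g where g: "\<And>B. g B \<noteq> 0 \<Longrightarrow> B \<subseteq> W \<and> Suc (card B) = q \<and> nonface missing B"
      and dg: "\<And>B. B \<subseteq> W \<Longrightarrow> cobdry g B = f1 B"
      using nonface_exactD[OF ex[OF W] f1 df1] by blast
    have gT: "g triangle123 = 0"
      using g[of triangle123] triangle_in_C nonface_card_3[of triangle123] by (auto simp: missing_iff)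
    \<comment> \<open>On \<open>W\<close> both \<open>h\<close> minus \<open>c\<close> times
      \<open>t\<close> and \<open>g\<close> are primitives of \<open>f1\<close>, so \<open>x\<close>
      is closed. If the triangle lies in \<open>W\<close>, its value there is 0, since
      \<open>c\<close> is the value of \<open>h\<close> and \<open>g\<close> vanishes on that
      face.\<close>
    define x where "x B = (if B \<subseteq> W then h B - c * t B - g B else 0)" for B
    have x: "B \<subseteq> W \<and> card B = q - 1" if "x B \<noteq> 0" for B
    proof -
      have B: "B \<subseteq> W" using that by (auto simp: x_def split: if_splits)
      have "h B \<noteq> 0 \<or> (c \<noteq> 0 \<and> t B \<noteq> 0) \<or> g B \<noteq> 0"
        using that B by (auto simp: x_def)
      then show ?thesis
        using h[of B] g[of B] c B by (auto simp: t_def split: if_splits)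
    qed
    have dx: "cobdry x B = 0" if "B \<subseteq> W" for B
    proof -
      have "cobdry x B = cobdry (\<lambda>B. h B - c * t B - g B) B"
        using that by (intro cobdry_cong) (auto simp: x_def)
      then show ?thesis
        using dh[of B] dg[of B] that 0 by (simp add: cobdry_diff cobdry_mult f1_def)
    qed
    obtain k where k: "\<And>B. k B \<noteq> 0 \<Longrightarrow> B \<subseteq> W \<and> Suc (card B) = q - 1"
      and dk: "\<And>B. B \<subseteq> W \<Longrightarrow> cobdry k B = x B"
      using simplex_exact[OF finW _ x dx] True by blast
    \<comment> \<open>The values on edges at \<open>0\<close> make \<open>cobdry k1\<close> vanish on the three new triangles.\<close>
    define k1 where "k1 A = (if 0 \<notin> A then k A else if A = {0, 2} then k {1, 2}
      else if A = {0, 3} then (if 1 \<in> W then k {1, 3} else k {2, 3}) else 0)" for A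
    define g1 where "g1 B = (if B \<subseteq> W' then h B - cobdry k1 B else 0)" for B
    have "cobdry g1 B = f B" if "B \<subseteq> W'" for B
    proof -
      have "cobdry g1 B = cobdry (\<lambda>B. h B - cobdry k1 B) B"
        using that by (intro cobdry_cong) (auto simp: g1_def)
      moreover have "finite B" using that finW' finite_subset by blast
      ultimately show ?thesis
        using dh[OF that] by (simp add: cobdry_diff cobdry_cobdry)
    qed
    moreover have "B \<subseteq> W' \<and> Suc (card B) = q \<and> nonface missing' B" if nz: "g1 B \<noteq> 0" for B
    proof (cases "0 \<in> B")
      case False
      have B: "B \<subseteq> W'" using nz by (auto simp: g1_def split: if_splits)
      then have BW: "B \<subseteq> W" using False by (auto simp: W_def)
      have "cobdry k1 B = cobdry k B"
        using False by (intro cobdry_cong) (auto simp: k1_def)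
      then have "g1 B = c * t B + g B"
        using dk[OF BW] B BW by (simp add: g1_def x_def)
      then have "(c \<noteq> 0 \<and> t B \<noteq> 0) \<or> g B \<noteq> 0" using nz by auto
      then show ?thesis
      proof
        assume "c \<noteq> 0 \<and> t B \<noteq> 0"
        then have "B = triangle123" "q = 4" using c by (auto simp: t_def split: if_splits)
        then show ?thesis using B triangle_in_missing' by (auto simp: nonface_def)
      next
        assume "g B \<noteq> 0"
        then show ?thesis using g[of B] NN'[of B] B by blast
      qed
    next
      case 0: True
      have B: "B \<subseteq> W'" using nz by (auto simp: g1_def split: if_splits)
      have finB: "finite B" using B finW' finite_subset by blast
      have dk1: "cobdry k1 B \<noteq> 0" using nz 0 B by (simp add: g1_def h_def)
      then obtain i where i: "i \<in> B" "k1 (B - {i}) \<noteq> 0" using cobdry_neq_0 by blast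
      have k1_card: "Suc (card A) = q - 1" if "k1 A \<noteq> 0" for A
        using that k[of A] k[of "{1, 2}"] k[of "{1, 3}"] k[of "{2, 3}"]
        by (auto simp: k1_def split: if_splits)
      have card_B: "Suc (card B) = q"
        using k1_card[OF i(2)] card_Suc_Diff1[OF finB i(1)] q by simp
      have "nonface missing' B"
      proof (rule ccontr)
        assume N: "\<not> nonface missing' B"
        have Bn: "B \<subseteq> {0..n}" using B W' by blast
        have "card B = 3"
          using nonface'_0[OF Bn 0] N card_B q by linarith
        then have "B \<in> {{0, 1, 2}, {0, 1, 3}, {0, 2, 3}}"
          by (rule not_nonface'_0[OF Bn 0 _ N])
        then consider "B = {0, 1, 2}" | "B = {0, 1, 3}" | "B = {0, 2, 3}" by blast
        then have "cobdry k1 B = 0"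
        proof cases
          case 1
          then show ?thesis by (simp add: cobdry_triple k1_def doubleton_eq_iff)
        next
          case 2
          then have "1 \<in> W" using B by (auto simp: W_def)
          with 2 show ?thesis by (simp add: cobdry_triple k1_def doubleton_eq_iff)
        next
          case 3
          show ?thesis
          proof (cases "1 \<in> W")
            case True
            then have TW: "triangle123 \<subseteq> W" using 3 B by (auto simp: W_def)
            have "cobdry k triangle123 = 0"
              using dk[OF TW] TW gT by (simp add: x_def c_def t_def)
            then have "k {2, 3} - k {1, 3} + k {1, 2} = 0"
              by (simp add: cobdry_triple)
            then show ?thesis
              using 3 True by (simp add: cobdry_triple k1_def doubleton_eq_iff algebra_simps)
          next
            case False
            then have "k {1, 2} = 0" using k[of "{1, 2}"] by auto
            then show ?thesis
              using 3 False by (simp add: cobdry_triple k1_def doubleton_eq_iff)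
          qed
        qed
        then show False using dk1 by contradiction
      qed
      then show ?thesis using B card_B by blast
    qed
    ultimately show ?thesis by blast
  qed
qed

text \<open>If \<open>0\<close> is in \<open>W\<close>, it is a cone apex. Otherwise a primitive
  over \<open>missing'\<close> can fail only by being nonzero on \<open>{1, 2, 3}\<close>, when
  \<open>q = 4\<close>. Then \<open>f\<close> is extended to \<open>insert 0 W\<close> so as to
  vanish on \<open>{0, 1, 2, 3}\<close>; a primitive of the extension is zero on the three new
  faces, hence also on \<open>{1, 2, 3}\<close>.\<close>

lemma subdivision_exact_converse:
  assumes q: "4 \<le> q" and ex: "\<And>W. W \<subseteq> {0..n} \<Longrightarrow> nonface_exact TYPE('a::field) missing' W q"
    and W: "W \<subseteq> {0..n}"
  shows "nonface_exact TYPE('a) missing W q"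
proof (cases "0 \<in> W")
  case True
  have "finite W" using W finite_subset by blast
  then show ?thesis by (rule nonface_exact_cone[OF _ True]) (rule nonface_remove_0)
next
  case 0: False
  have W1: "W \<subseteq> {1..n}"
  proof
    fix i assume "i \<in> W"
    then show "i \<in> {1..n}" using W 0 by (cases i) auto
  qed
  have finW: "finite W" using W finite_subset by blast
  have NN': "nonface missing B \<Longrightarrow> B \<subseteq> W \<Longrightarrow> nonface missing' B" for B
    using nonface'_iff[of B] W1 by blast
  have N'N: "nonface missing' B \<Longrightarrow> B \<subseteq> W \<Longrightarrow> B \<noteq> triangle123 \<Longrightarrow> nonface missing B" for B
    using nonface'_imp[of B] W1 by blast
  show ?thesis
    unfolding nonface_exact_def
  proof (intro allI impI, elim conjE)
    fix f :: "nat set \<Rightarrow> 'a"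
    assume "\<forall>B. f B \<noteq> 0 \<longrightarrow> B \<subseteq> W \<and> card B = q \<and> nonface missing B" "\<forall>B\<subseteq>W. cobdry f B = 0"
    then have f: "f B \<noteq> 0 \<Longrightarrow> B \<subseteq> W \<and> card B = q \<and> nonface missing B"
      and cyc: "B \<subseteq> W \<Longrightarrow> cobdry f B = 0" for B
      by blast+
    show "\<exists>g. (\<forall>B. g B \<noteq> 0 \<longrightarrow> B \<subseteq> W \<and> Suc (card B) = q \<and> nonface missing B) \<and> (\<forall>B\<subseteq>W. cobdry g B = f B)"
    proof (cases "q = 4 \<and> triangle123 \<subseteq> W")
      case False
      have fN: "f B \<noteq> 0 \<Longrightarrow> B \<subseteq> W \<and> card B = q \<and> nonface missing' B" for B
        using f[of B] NN'[of B] by blast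
      obtain g where g: "\<And>B. g B \<noteq> 0 \<Longrightarrow> B \<subseteq> W \<and> Suc (card B) = q \<and> nonface missing' B"
        "\<And>B. B \<subseteq> W \<Longrightarrow> cobdry g B = f B"
        using nonface_exactD[OF ex[OF W] fN cyc] by blast
      \<comment> \<open>The triangle either has the wrong size for \<open>q\<close> or does not lie
        in \<open>W\<close>.\<close>
      have "B \<subseteq> W \<and> Suc (card B) = q \<and> nonface missing B" if "g B \<noteq> 0" for B
      proof -
        have "B \<noteq> triangle123" using g(1)[OF that] False by auto
        then show ?thesis using g(1)[OF that] N'N[of B] by blast
      qed
      then show ?thesis using g(2) by (intro exI[of _ g] conjI) auto
    next
      case True
      then have q4: "q = 4" and TW: "triangle123 \<subseteq> W" by auto
      have W'n: "insert 0 W \<subseteq> {0..n}" using W by auto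
      have "W \<noteq> {}" using TW by blast
      then obtain h where h: "\<And>B. h B \<noteq> 0 \<Longrightarrow> B \<subseteq> W \<and> Suc (card B) = q"
        and dh: "\<And>B. B \<subseteq> W \<Longrightarrow> cobdry h B = f B"
        using simplex_exact[OF finW _ _ cyc, of q] f by blast
      \<comment> \<open>The value on \<open>{0, 2, 3}\<close> is chosen such that \<open>cobdry h1\<close> vanishes on \<open>{0, 1, 2, 3}\<close>.\<close>
      define h1 where "h1 B = (if B = {0, 2, 3} then h triangle123 else h B)" for B
      have dh1: "cobdry h1 B = cobdry h B" if "0 \<notin> B" for B
        using that by (intro cobdry_cong) (auto simp: h1_def)
      \<comment> \<open>This agrees with \<open>f\<close> on subsets of \<open>W\<close> and is
        closed as a coboundary. Its support is admissible at \<open>0\<close> because every 4-set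
        containing \<open>0\<close> is a nonface of \<open>missing'\<close>.\<close>
      define f1 where "f1 B = (if B \<subseteq> insert 0 W then cobdry h1 B else 0)" for B
      have f1: "B \<subseteq> insert 0 W \<and> card B = q \<and> nonface missing' B" if nz: "f1 B \<noteq> 0" for B
      proof -
        have B: "B \<subseteq> insert 0 W" "cobdry h1 B \<noteq> 0" using nz by (auto simp: f1_def split: if_splits)
        have finB: "finite B" using B(1) finW finite_subset by blast
        obtain i where i: "i \<in> B" "h1 (B - {i}) \<noteq> 0" using cobdry_neq_0[OF B(2)] by blast
        have "card A = 3" if "h1 A \<noteq> 0" for A
          using h[of A] q4 that by (cases "A = {0, 2, 3}") (auto simp: h1_def)
        from this[OF i(2)] have card_B: "card B = 4" using card_Suc_Diff1[OF finB i(1)] by simp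
        have "nonface missing' B"
        proof (cases "0 \<in> B")
          case True
          then show ?thesis using nonface'_0[OF subset_trans[OF B(1) W'n]] card_B by simp
        next
          case False
          then have BW: "B \<subseteq> W" using B(1) by auto
          then have "f B \<noteq> 0" using dh1[OF False] dh[OF BW] B(2) by simp
          then show ?thesis using f[of B] NN'[of B] by blast
        qed
        then show ?thesis using B(1) card_B q4 by simp
      qed
      have df1: "cobdry f1 B = 0" if "B \<subseteq> insert 0 W" for B
      proof -
        have "cobdry f1 B = cobdry (cobdry h1) B"
          using that by (intro cobdry_cong) (auto simp: f1_def)
        moreover have "finite B" using that finW finite_subset by blast
        ultimately show ?thesis by (simp add: cobdry_cobdry)
      qed
      obtain g where g: "\<And>B. g B \<noteq> 0 \<Longrightarrow> B \<subseteq> insert 0 W \<and> Suc (card B) = q \<and> nonface missing' B"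
        and dg: "\<And>B. B \<subseteq> insert 0 W \<Longrightarrow> cobdry g B = f1 B"
        using nonface_exactD[OF ex[OF W'n] f1 df1] by blast
      have sub: "{0, 1, 2, 3} \<subseteq> insert 0 W" using TW by auto
      have h0: "h B = 0" if "0 \<in> B" for B using h[of B] 0 that by blast
      have "0 \<notin> triangle123" "2 \<notin> {0, 1, 3::nat}" "3 \<notin> {0, 1, 2::nat}" by simp_all
      then have "triangle123 \<noteq> {0, 2, 3}" "{0, 1, 3::nat} \<noteq> {0, 2, 3}" "{0, 1, 2::nat} \<noteq> {0, 2, 3}" by blast+
      then have "h1 triangle123 = h triangle123" "h1 {0, 2, 3} = h triangle123" "h1 {0, 1, 3} = 0" "h1 {0, 1, 2} = 0"
        using h0[of "{0, 1, 3}"] h0[of "{0, 1, 2}"] unfolding h1_def by simp_all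
      then have "f1 {0, 1, 2, 3} = 0"
        using sub unfolding f1_def cobdry_0123 by simp
      moreover have "g {0, 1, 2} = 0" "g {0, 1, 3} = 0" "g {0, 2, 3} = 0"
        using g faces'_0 by blast+
      ultimately have gT: "g triangle123 = 0"
        using dg[OF sub] unfolding cobdry_0123 by simp
      define g1 where "g1 B = (if B \<subseteq> W then g B else 0)" for B
      have "B \<subseteq> W \<and> Suc (card B) = q \<and> nonface missing B" if "g1 B \<noteq> 0" for B
        using that g[of B] N'N[of B] gT by (auto simp: g1_def split: if_splits)
      moreover have "cobdry g1 B = f B" if "B \<subseteq> W" for B
      proof -
        have "cobdry g1 B = cobdry g B"
          using that by (intro cobdry_cong) (auto simp: g1_def)
        also have "\<dots> = cobdry h1 B" using dg[of B] that by (auto simp: f1_def)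
        also have "\<dots> = f B" using dh1[of B] dh[OF that] that 0 by auto
        finally show ?thesis .
      qed
      ultimately show ?thesis by blast
    qed
  qed
qed

text \<open>Below \<open>q = 3\<close> there are no nonfaces. At \<open>q = 3\<close> both sides
  hold: for \<open>W\<close> a single missing circuit, its indicator is a cocycle without primitive,
  as no nonface has two elements. Such a circuit exists by assumption for \<open>missing\<close>,
  and is \<open>{1, 2, 3}\<close> for \<open>missing'\<close>.\<close>

lemma nonface_exact_subdivision_iff:
  assumes "missing \<noteq> {}"
  shows "(\<exists>W\<subseteq>{0..n}. \<not> nonface_exact TYPE('a::field) missing W q) \<longleftrightarrow> (\<exists>W\<subseteq>{0..n}. \<not> nonface_exact TYPE('a) missing' W q)"
proof -
  have three: "\<not> nonface_exact TYPE('a) E F 3" if F: "F \<in> E" "card F = 3"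
    and E: "\<And>B. finite B \<Longrightarrow> nonface E B \<Longrightarrow> 3 \<le> card B" for E F
  proof
    have finF: "finite F" using F(2) card.infinite by fastforce
    define f where "f B = (if B = F then 1 else 0 :: 'a)" for B
    assume exact: "nonface_exact TYPE('a) E F 3"
    have f: "f B \<noteq> 0 \<Longrightarrow> B \<subseteq> F \<and> card B = 3 \<and> nonface E B" for B
      using F by (auto simp: f_def nonface_def split: if_splits)
    have df: "cobdry f B = 0" if "B \<subseteq> F" for B
      using that by (auto simp: cobdry_def f_def intro!: sum.neutral)
    obtain g where g: "\<And>B. g B \<noteq> 0 \<Longrightarrow> B \<subseteq> F \<and> Suc (card B) = 3 \<and> nonface E B"
      and dg: "\<And>B. B \<subseteq> F \<Longrightarrow> cobdry g B = f B"
      using nonface_exactD[OF exact f df] by blast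
    have "g B = 0" for B
    proof (rule ccontr)
      assume "g B \<noteq> 0"
      then have "B \<subseteq> F" "Suc (card B) = 3" "nonface E B" using g by blast+
      then show False using E[of B] finF finite_subset by fastforce
    qed
    then show False using dg[of F] by (simp add: cobdry_def f_def)
  qed
  consider "q < 3" | "q = 3" | "4 \<le> q" by linarith
  then show ?thesis
  proof cases
    case 1
    have "nonface_exact TYPE('a) missing W q" "nonface_exact TYPE('a) missing' W q" if "W \<subseteq> {0..n}" for W
      using 1 that by (auto intro!: nonface_exact_trivial dest!: nonface_card[rotated] nonface'_card[rotated]
          dest: finite_subset)
    then show ?thesis by blast
  next
    case 2
    obtain F where "F \<in> missing" using assms by blast
    then have "F \<subseteq> {0..n}" "\<not> nonface_exact TYPE('a) missing F q"
      using three[of F missing] nonface_card 2 by (auto simp: missing_iff)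
    moreover have "triangle123 \<subseteq> {0..n}" "\<not> nonface_exact TYPE('a) missing' triangle123 q"
      using three[OF triangle_in_missing'] nonface'_card 2 n_ge_3 by auto
    ultimately show ?thesis by blast
  next
    case 3
    have sub: "W \<subseteq> {0..n}" if "W \<subseteq> {1..n}" for W using that by auto
    have "(\<forall>W\<subseteq>{0..n}. nonface_exact TYPE('a) missing W q) \<longleftrightarrow> (\<forall>W\<subseteq>{0..n}. nonface_exact TYPE('a) missing' W q)"
    proof (intro iffI allI impI)
      show "nonface_exact TYPE('a) missing' W' q"
        if "\<forall>W\<subseteq>{0..n}. nonface_exact TYPE('a) missing W q" "W' \<subseteq> {0..n}" for W'
        using that sub by (intro subdivision_exact[OF 3]) blast+
      show "nonface_exact TYPE('a) missing W q"
        if "\<forall>W\<subseteq>{0..n}. nonface_exact TYPE('a) missing' W q" "W \<subseteq> {0..n}" for W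
        using that by (intro subdivision_exact_converse[OF 3]) blast+
    qed
    then show ?thesis by blast
  qed
qed

end

theorem theorem3p15:
  fixes n :: nat and F :: "nat set" and C C1 C' :: "nat set set"
    and I J :: "'a::field mpoly set"
  assumes "three_uniform_clutter {1..n} C"
    and "F = {1, 2, 3}" and "F \<in> C"
    and "\<forall>r. 3 < r \<and> r \<le> n \<longrightarrow> \<not> {{1, 2, r}, {1, 3, r}, {2, 3, r}} \<subseteq> C"
    and "C1 = C - {F}"
    and "C' = C1 \<union> {{0, 1, 2}, {0, 1, 3}, {0, 2, 3}}"
    and "I = circuit_ideal n (clutter_complement {1..n} C)"
    and "J = circuit_ideal n (clutter_complement {0..n} C')"
    and "I \<noteq> {0}"
  shows "cm_regularity n I = cm_regularity n J"
proof -
  let ?D = "clutter_complement {1..n} C" and ?D' = "clutter_complement {0..n} C'"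
  have D: "F \<subseteq> {0..n}" if "F \<in> ?D" for F
    using that by (auto simp: clutter_complement_def three_subsets_def)
  have D': "F \<subseteq> {0..n}" if "F \<in> ?D'" for F
    using that by (auto simp: clutter_complement_def three_subsets_def)
  \<comment> \<open>Without a missing circuit the ideal contains no monomial and is zero, contrary
    to the assumption on \<open>I\<close>.\<close>
  have "?D \<noteq> {}"
  proof
    assume "?D = {}"
    have "I = monomial_ideal (ideal_monomials n ?D)"
      unfolding assms(7) by (rule circuit_ideal_eq[OF D])
    then have "I = monomial_ideal {}"
      unfolding \<open>?D = {}\<close> by (simp add: ideal_monomials_def nonface_def)
    then show False using assms(9) by (simp add: monomial_ideal_def)
  qed
  then have "(\<exists>W\<subseteq>{0..n}. \<not> nonface_exact TYPE('a) ?D W q) \<longleftrightarrow> (\<exists>W\<subseteq>{0..n}. \<not> nonface_exact TYPE('a) ?D' W q)" for q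
    using nonface_exact_subdivision_iff[of C n q, where 'a='a] assms(1-6)
    by (auto simp: three_uniform_clutter_def missing_def missing'_def subdivided_def)
  moreover have "cm_regularity n I = Sup {ereal (real q) | q. \<exists>W\<subseteq>{0..n}. \<not> nonface_exact TYPE('a) ?D W q}"
    unfolding assms(7) by (rule cm_regularity_circuit_ideal[OF D])
  moreover have "cm_regularity n J = Sup {ereal (real q) | q. \<exists>W\<subseteq>{0..n}. \<not> nonface_exact TYPE('a) ?D' W q}"
    unfolding assms(8) by (rule cm_regularity_circuit_ideal[OF D'])
  ultimately show ?thesis by simp
qed

end
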